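(* Let $\kappa>0$, $R>0$, let $\boldsymbol J\in H(\mathrm{div};\mathrm{grad};B_R)$ be a source with compact support contained in $B_R$, and let $\boldsymbol E$ be the electric field it generates. For $\xi\in\mathbb R^3$ with $|\xi|=\kappa$ define $$\boldsymbol V(\xi)=\int_{\partial B_R}\big[\boldsymbol E(y)\,(\mathrm i\xi\cdot\boldsymbol n(y))-\nabla\boldsymbol E(y)\boldsymbol n(y)\big]e^{-\mathrm i\xi\cdot y}\,\mathrm ds_y .$$ Then $\boldsymbol J$ is nonradiating if and only if $\boldsymbol V(\xi)=0$ for all $\xi$ with $|\xi|=\kappa$.
   Context: $B_R=\{x\in\mathbb R^3:|x|<R\}$, $\boldsymbol n$ is the unit normal on $\partial B_R$ pointing outward from $B_R$, and $\nabla\boldsymbol E\,\boldsymbol n$ is the Jacobian matrix of $\boldsymbol E$ applied to $\boldsymbol n$ (the normal derivative of $\boldsymbol E$). $\kappa>0$ is the wavenumber, $g(x,y)=\frac{e^{\mathrm i\kappa|x-y|}}{4\pi|x-y|}$, and $\boldsymbol G(x,y)=[\boldsymbol I+\kappa^{-2}\nabla\nabla]g(x,y)$ is the $3\times3$ dyadic Green's tensor of Maxwell's equations ($\nabla\nabla$ is the Hessian). The electric field generated by $\boldsymbol J$ is $\boldsymbol E(x)=\int_{B_R}\boldsymbol G(x,y)\boldsymbol J(y)\,\mathrm dy$, the solution of $\nabla\times(\nabla\times\boldsymbol E)-\kappa^2\boldsymbol E=\boldsymbol J$ satisfying the Silver--Müller radiation condition. A source $\boldsymbol J$ with compact support contained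 in $B_R$ is called nonradiating if this $\boldsymbol E$ is identically zero outside $B_R$. $H(\mathrm{div};\mathrm{grad};B_R)=\{\boldsymbol\Psi\in(L^2(B_R))^3:\nabla(\nabla\cdot\boldsymbol\Psi)\in(L^2(B_R))^3\}$. *)

theory Defs
  imports "HOL-Analysis.Analysis"
begin

definition partial :: "3 \<Rightarrow> (real^3 \<Rightarrow> complex) \<Rightarrow> real^3 \<Rightarrow> complex" where
  "partial i f x = frechet_derivative f (at x) (axis i 1)"

text \<open>All iterated partial derivatives exist and are Frechet differentiable (hence continuous)
  everywhere, which is \<open>C\<^sup>\<infinity>\<close> regularity.\<close>

definition smooth :: "(real^3 \<Rightarrow> complex) \<Rightarrow> bool" where
  "smooth f \<longleftrightarrow> (\<forall>is x. foldr partial is f differentiable (at x))"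

definition test_functions :: "(real^3) set \<Rightarrow> (real^3 \<Rightarrow> complex) set" where
  "test_functions S =
     {\<phi>. smooth \<phi> \<and> compact (closure {x. \<phi> x \<noteq> 0}) \<and> closure {x. \<phi> x \<noteq> 0} \<subseteq> S}"

text \<open>The support of a function that is only relevant up to null sets: the complement of the
  largest open set on which it vanishes almost everywhere.\<close>

definition ess_support :: "(real^3 \<Rightarrow> complex^3) \<Rightarrow> (real^3) set" where
  "ess_support f =
     - \<Union>{U. open U \<and> (AE y in lebesgue. y \<in> U \<longrightarrow> f y = 0)}"

definition L2_fields :: "(real^3) set \<Rightarrow> (real^3 \<Rightarrow> complex^3) set" where
  "L2_fields S = {f. f \<in> borel_measurable (lebesgue_on S) \<and>
     integrable (lebesgue_on S) (\<lambda>x. (norm (f x))\<^sup>2)}"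

text \<open>Distributions on \<open>S\<close> are represented by their values on \<open>test_functions S\<close>. The pairing is
  bilinear (no complex conjugation).\<close>

definition distr_of :: "(real^3) set \<Rightarrow> (real^3 \<Rightarrow> complex) \<Rightarrow> (real^3 \<Rightarrow> complex) \<Rightarrow> complex" where
  "distr_of S f \<phi> = (LINT x:S|lebesgue. f x * \<phi> x)"

definition distr_partial ::
    "3 \<Rightarrow> ((real^3 \<Rightarrow> complex) \<Rightarrow> complex) \<Rightarrow> (real^3 \<Rightarrow> complex) \<Rightarrow> complex" where
  "distr_partial i T \<phi> = - T (partial i \<phi>)"

definition distr_div :: "(real^3) set \<Rightarrow> (real^3 \<Rightarrow> complex^3) \<Rightarrow> (real^3 \<Rightarrow> complex) \<Rightarrow> complex" where
  "distr_div S \<Psi> \<phi> = (\<Sum>j\<in>UNIV. distr_partial j (distr_of S (\<lambda>x. \<Psi> x $ j)) \<phi>)"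

definition H_div_grad :: "(real^3) set \<Rightarrow> (real^3 \<Rightarrow> complex^3) set" where
  "H_div_grad S = {\<Psi> \<in> L2_fields S. \<exists>W \<in> L2_fields S.
     \<forall>i. \<forall>\<phi> \<in> test_functions S.
       distr_partial i (distr_div S \<Psi>) \<phi> = distr_of S (\<lambda>x. W x $ i) \<phi>}"

definition helmholtz_green :: "real \<Rightarrow> real^3 \<Rightarrow> real^3 \<Rightarrow> complex" where
  "helmholtz_green \<kappa> x y = exp (\<i> * of_real (\<kappa> * dist x y)) / of_real (4 * pi * dist x y)"

definition maxwell_green :: "real \<Rightarrow> real^3 \<Rightarrow> real^3 \<Rightarrow> complex^3^3" where
  "maxwell_green \<kappa> x y = (\<chi> i j.
     (if i = j then helmholtz_green \<kappa> x y else 0) +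
     partial i (partial j (\<lambda>z. helmholtz_green \<kappa> z y)) x / of_real (\<kappa>\<^sup>2))"

text \<open>Since \<open>maxwell_green\<close> has a singularity of order \<open>dist x y powr (-3)\<close>, the integral converges absolutely
  only for \<open>x\<close> off the support of \<open>J\<close>; at other points the value below is not meaningful
  in general. For \<open>J\<close> compactly supported in \<open>ball 0 R\<close>, the points off the support include the
  complement of \<open>ball 0 R\<close> and a neighbourhood of the sphere \<open>sphere 0 R\<close>, and only these are used.\<close>

definition electric_field :: "real \<Rightarrow> real \<Rightarrow> (real^3 \<Rightarrow> complex^3) \<Rightarrow> real^3 \<Rightarrow> complex^3" where
  "electric_field \<kappa> R J x = (LINT y:ball 0 R|lebesgue. maxwell_green \<kappa> x y *v J y)"

definition nonradiating :: "real \<Rightarrow> real \<Rightarrow> (real^3 \<Rightarrow> complex^3) \<Rightarrow> bool" where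
  "nonradiating \<kappa> R J \<longleftrightarrow> (\<forall>x. x \<notin> ball 0 R \<longrightarrow> electric_field \<kappa> R J x = 0)"

text \<open>Surface integral over \<open>sphere 0 R\<close> in spherical coordinates, with surface element
  \<open>R\<^sup>2 sin \<theta> d\<theta> d\<phi>\<close>.\<close>

definition spherical_point :: "real \<Rightarrow> real \<Rightarrow> real \<Rightarrow> real^3" where
  "spherical_point R \<theta> \<phi> =
     R *\<^sub>R vector [sin \<theta> * cos \<phi>, sin \<theta> * sin \<phi>, cos \<theta>]"

definition sphere_integral :: "real \<Rightarrow> (real^3 \<Rightarrow> complex^3) \<Rightarrow> complex^3" where
  "sphere_integral R f =
     (LINT (\<theta>, \<phi>):{0..pi} \<times> {0..2 * pi}|lborel.
        (R\<^sup>2 * sin \<theta>) *\<^sub>R f (spherical_point R \<theta> \<phi>))"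

definition unit_normal :: "real \<Rightarrow> real^3 \<Rightarrow> real^3" where
  "unit_normal R y = y /\<^sub>R R"

text \<open>The Jacobian matrix of \<open>E\<close> at \<open>y\<close>, applied to the normal, is
  \<open>frechet_derivative E (at y) (unit_normal R y)\<close>.\<close>

definition V_field :: "real \<Rightarrow> (real^3 \<Rightarrow> complex^3) \<Rightarrow> real^3 \<Rightarrow> complex^3" where
  "V_field R E \<xi> = sphere_integral R (\<lambda>y.
     exp (- \<i> * of_real (\<xi> \<bullet> y)) *s
       ((\<i> * of_real (\<xi> \<bullet> unit_normal R y)) *s E y
        - frechet_derivative E (at y) (unit_normal R y)))"

end

theory Submission
  imports Defs
begin

text \<open>
Let \<open>e\<close> be a Cartesian component of the electric field. Off the support of the source it is an integral of
smooth kernels, so for \<open>norm x > \<rho>\<close>, with some \<open>\<rho> < R\<close>, it is twice continuously differentiable, solves the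
Helmholtz equation and is outgoing (\<open>source.radiating_potential\<close>, \<open>electric_field_nth\<close>). If \<open>e\<close> vanishes outside
the ball then so do its radial derivatives on the sphere, and \<open>V_field\<close> is zero. The content lies in
the converse, which is a statement about a single scalar field: the theorem
\<open>radiating_field.zero_outside\<close>.

With \<open>u(y) = exp (- \<i> (\<xi> \<bullet> y))\<close> the integrand of \<open>V_field\<close> is \<open>- (e \<partial>\<^sub>n u + u \<partial>\<^sub>n e)\<close>, the normal derivative of
\<open>- e u\<close>. Both terms carry the same sign, so this is not the combination in Green's second identity and
\<open>V_field\<close> is not a far field pattern. It is analysed degree by degree instead. In terms of spherical
harmonics, \<open>e\<close> is a sum of terms \<open>c h\<^sub>l(\<kappa> r) Y\<^sub>l\<close> with outgoing spherical Hankel functions \<open>h\<^sub>l\<close>, while \<open>u\<close> is a sum of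
terms \<open>j\<^sub>l(\<kappa> r) Y\<^sub>l\<close> with spherical Bessel functions \<open>j\<^sub>l\<close>, hence the vanishing of \<open>V_field\<close> for \<open>norm \<xi> = \<kappa>\<close> means that
\<open>c (h\<^sub>l j\<^sub>l)'(\<kappa> R) = 0\<close> for each term. The derivative \<open>(h\<^sub>l j\<^sub>l)'\<close> has no positive zero: its real part is \<open>2 j\<^sub>l j\<^sub>l'\<close>,
and where that vanishes the imaginary part is nonzero by the Wronskian of \<open>j\<^sub>l\<close> and the spherical Neumann function. So all the \<open>c\<close> vanish.

The formal argument uses neither spherical harmonics nor Hankel functions. It works with the zonal moments
\<open>A\<^sub>k(r)\<close>, the integral of \<open>e (r \<omega>) (\<omega> \<bullet> \<eta>)\<^sup>k\<close> over the unit sphere for a fixed unit vector \<open>\<eta>\<close>, by induction on \<open>k\<close>.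

\<^item> Green's identity on the sphere (\<open>surf_green\<close>) turns the Helmholtz equation for \<open>e\<close> into an ordinary
differential equation for \<open>A\<^sub>k\<close> with inhomogeneity a multiple of \<open>A\<^sub>k\<^sub>-\<^sub>2\<close>, which is zero by induction
(\<open>radiating_field.moment_ode\<close>).

\<^item> Integrating \<open>V_field\<close> against \<open>(\<xi> \<bullet> \<eta>)\<^sup>k\<close> over the directions of \<open>\<xi>\<close> replaces the plane wave by its zonal moment, a
polynomial of degree \<open>k\<close> in \<open>\<omega> \<bullet> \<eta>\<close> whose leading coefficient is a constant times a real function of \<open>r\<close>
(\<open>plane_wave_moment_expansion\<close>). The lower coefficients meet moments that are already zero, and what remains
is a real linear relation between \<open>A\<^sub>k(R)\<close> and \<open>A\<^sub>k'(R)\<close> (\<open>radiating_field.boundary_relation\<close>).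

\<^item> The radial energy flux of a solution of the radial equation is independent of \<open>r\<close>. A real boundary relation
makes it zero, and an outgoing solution without flux vanishes (\<open>outgoing_ode_zero\<close>).

\<^item> Finally the moments for all \<open>\<eta>\<close> and \<open>k\<close> determine \<open>e\<close> on each sphere, since the polynomials
\<open>((1 + \<omega> \<bullet> \<eta>) / 2)\<^sup>n\<close> concentrate at \<open>\<eta>\<close> (\<open>zero_of_surf_moments_zero\<close>).
\<close>

section \<open>Integration over the unit sphere\<close>

abbreviation sph :: "real \<Rightarrow> real \<Rightarrow> real^3" where
  "sph \<equiv> spherical_point 1"

lemma sph_axis:
  "sph \<theta> \<phi> = (sin \<theta> * cos \<phi>) *\<^sub>R axis 1 1 + (sin \<theta> * sin \<phi>) *\<^sub>R axis 2 1 + cos \<theta> *\<^sub>R axis 3 1"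
  by (simp add: spherical_point_def vec_eq_iff forall_3 axis_def)

lemma sph_nth [simp]:
  "sph \<theta> \<phi> $ 1 = sin \<theta> * cos \<phi>" "sph \<theta> \<phi> $ 2 = sin \<theta> * sin \<phi>" "sph \<theta> \<phi> $ 3 = cos \<theta>"
  by (simp_all add: spherical_point_def)

lemma spherical_point_scaleR: "spherical_point R \<theta> \<phi> = R *\<^sub>R sph \<theta> \<phi>"
  by (simp add: spherical_point_def)

lemma norm_sph [simp]: "norm (sph \<theta> \<phi>) = 1"
proof -
  have "(sin \<theta> * cos \<phi>)\<^sup>2 + (sin \<theta> * sin \<phi>)\<^sup>2 + (cos \<theta>)\<^sup>2 = (sin \<theta>)\<^sup>2 * ((cos \<phi>)\<^sup>2 + (sin \<phi>)\<^sup>2) + (cos \<theta>)\<^sup>2"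
    by algebra
  also have "\<dots> = 1" by simp
  finally show ?thesis
    by (simp add: norm_vec_def L2_set_def sum_3)
qed

lemma continuous_on_sph [continuous_intros]:
  fixes f g :: "'a::t2_space \<Rightarrow> real"
  shows "continuous_on A f \<Longrightarrow> continuous_on A g \<Longrightarrow> continuous_on A (\<lambda>z. sph (f z) (g z))"
  unfolding sph_axis by (intro continuous_intros)

text \<open>The surface integral over the unit sphere in spherical coordinates, as a gauge integral over a box, where
differentiation under the integral sign and the exchange of integrals of continuous functions are at hand.\<close>

definition surf :: "(real^3 \<Rightarrow> complex) \<Rightarrow> complex" where
  "surf f = integral (cbox (0,0) (pi, 2*pi)) (\<lambda>(\<theta>, \<phi>). sin \<theta> *\<^sub>R f (sph \<theta> \<phi>))"

lemma continuous_on_surf_integrand: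
  fixes f :: "real^3 \<Rightarrow> complex"
  assumes "continuous_on (sphere 0 1) f"
  shows "continuous_on A (\<lambda>(\<theta>, \<phi>). sin \<theta> *\<^sub>R f (sph \<theta> \<phi>))"
  unfolding case_prod_beta
  by (intro continuous_intros continuous_on_compose2[OF assms]) auto

lemma surf_integrable:
  fixes f :: "real^3 \<Rightarrow> complex"
  assumes "continuous_on (sphere 0 1) f"
  shows "(\<lambda>(\<theta>, \<phi>). sin \<theta> *\<^sub>R f (sph \<theta> \<phi>)) integrable_on cbox (0,0) (pi, 2*pi)"
  by (rule integrable_continuous[OF continuous_on_surf_integrand[OF assms]])

lemma surf_cong: "(\<And>\<omega>. norm \<omega> = 1 \<Longrightarrow> f \<omega> = g \<omega>) \<Longrightarrow> surf f = surf g"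
  unfolding surf_def by (intro integral_cong) auto

lemma surf_add:
  assumes "continuous_on (sphere 0 1) f" "continuous_on (sphere 0 1) g"
  shows "surf (\<lambda>\<omega>. f \<omega> + g \<omega>) = surf f + surf g"
  unfolding surf_def integral_add[OF surf_integrable[OF assms(1)] surf_integrable[OF assms(2)], symmetric]
  by (intro integral_cong) (auto simp: scaleR_add_right)

lemma surf_cmul:
  "surf (\<lambda>\<omega>. c * f \<omega>) = c * surf f"
  unfolding surf_def integral_mult_right[symmetric] by (intro integral_cong) auto

lemma surf_minus: "surf (\<lambda>\<omega>. - f \<omega>) = - surf f"
  using surf_cmul[of "-1" f] by simp

lemma surf_diff:
  assumes "continuous_on (sphere 0 1) f" "continuous_on (sphere 0 1) g"
  shows "surf (\<lambda>\<omega>. f \<omega> - g \<omega>) = surf f - surf g"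
  using surf_add[OF assms(1) continuous_on_minus[OF assms(2)]] by (simp add: surf_minus)

lemma surf_zero [simp]: "surf (\<lambda>\<omega>. 0) = 0"
  using surf_cmul[of 0 "\<lambda>_. 0"] by simp

lemma surf_sum:
  assumes "finite I" "\<And>i. i \<in> I \<Longrightarrow> continuous_on (sphere 0 1) (f i)"
  shows "surf (\<lambda>\<omega>. \<Sum>i\<in>I. f i \<omega>) = (\<Sum>i\<in>I. surf (f i))"
  using assms by (induction I rule: finite_induct) (auto simp: surf_add continuous_on_sum)

lemma surf_of_real_norm_le:
  assumes f: "continuous_on (sphere 0 1) f" and g: "continuous_on (sphere 0 1) g"
    and le: "\<And>\<omega>. norm \<omega> = 1 \<Longrightarrow> norm (f \<omega>) \<le> g \<omega>"
  shows "norm (surf f) \<le> Re (surf (\<lambda>\<omega>. of_real (g \<omega>)))"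
proof -
  have g': "continuous_on (sphere 0 1) (\<lambda>\<omega>. complex_of_real (g \<omega>))"
    by (intro continuous_intros g)
  have "norm (surf f) \<le> integral (cbox (0,0) (pi, 2*pi)) (\<lambda>z. Re ((\<lambda>(\<theta>, \<phi>). sin \<theta> *\<^sub>R complex_of_real (g (sph \<theta> \<phi>))) z))"
    unfolding surf_def
  proof (intro integral_norm_bound_integral surf_integrable[OF f])
    show "(\<lambda>z. Re ((\<lambda>(\<theta>, \<phi>). sin \<theta> *\<^sub>R complex_of_real (g (sph \<theta> \<phi>))) z)) integrable_on cbox (0, 0) (pi, 2 * pi)"
      using integrable_linear[OF surf_integrable[OF g'] bounded_linear_Re] by (simp add: o_def)
  qed (auto simp: sin_ge_zero intro!: mult_left_mono le)
  also have "\<dots> = Re (surf (\<lambda>\<omega>. of_real (g \<omega>)))"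
    using integral_linear[OF surf_integrable[OF g'] bounded_linear_Re]
    by (simp add: surf_def o_def)
  finally show ?thesis .
qed

lemma surf_one: "surf (\<lambda>_. 1) = 4 * pi"
proof -
  have "surf (\<lambda>_. 1) = integral (cbox 0 pi) (\<lambda>\<theta>. integral (cbox 0 (2*pi)) (\<lambda>\<phi>::real. complex_of_real (sin \<theta>)))"
    unfolding surf_def
    by (subst integral_prod_continuous[OF continuous_on_surf_integrand])
       (auto simp: scaleR_conv_of_real intro!: continuous_intros)
  also have "\<dots> = integral {0..pi} (\<lambda>\<theta>. 2 * pi * complex_of_real (sin \<theta>))"
    by (simp add: scaleR_conv_of_real)
  also have "((\<lambda>\<theta>. 2 * pi * complex_of_real (sin \<theta>)) has_integral
      (2 * pi * complex_of_real (- cos pi) - 2 * pi * complex_of_real (- cos 0))) {0..pi}"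
  proof (intro fundamental_theorem_of_calculus)
    fix x :: real
    have "((\<lambda>x. - cos x) has_real_derivative sin x) (at x within {0..pi})"
      by (auto intro!: derivative_eq_intros)
    then have "((\<lambda>x. complex_of_real (- cos x)) has_vector_derivative complex_of_real (sin x)) (at x within {0..pi})"
      using bounded_linear.has_vector_derivative[OF bounded_linear_of_real, of "\<lambda>x. - cos x" "sin x"]
      by (simp only: has_real_derivative_iff_has_vector_derivative)
    then show "((\<lambda>x. 2 * pi * complex_of_real (- cos x)) has_vector_derivative 2 * pi * complex_of_real (sin x)) (at x within {0..pi})"
      by (auto intro!: derivative_eq_intros)
  qed auto
  then have "integral {0..pi} (\<lambda>\<theta>. 2 * pi * complex_of_real (sin \<theta>)) = 4 * pi"
    by (intro integral_unique) simp
  finally show ?thesis by simp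
qed

lemma surf_swap:
  assumes "continuous_on (sphere 0 1 \<times> sphere 0 1) (\<lambda>(x, y). f x y)"
  shows "surf (\<lambda>x. surf (\<lambda>y. f x y)) = surf (\<lambda>y. surf (\<lambda>x. f x y))"
proof -
  let ?g = "\<lambda>(z::real\<times>real) (w::real\<times>real). (sin (fst z) * sin (fst w)) *\<^sub>R f (sph (fst z) (snd z)) (sph (fst w) (snd w))"
  let ?B = "cbox (0,0) (pi, 2*pi)"
  have cf: "continuous_on A (\<lambda>p. f (sph (fst (fst p)) (snd (fst p))) (sph (fst (snd p)) (snd (snd p))))" for A
  proof -
    have "continuous_on A (\<lambda>p. (sph (fst (fst p)) (snd (fst p)), sph (fst (snd p)) (snd (snd p))))"
      by (intro continuous_intros)
    from continuous_on_compose2[OF assms this] show ?thesis by (simp add: image_subset_iff)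
  qed
  have cont: "continuous_on A (\<lambda>(z, w). ?g z w)" for A
    unfolding case_prod_beta by (intro continuous_intros cf)
  have "surf (\<lambda>x. surf (\<lambda>y. f x y)) = integral ?B (\<lambda>z. integral ?B (?g z))"
    unfolding surf_def case_prod_beta by (simp flip: integral_cmul)
  also have "\<dots> = integral ?B (\<lambda>w. integral ?B (\<lambda>z. ?g z w))"
    by (rule integral_swap_continuous) (rule cont)
  also have "\<dots> = surf (\<lambda>y. surf (\<lambda>x. f x y))"
    unfolding surf_def case_prod_beta by (simp flip: integral_cmul add: mult.commute)
  finally show ?thesis .
qed

lemma has_vector_derivative_surf:
  assumes deriv: "\<And>t \<omega>. t \<in> I \<Longrightarrow> norm \<omega> = 1 \<Longrightarrow>
      ((\<lambda>t. f t \<omega>) has_vector_derivative f' t \<omega>) (at t within I)"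
    and cf: "\<And>t. t \<in> I \<Longrightarrow> continuous_on (sphere 0 1) (f t)"
    and cf': "continuous_on (I \<times> sphere 0 1) (\<lambda>(t, \<omega>). f' t \<omega>)"
    and I: "t \<in> I" "convex I"
  shows "((\<lambda>t. surf (f t)) has_vector_derivative surf (f' t)) (at t within I)"
proof -
  let ?B = "cbox (0,0) (pi, 2*pi) :: (real\<times>real) set"
  have c: "continuous_on A (\<lambda>p. f' (fst p) (sph (fst (snd p)) (snd (snd p))))" if "fst ` A \<subseteq> I" for A
  proof -
    have "continuous_on A (\<lambda>p. (fst p, sph (fst (snd p)) (snd (snd p))))"
      by (intro continuous_intros)
    from continuous_on_compose2[OF cf' this] show ?thesis using that by (simp add: image_subset_iff)
  qed
  have "((\<lambda>t. integral ?B (\<lambda>z. sin (fst z) *\<^sub>R f t (sph (fst z) (snd z)))) has_vector_derivative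
     integral ?B (\<lambda>z. sin (fst z) *\<^sub>R f' t (sph (fst z) (snd z)))) (at t within I)"
  proof (rule leibniz_rule_vector_derivative[OF _ _ _ I])
    show "continuous_on (I \<times> ?B) (\<lambda>(x, z). sin (fst z) *\<^sub>R f' x (sph (fst z) (snd z)))"
      unfolding case_prod_beta by (intro continuous_intros c) auto
    show "(\<lambda>z. sin (fst z) *\<^sub>R f x (sph (fst z) (snd z))) integrable_on ?B" if "x \<in> I" for x
      using surf_integrable[OF cf[OF that]] by (simp add: case_prod_beta')
    show "((\<lambda>x. sin (fst z) *\<^sub>R f x (sph (fst z) (snd z))) has_vector_derivative
         sin (fst z) *\<^sub>R f' x (sph (fst z) (snd z))) (at x within I)" if "x \<in> I" for x z
      by (rule bounded_linear.has_vector_derivative[OF bounded_linear_scaleR_right deriv]) (use that in auto)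
  qed
  then show ?thesis by (simp add: surf_def case_prod_beta')
qed

section \<open>Rotational invariance\<close>

lemma integral_box_deriv_fst:
  fixes P P' :: "real \<Rightarrow> real \<Rightarrow> complex"
  assumes P: "\<And>x y. ((\<lambda>x. P x y) has_vector_derivative P' x y) (at x)"
    and cP: "continuous_on UNIV (\<lambda>(x,y). P' x y)" and ab: "a \<le> b" "\<And>y. P a y = P b y"
  shows "integral (cbox (a,c) (b,d)) (\<lambda>(x,y). P' x y) = 0"
proof -
  have cP': "continuous_on A (\<lambda>(x,y). P' x y)" for A
    using continuous_on_subset[OF cP subset_UNIV] .
  have "integral (cbox (a,c) (b,d)) (\<lambda>(x,y). P' x y) = integral (cbox a b) (\<lambda>x. integral (cbox c d) (P' x))"
    unfolding integral_prod_continuous[OF cP', of a c b d] split_conv ..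
  also have "\<dots> = integral (cbox c d) (\<lambda>y. integral (cbox a b) (\<lambda>x. P' x y))"
    using integral_swap_continuous[where f=P', OF cP', of a b c d] .
  also have "\<dots> = integral (cbox c d) (\<lambda>y. 0)"
  proof (rule integral_cong)
    fix y
    have "((\<lambda>x. P' x y) has_integral (P b y - P a y)) {a..b}"
      by (rule fundamental_theorem_of_calculus[OF ab(1) has_vector_derivative_at_within[OF P]])
    then show "integral (cbox a b) (\<lambda>x. P' x y) = 0"
      using ab(2)[of y] by (simp only: integral_unique cbox_interval) simp
  qed
  finally show ?thesis by (simp only: integral_0)
qed

lemma integral_box_deriv_snd:
  fixes P P' :: "real \<Rightarrow> real \<Rightarrow> complex"
  assumes P: "\<And>x y. ((\<lambda>y. P x y) has_vector_derivative P' x y) (at y)"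
    and cP: "continuous_on UNIV (\<lambda>(x,y). P' x y)" and cd: "c \<le> d" "\<And>x. P x c = P x d"
  shows "integral (cbox (a,c) (b,d)) (\<lambda>(x,y). P' x y) = 0"
proof -
  have cP': "continuous_on A (\<lambda>(x,y). P' x y)" for A
    using continuous_on_subset[OF cP subset_UNIV] .
  have "integral (cbox (a,c) (b,d)) (\<lambda>(x,y). P' x y) = integral (cbox a b) (\<lambda>x. integral (cbox c d) (P' x))"
    unfolding integral_prod_continuous[OF cP', of a c b d] split_conv ..
  also have "\<dots> = integral (cbox a b) (\<lambda>y. 0)"
  proof (rule integral_cong)
    fix x
    have "((\<lambda>y. P' x y) has_integral (P x d - P x c)) {c..d}"
      by (rule fundamental_theorem_of_calculus[OF cd(1) has_vector_derivative_at_within[OF P]])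
    then show "integral (cbox c d) (P' x) = 0"
      using cd(2)[of x] by (simp only: integral_unique cbox_interval) simp
  qed
  finally show ?thesis by (simp only: integral_0)
qed

text \<open>The derivative is recorded by its three partial derivatives, as functions of the same type as \<open>f\<close>, so that
the notion can be iterated.\<close>

definition grad :: "(real^3) set \<Rightarrow> (real^3 \<Rightarrow> complex) \<Rightarrow> (3 \<Rightarrow> real^3 \<Rightarrow> complex) \<Rightarrow> bool" where
  "grad U f D \<longleftrightarrow> (\<forall>x\<in>U. (f has_derivative (\<lambda>h. \<Sum>i\<in>UNIV. h$i *\<^sub>R D i x)) (at x))"

lemma gradD: "grad U f D \<Longrightarrow> x \<in> U \<Longrightarrow> (f has_derivative (\<lambda>h. \<Sum>i\<in>UNIV. h$i *\<^sub>R D i x)) (at x)"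
  by (simp add: grad_def)

lemma grad_imp_continuous_on: "grad U f D \<Longrightarrow> continuous_on U f"
  by (meson gradD continuous_at_imp_continuous_on has_derivative_continuous)

lemma grad_chain:
  assumes "grad U f D" "c t \<in> U" "(c has_vector_derivative c') (at t within T)"
  shows "((\<lambda>t. f (c t)) has_vector_derivative (\<Sum>i\<in>UNIV. c'$i *\<^sub>R D i (c t))) (at t within T)"
proof -
  have "((\<lambda>t. f (c t)) has_derivative (\<lambda>h. \<Sum>i\<in>UNIV. (h *\<^sub>R c')$i *\<^sub>R D i (c t))) (at t within T)"
    using has_derivative_compose[OF assms(3)[unfolded has_vector_derivative_def] gradD[OF assms(1,2)]] .
  then show ?thesis
    by (simp add: has_vector_derivative_def scaleR_sum_right)
qed

definition sph_\<theta> :: "real \<Rightarrow> real \<Rightarrow> real^3" where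
  "sph_\<theta> \<theta> \<phi> = vector [cos \<theta> * cos \<phi>, cos \<theta> * sin \<phi>, - sin \<theta>]"

definition sph_\<phi> :: "real \<Rightarrow> real \<Rightarrow> real^3" where
  "sph_\<phi> \<theta> \<phi> = vector [- sin \<theta> * sin \<phi>, sin \<theta> * cos \<phi>, 0]"

lemma sph_\<theta>_nth [simp]:
  "sph_\<theta> \<theta> \<phi> $ 1 = cos \<theta> * cos \<phi>" "sph_\<theta> \<theta> \<phi> $ 2 = cos \<theta> * sin \<phi>" "sph_\<theta> \<theta> \<phi> $ 3 = - sin \<theta>"
  by (simp_all add: sph_\<theta>_def)

lemma sph_\<phi>_nth [simp]:
  "sph_\<phi> \<theta> \<phi> $ 1 = - sin \<theta> * sin \<phi>" "sph_\<phi> \<theta> \<phi> $ 2 = sin \<theta> * cos \<phi>" "sph_\<phi> \<theta> \<phi> $ 3 = 0"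
  by (simp_all add: sph_\<phi>_def)

lemma has_vector_derivative_sph_\<theta>: "((\<lambda>\<theta>. sph \<theta> \<phi>) has_vector_derivative sph_\<theta> \<theta> \<phi>) (at \<theta>)"
proof -
  have "((\<lambda>\<theta>. sph \<theta> \<phi>) has_vector_derivative
      (cos \<theta> * cos \<phi>) *\<^sub>R axis 1 1 + (cos \<theta> * sin \<phi>) *\<^sub>R axis 2 1 + (- sin \<theta>) *\<^sub>R axis 3 1) (at \<theta>)"
    unfolding sph_axis
    by (auto intro!: derivative_eq_intros simp: has_real_derivative_iff_has_vector_derivative[symmetric])
  also have "(cos \<theta> * cos \<phi>) *\<^sub>R axis 1 1 + (cos \<theta> * sin \<phi>) *\<^sub>R axis 2 1 + (- sin \<theta>) *\<^sub>R axis 3 1 = sph_\<theta> \<theta> \<phi>"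
    by (simp add: vec_eq_iff forall_3 axis_def)
  finally show ?thesis .
qed

lemma has_vector_derivative_sph_\<phi>: "((\<lambda>\<phi>. sph \<theta> \<phi>) has_vector_derivative sph_\<phi> \<theta> \<phi>) (at \<phi>)"
proof -
  have "((\<lambda>\<phi>. sph \<theta> \<phi>) has_vector_derivative
      (- sin \<theta> * sin \<phi>) *\<^sub>R axis 1 1 + (sin \<theta> * cos \<phi>) *\<^sub>R axis 2 1 + 0 *\<^sub>R axis 3 1) (at \<phi>)"
    unfolding sph_axis
    by (auto intro!: derivative_eq_intros simp: has_real_derivative_iff_has_vector_derivative[symmetric] mult.commute)
  also have "(- sin \<theta> * sin \<phi>) *\<^sub>R axis 1 1 + (sin \<theta> * cos \<phi>) *\<^sub>R axis 2 1 + 0 *\<^sub>R axis 3 1 = sph_\<phi> \<theta> \<phi>"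
    by (simp add: vec_eq_iff forall_3 axis_def)
  finally show ?thesis .
qed

text \<open>Rotations preserve the surface measure, and this is the infinitesimal form of that fact: the vector field
\<open>cross3 a\<close> generates the rotations about \<open>a\<close>, and differentiation along it integrates to zero. In the coordinates
\<open>\<theta>\<close> and \<open>\<phi>\<close> the integrand, including the factor \<open>sin \<theta>\<close>, is a divergence. The boundary terms in \<open>\<theta>\<close> vanish because \<open>sin\<close>
vanishes at the poles, those in \<open>\<phi>\<close> by periodicity.\<close>

lemma surf_rotation_field:
  fixes a :: "real^3"
  assumes g: "grad (sphere 0 1) f D" and cD: "\<And>i. continuous_on (sphere 0 1) (D i)"
  shows "surf (\<lambda>\<omega>. \<Sum>i\<in>UNIV. (cross3 a \<omega>)$i *\<^sub>R D i \<omega>) = 0"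
proof -
  define \<alpha> where "\<alpha> \<phi> = a$2 * cos \<phi> - a$1 * sin \<phi>" for \<phi>
  define \<alpha>' where "\<alpha>' \<phi> = - a$2 * sin \<phi> - a$1 * cos \<phi>" for \<phi>
  define G where "G \<theta> \<phi> = f (sph \<theta> \<phi>)" for \<theta> \<phi>
  define G1 where "G1 \<theta> \<phi> = (\<Sum>i\<in>UNIV. sph_\<theta> \<theta> \<phi> $ i *\<^sub>R D i (sph \<theta> \<phi>))" for \<theta> \<phi>
  define G2 where "G2 \<theta> \<phi> = (\<Sum>i\<in>UNIV. sph_\<phi> \<theta> \<phi> $ i *\<^sub>R D i (sph \<theta> \<phi>))" for \<theta> \<phi>
  have dG1: "((\<lambda>\<theta>. G \<theta> \<phi>) has_vector_derivative G1 \<theta> \<phi>) (at \<theta>)" for \<theta> \<phi>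
    unfolding G_def G1_def by (rule grad_chain[OF g _ has_vector_derivative_sph_\<theta>]) simp
  have dG2: "((\<lambda>\<phi>. G \<theta> \<phi>) has_vector_derivative G2 \<theta> \<phi>) (at \<phi>)" for \<theta> \<phi>
    unfolding G_def G2_def by (rule grad_chain[OF g _ has_vector_derivative_sph_\<phi>]) simp
  \<comment> \<open>The two parts of the divergence: \<open>P'\<close> is a derivative in \<open>\<theta>\<close> and \<open>Q'\<close> a derivative in \<open>\<phi>\<close>. Their zeroth
order terms cancel because the derivative of \<open>\<alpha>'\<close> is \<open>- \<alpha>\<close>.\<close>
  define P' where "P' \<theta> \<phi> = (\<alpha> \<phi> * cos \<theta>) *\<^sub>R G \<theta> \<phi> + (\<alpha> \<phi> * sin \<theta>) *\<^sub>R G1 \<theta> \<phi>" for \<theta> \<phi>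
  define Q' where "Q' \<theta> \<phi> = (- cos \<theta> * \<alpha> \<phi>) *\<^sub>R G \<theta> \<phi> + (a$3 * sin \<theta> + cos \<theta> * \<alpha>' \<phi>) *\<^sub>R G2 \<theta> \<phi>" for \<theta> \<phi>
  have cG: "continuous_on UNIV (\<lambda>z. G (fst z) (snd z))"
    unfolding G_def by (intro continuous_intros continuous_on_compose2[OF grad_imp_continuous_on[OF g]]) auto
  have cDs: "continuous_on UNIV (\<lambda>z. D i (sph (fst z) (snd z)))" for i
    by (intro continuous_intros continuous_on_compose2[OF cD]) auto
  have cG1: "continuous_on UNIV (\<lambda>z. G1 (fst z) (snd z))"
    unfolding G1_def sum_3 sph_\<theta>_nth by (intro continuous_intros cDs)
  have cG2: "continuous_on UNIV (\<lambda>z. G2 (fst z) (snd z))"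
    unfolding G2_def sum_3 sph_\<phi>_nth by (intro continuous_intros cDs)
  have cP': "continuous_on UNIV (\<lambda>(\<theta>,\<phi>). P' \<theta> \<phi>)"
    unfolding P'_def \<alpha>_def case_prod_beta by (intro continuous_intros cG cG1)
  have cQ': "continuous_on UNIV (\<lambda>(\<theta>,\<phi>). Q' \<theta> \<phi>)"
    unfolding Q'_def \<alpha>_def \<alpha>'_def case_prod_beta by (intro continuous_intros cG cG2)
  have I1: "integral (cbox (0,0) (pi,2*pi)) (\<lambda>(\<theta>,\<phi>). P' \<theta> \<phi>) = 0"
  proof (rule integral_box_deriv_fst[OF _ cP'])
    show "((\<lambda>\<theta>. (\<alpha> \<phi> * sin \<theta>) *\<^sub>R G \<theta> \<phi>) has_vector_derivative P' \<theta> \<phi>) (at \<theta>)" for \<theta> \<phi>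
      unfolding P'_def
      by (rule has_vector_derivative_scaleR[THEN has_vector_derivative_eq_rhs, OF _ dG1])
         (auto intro!: derivative_eq_intros)
  qed auto
  have I2: "integral (cbox (0,0) (pi,2*pi)) (\<lambda>(\<theta>,\<phi>). Q' \<theta> \<phi>) = 0"
  proof (rule integral_box_deriv_snd[OF _ cQ'])
    show "((\<lambda>\<phi>. (a$3 * sin \<theta> + cos \<theta> * \<alpha>' \<phi>) *\<^sub>R G \<theta> \<phi>) has_vector_derivative Q' \<theta> \<phi>) (at \<phi>)" for \<theta> \<phi>
      unfolding Q'_def \<alpha>_def \<alpha>'_def
      by (rule has_vector_derivative_scaleR[THEN has_vector_derivative_eq_rhs, OF _ dG2])
         (auto intro!: derivative_eq_intros simp: algebra_simps)
    show "(a$3 * sin \<theta> + cos \<theta> * \<alpha>' 0) *\<^sub>R G \<theta> 0 = (a$3 * sin \<theta> + cos \<theta> * \<alpha>' (2*pi)) *\<^sub>R G \<theta> (2*pi)" for \<theta>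
      by (simp add: \<alpha>'_def G_def spherical_point_def)
  qed auto
  have key: "sin \<theta> *\<^sub>R (\<Sum>i\<in>UNIV. (cross3 a (sph \<theta> \<phi>))$i *\<^sub>R D i (sph \<theta> \<phi>)) = P' \<theta> \<phi> + Q' \<theta> \<phi>" for \<theta> \<phi>
  proof -
    have v: "sin \<theta> *\<^sub>R cross3 a (sph \<theta> \<phi>) =
       (\<alpha> \<phi> * sin \<theta>) *\<^sub>R sph_\<theta> \<theta> \<phi> + (a$3 * sin \<theta> + cos \<theta> * \<alpha>' \<phi>) *\<^sub>R sph_\<phi> \<theta> \<phi>"
    proof -
      have sc: "(sin x)\<^sup>2 = 1 - (cos x)\<^sup>2" for x :: real by (simp add: sin_squared_eq)
      have e1: "sin \<theta> * (a$2 * cos \<theta> - a$3 * (sin \<theta> * sin \<phi>)) =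
        \<alpha> \<phi> * sin \<theta> * (cos \<theta> * cos \<phi>) + (a$3 * sin \<theta> + cos \<theta> * \<alpha>' \<phi>) * (- sin \<theta> * sin \<phi>)"
        unfolding \<alpha>_def \<alpha>'_def using sc[of \<phi>] by algebra
      have e2: "sin \<theta> * (a$3 * (sin \<theta> * cos \<phi>) - a$1 * cos \<theta>) =
        \<alpha> \<phi> * sin \<theta> * (cos \<theta> * sin \<phi>) + (a$3 * sin \<theta> + cos \<theta> * \<alpha>' \<phi>) * (sin \<theta> * cos \<phi>)"
        unfolding \<alpha>_def \<alpha>'_def using sc[of \<phi>] by algebra
      have e3: "sin \<theta> * (a$1 * (sin \<theta> * sin \<phi>) - a$2 * (sin \<theta> * cos \<phi>)) =
        \<alpha> \<phi> * sin \<theta> * (- sin \<theta>)"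
        unfolding \<alpha>_def by algebra
      show ?thesis
        using e1 e2 e3 by (simp add: vec_eq_iff forall_3 cross3_def)
    qed
    have lin: "(\<Sum>i\<in>UNIV. (c *\<^sub>R u + d *\<^sub>R v)$i *\<^sub>R X i)
        = c *\<^sub>R (\<Sum>i\<in>UNIV. u$i *\<^sub>R X i) + d *\<^sub>R (\<Sum>i\<in>UNIV. v$i *\<^sub>R X i)"
      for c d and u v :: "real^3" and X :: "3 \<Rightarrow> complex"
      by (simp add: scaleR_sum_right sum.distrib scaleR_add_left)
    have "sin \<theta> *\<^sub>R (\<Sum>i\<in>UNIV. (cross3 a (sph \<theta> \<phi>))$i *\<^sub>R D i (sph \<theta> \<phi>))
        = (\<Sum>i\<in>UNIV. (sin \<theta> *\<^sub>R cross3 a (sph \<theta> \<phi>))$i *\<^sub>R D i (sph \<theta> \<phi>))"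
      by (simp add: scaleR_sum_right)
    also have "\<dots> = (\<alpha> \<phi> * sin \<theta>) *\<^sub>R G1 \<theta> \<phi> + (a$3 * sin \<theta> + cos \<theta> * \<alpha>' \<phi>) *\<^sub>R G2 \<theta> \<phi>"
      unfolding v G1_def G2_def by (rule lin)
    also have "\<dots> = P' \<theta> \<phi> + Q' \<theta> \<phi>"
      by (simp add: P'_def Q'_def algebra_simps)
    finally show ?thesis .
  qed
  have "surf (\<lambda>\<omega>. \<Sum>i\<in>UNIV. (cross3 a \<omega>)$i *\<^sub>R D i \<omega>) =
      integral (cbox (0,0) (pi,2*pi)) (\<lambda>z. (\<lambda>(\<theta>,\<phi>). P' \<theta> \<phi>) z + (\<lambda>(\<theta>,\<phi>). Q' \<theta> \<phi>) z)"
    unfolding surf_def by (intro integral_cong) (auto simp: key)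
  also have "\<dots> = 0"
    by (subst integral_add) (auto intro!: integrable_continuous continuous_on_subset[OF cP'] continuous_on_subset[OF cQ'] simp: I1 I2)
  finally show ?thesis .
qed

section \<open>Green's identity on the sphere\<close>

lemma grad_mult:
  assumes "grad U f D" "grad U g E"
  shows "grad U (\<lambda>x. f x * g x) (\<lambda>i x. f x * E i x + D i x * g x)"
  unfolding grad_def
proof
  fix x assume x: "x \<in> U"
  show "((\<lambda>x. f x * g x) has_derivative (\<lambda>h. \<Sum>i\<in>UNIV. h$i *\<^sub>R (f x * E i x + D i x * g x))) (at x)"
    by (rule has_derivative_eq_rhs[OF has_derivative_mult[OF gradD[OF assms(1) x] gradD[OF assms(2) x]]])
       (simp add: sum_distrib_left sum_distrib_right scaleR_add_right sum.distrib fun_eq_iff)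
qed

lemma grad_diff:
  assumes "grad U f D" "grad U g E"
  shows "grad U (\<lambda>x. f x - g x) (\<lambda>i x. D i x - E i x)"
  unfolding grad_def
proof
  fix x assume x: "x \<in> U"
  show "((\<lambda>x. f x - g x) has_derivative (\<lambda>h. \<Sum>i\<in>UNIV. h$i *\<^sub>R (D i x - E i x))) (at x)"
    by (rule has_derivative_eq_rhs[OF has_derivative_diff[OF gradD[OF assms(1) x] gradD[OF assms(2) x]]])
       (simp add: scaleR_diff_right sum_subtractf fun_eq_iff)
qed

text \<open>Functions of class \<open>C\<^sup>2\<close> with their first and second partial derivatives. The symmetry of the second derivatives is
part of the notion, since it is what the identity \<open>rot_deriv_squared\<close> needs.\<close>

definition C2 :: "(real^3) set \<Rightarrow> (real^3 \<Rightarrow> complex) \<Rightarrow> (3 \<Rightarrow> real^3 \<Rightarrow> complex) \<Rightarrow>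
    (3 \<Rightarrow> 3 \<Rightarrow> real^3 \<Rightarrow> complex) \<Rightarrow> bool" where
  "C2 U f D H \<longleftrightarrow> grad U f D \<and> (\<forall>i. grad U (D i) (H i)) \<and> (\<forall>i j. continuous_on U (H i j)) \<and>
     (\<forall>x\<in>U. \<forall>i j. H i j x = H j i x)"

lemma C2D:
  assumes "C2 U f D H"
  shows "grad U f D" "grad U (D i) (H i)" "continuous_on U (H i j)" "x \<in> U \<Longrightarrow> H i j x = H j i x"
    "continuous_on U f" "continuous_on U (D i)"
  using assms by (auto simp: C2_def intro: grad_imp_continuous_on)

lemma C2_subset: "C2 U f D H \<Longrightarrow> V \<subseteq> U \<Longrightarrow> C2 V f D H"
  unfolding C2_def grad_def by (blast intro: continuous_on_subset)

text \<open>The Laplace-Beltrami operator of the unit sphere, obtained from the Laplacian of space by removing the radial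
part: it is \<open>\<Delta> - \<partial>\<^sub>r\<^sup>2 - (2 / r) \<partial>\<^sub>r\<close> at \<open>r = 1\<close>.\<close>

definition spherical_laplacian ::
    "(3 \<Rightarrow> real^3 \<Rightarrow> complex) \<Rightarrow> (3 \<Rightarrow> 3 \<Rightarrow> real^3 \<Rightarrow> complex) \<Rightarrow> real^3 \<Rightarrow> complex" where
  "spherical_laplacian D H \<omega> = (\<Sum>i\<in>UNIV. H i i \<omega>)
     - (\<Sum>i\<in>UNIV. \<Sum>j\<in>UNIV. (\<omega>$i * \<omega>$j) *\<^sub>R H i j \<omega>) - 2 * (\<Sum>i\<in>UNIV. \<omega>$i *\<^sub>R D i \<omega>)"

definition rot_deriv :: "real^3 \<Rightarrow> (3 \<Rightarrow> real^3 \<Rightarrow> complex) \<Rightarrow> real^3 \<Rightarrow> complex" where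
  "rot_deriv a D x = (\<Sum>i\<in>UNIV. (cross3 a x)$i *\<^sub>R D i x)"

definition rot_deriv_grad :: "real^3 \<Rightarrow> (3 \<Rightarrow> real^3 \<Rightarrow> complex) \<Rightarrow> (3 \<Rightarrow> 3 \<Rightarrow> real^3 \<Rightarrow> complex)
    \<Rightarrow> 3 \<Rightarrow> real^3 \<Rightarrow> complex" where
  "rot_deriv_grad a D H j x =
     (\<Sum>i\<in>UNIV. (cross3 a (axis j 1))$i *\<^sub>R D i x + (cross3 a x)$i *\<^sub>R H i j x)"

lemma cross3_nth:
  "cross3 a b $ 1 = a$2 * b$3 - a$3 * b$2" "cross3 a b $ 2 = a$3 * b$1 - a$1 * b$3"
  "cross3 a b $ 3 = a$1 * b$2 - a$2 * b$1"
  by (simp_all add: cross3_def)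

lemma grad_rot_deriv:
  assumes "\<And>i. grad U (D i) (H i)"
  shows "grad U (rot_deriv a D) (rot_deriv_grad a D H)"
  unfolding grad_def
proof
  fix x assume x: "x \<in> U"
  have lin: "((\<lambda>x. cross3 a x $ i) has_derivative (\<lambda>h. cross3 a h $ i)) (at x)" for i
  proof (rule bounded_linear.has_derivative[OF _ has_derivative_ident])
    show "bounded_linear (\<lambda>h. cross3 a h $ i)"
      by (rule linear_conv_bounded_linear[THEN iffD1], rule linearI)
         (simp_all add: cross3_simps cross_mult_right)
  qed
  show "(rot_deriv a D has_derivative (\<lambda>h. \<Sum>j\<in>UNIV. h$j *\<^sub>R rot_deriv_grad a D H j x)) (at x)"
    unfolding rot_deriv_def
    by (rule has_derivative_eq_rhs[OF has_derivative_sum[OF has_derivative_scaleR[OF lin gradD[OF assms x]]]])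
       (simp add: fun_eq_iff rot_deriv_grad_def sum_3 cross3_nth axis_def scaleR_conv_of_real algebra_simps)
qed

text \<open>The Laplace-Beltrami operator is the sum of the squares of the rotational derivatives about the three coordinate
axes. This reduces the self-adjointness of the operator to the invariance under rotations.\<close>

lemma rot_deriv_squared:
  assumes "norm \<omega> = 1" "\<And>i j. H i j \<omega> = H j i \<omega>"
  shows "(\<Sum>k\<in>UNIV. \<Sum>j\<in>UNIV. (cross3 (axis k 1) \<omega>)$j *\<^sub>R rot_deriv_grad (axis k 1) D H j \<omega>)
     = spherical_laplacian D H \<omega>"
proof -
  have n: "(\<omega>$1)\<^sup>2 + (\<omega>$2)\<^sup>2 + (\<omega>$3)\<^sup>2 = 1"
    using assms(1) by (simp add: norm_vec_def L2_set_def sum_3 real_sqrt_eq_1_iff)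
  have m: "(of_real (\<omega>$1))\<^sup>2 + (of_real (\<omega>$2))\<^sup>2 + (of_real (\<omega>$3))\<^sup>2 = (1::complex)"
    using arg_cong[OF n, of complex_of_real] by simp
  have eq: "H 2 1 \<omega> = H 1 2 \<omega>" "H 3 1 \<omega> = H 1 3 \<omega>" "H 3 2 \<omega> = H 2 3 \<omega>"
    by (rule assms)+
  define x y z where "x = complex_of_real (\<omega>$1)" and "y = complex_of_real (\<omega>$2)" and "z = complex_of_real (\<omega>$3)"
  show ?thesis
    unfolding spherical_laplacian_def rot_deriv_grad_def
    using m by (simp add: sum_3 cross3_nth axis_def scaleR_conv_of_real eq flip: x_def y_def z_def) algebra
qed

text \<open>For each axis, the rotational derivative of \<open>f L p - p L f\<close> is \<open>f L L p - p L L f\<close>, since the mixed terms cancel, and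
it integrates to zero. Summing over the axes gives the identity.\<close>

lemma surf_green:
  assumes U: "sphere 0 1 \<subseteq> U" and f: "C2 U f D H" and p: "C2 U p E K"
  shows "surf (\<lambda>\<omega>. f \<omega> * spherical_laplacian E K \<omega>) = surf (\<lambda>\<omega>. p \<omega> * spherical_laplacian D H \<omega>)"
proof -
  note f = C2D[OF C2_subset[OF f U]] and p = C2D[OF C2_subset[OF p U]]
  let ?S = "sphere 0 1 :: (real^3) set"
  have cl: "continuous_on ?S (\<lambda>x. cross3 a x $ i)" for a i
  proof -
    have "continuous_on ?S (\<lambda>x. cross3 a x $ 1)" "continuous_on ?S (\<lambda>x. cross3 a x $ 2)"
      "continuous_on ?S (\<lambda>x. cross3 a x $ 3)"
      unfolding cross3_nth by (intro continuous_intros)+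
    then show ?thesis using exhaust_3[of i] by metis
  qed
  have crd: "continuous_on ?S (rot_deriv a D)" "continuous_on ?S (rot_deriv a E)" for a
    unfolding rot_deriv_def by (intro continuous_intros cl f p)+
  have crg: "continuous_on ?S (rot_deriv_grad a D H j)" "continuous_on ?S (rot_deriv_grad a E K j)" for a j
    unfolding rot_deriv_grad_def by (intro continuous_intros cl f p)+
  define W where "W k \<omega> = f \<omega> * (\<Sum>j\<in>UNIV. (cross3 (axis k 1) \<omega>)$j *\<^sub>R rot_deriv_grad (axis k 1) E K j \<omega>)
      - p \<omega> * (\<Sum>j\<in>UNIV. (cross3 (axis k 1) \<omega>)$j *\<^sub>R rot_deriv_grad (axis k 1) D H j \<omega>)" for k \<omega>
  have W0: "surf (W k) = 0" for k
  proof -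
    let ?a = "axis k 1 :: real^3"
    have "surf (\<lambda>\<omega>. \<Sum>i\<in>UNIV. (cross3 ?a \<omega>)$i *\<^sub>R
        (f \<omega> * rot_deriv_grad ?a E K i \<omega> + D i \<omega> * rot_deriv ?a E \<omega>
         - (p \<omega> * rot_deriv_grad ?a D H i \<omega> + E i \<omega> * rot_deriv ?a D \<omega>))) = 0"
      by (rule surf_rotation_field[OF grad_diff[OF grad_mult[OF f(1) grad_rot_deriv] grad_mult[OF p(1) grad_rot_deriv]]])
         (intro f p continuous_intros crd crg)+
    also have "(\<lambda>\<omega>. \<Sum>i\<in>UNIV. (cross3 ?a \<omega>)$i *\<^sub>R
        (f \<omega> * rot_deriv_grad ?a E K i \<omega> + D i \<omega> * rot_deriv ?a E \<omega>
         - (p \<omega> * rot_deriv_grad ?a D H i \<omega> + E i \<omega> * rot_deriv ?a D \<omega>))) = W k"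
    proof
      fix \<omega>
      have "(\<Sum>i\<in>UNIV. (cross3 ?a \<omega>)$i *\<^sub>R (D i \<omega> * rot_deriv ?a E \<omega>)) = rot_deriv ?a D \<omega> * rot_deriv ?a E \<omega>"
        "(\<Sum>i\<in>UNIV. (cross3 ?a \<omega>)$i *\<^sub>R (E i \<omega> * rot_deriv ?a D \<omega>)) = rot_deriv ?a E \<omega> * rot_deriv ?a D \<omega>"
        by (simp_all add: rot_deriv_def sum_distrib_right)
      then show "(\<Sum>i\<in>UNIV. (cross3 ?a \<omega>)$i *\<^sub>R
        (f \<omega> * rot_deriv_grad ?a E K i \<omega> + D i \<omega> * rot_deriv ?a E \<omega>
         - (p \<omega> * rot_deriv_grad ?a D H i \<omega> + E i \<omega> * rot_deriv ?a D \<omega>))) = W k \<omega>"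
        by (simp add: W_def scaleR_add_right scaleR_diff_right sum.distrib sum_subtractf sum_distrib_left mult.commute)
    qed
    finally show ?thesis .
  qed
  have cW: "continuous_on ?S (W k)" for k
    unfolding W_def by (intro continuous_intros f p crg cl)
  have cLf: "continuous_on ?S (spherical_laplacian D H)" and cLp: "continuous_on ?S (spherical_laplacian E K)"
    unfolding spherical_laplacian_def by (intro continuous_intros f p)+
  have "surf (\<lambda>\<omega>. f \<omega> * spherical_laplacian E K \<omega>) - surf (\<lambda>\<omega>. p \<omega> * spherical_laplacian D H \<omega>)
     = surf (\<lambda>\<omega>. f \<omega> * spherical_laplacian E K \<omega> - p \<omega> * spherical_laplacian D H \<omega>)"
    by (intro surf_diff[symmetric] continuous_intros f p cLf cLp)
  also have "\<dots> = surf (\<lambda>\<omega>. \<Sum>k\<in>UNIV. W k \<omega>)"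
  proof (rule surf_cong)
    fix \<omega> :: "real^3" assume w: "norm \<omega> = 1"
    then have "\<omega> \<in> sphere 0 1" by simp
    then show "f \<omega> * spherical_laplacian E K \<omega> - p \<omega> * spherical_laplacian D H \<omega> = (\<Sum>k\<in>UNIV. W k \<omega>)"
      unfolding W_def sum_subtractf sum_distrib_left[symmetric]
      by (subst (1 2) rot_deriv_squared[OF w]) (auto simp: f p)
  qed
  also have "\<dots> = 0" by (subst surf_sum) (auto simp: cW W0)
  finally show ?thesis by simp
qed

section \<open>Zonal functions\<close>

lemma C2_const: "C2 U (\<lambda>_. c) (\<lambda>_ _. 0) (\<lambda>_ _ _. 0)"
  by (auto simp: C2_def grad_def)

lemma C2_ridge:
  assumes P: "\<And>s. (P has_vector_derivative P' s) (at s)" and P': "\<And>s. (P' has_vector_derivative P'' s) (at s)"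
    and cP'': "continuous_on UNIV P''"
  shows "C2 U (\<lambda>x. P (x \<bullet> \<eta>)) (\<lambda>i x. \<eta>$i *\<^sub>R P' (x \<bullet> \<eta>)) (\<lambda>i j x. (\<eta>$i * \<eta>$j) *\<^sub>R P'' (x \<bullet> \<eta>))"
proof -
  have *: "((\<lambda>x. Q (x \<bullet> \<eta>)) has_derivative (\<lambda>h. \<Sum>i\<in>UNIV. h$i *\<^sub>R (\<eta>$i *\<^sub>R Q' (x \<bullet> \<eta>)))) (at x)"
    if "\<And>s. (Q has_vector_derivative Q' s) (at s)" for Q Q' :: "real \<Rightarrow> complex" and x
  proof -
    have "((\<lambda>x. Q (x \<bullet> \<eta>)) has_derivative (\<lambda>h. (h \<bullet> \<eta>) *\<^sub>R Q' (x \<bullet> \<eta>))) (at x)"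
      by (rule has_derivative_compose[OF _ that[unfolded has_vector_derivative_def]])
         (auto intro!: derivative_eq_intros)
    then show ?thesis by (simp add: inner_vec_def scaleR_sum_left)
  qed
  have "grad U (\<lambda>x. P (x \<bullet> \<eta>)) (\<lambda>i x. \<eta>$i *\<^sub>R P' (x \<bullet> \<eta>))"
    unfolding grad_def using *[OF P] by blast
  moreover have "grad U (\<lambda>x. \<eta>$i *\<^sub>R P' (x \<bullet> \<eta>)) (\<lambda>j x. (\<eta>$i * \<eta>$j) *\<^sub>R P'' (x \<bullet> \<eta>))" for i
    unfolding grad_def
  proof
    fix x
    show "((\<lambda>x. \<eta>$i *\<^sub>R P' (x \<bullet> \<eta>)) has_derivative (\<lambda>h. \<Sum>j\<in>UNIV. h$j *\<^sub>R (\<eta>$i * \<eta>$j) *\<^sub>R P'' (x \<bullet> \<eta>))) (at x)"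
      by (rule has_derivative_eq_rhs[OF has_derivative_scaleR_right[OF *[OF P']]])
         (auto simp: fun_eq_iff scaleR_sum_right mult_ac)
  qed
  moreover have "continuous_on U (\<lambda>x. (\<eta>$i * \<eta>$j) *\<^sub>R P'' (x \<bullet> \<eta>))" for i j
    by (intro continuous_intros continuous_on_compose2[OF cP'']) auto
  ultimately show ?thesis by (auto simp: C2_def mult_ac)
qed

text \<open>On functions of \<open>\<omega> \<bullet> \<eta>\<close> the Laplace-Beltrami operator is Legendre's operator.\<close>

lemma spherical_laplacian_ridge:
  assumes "norm \<eta> = 1"
  shows "spherical_laplacian (\<lambda>i x. \<eta>$i *\<^sub>R P' (x \<bullet> \<eta>)) (\<lambda>i j x. (\<eta>$i * \<eta>$j) *\<^sub>R P'' (x \<bullet> \<eta>)) \<omega>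
     = (1 - (\<omega> \<bullet> \<eta>)\<^sup>2) *\<^sub>R P'' (\<omega> \<bullet> \<eta>) - (2 * (\<omega> \<bullet> \<eta>)) *\<^sub>R P' (\<omega> \<bullet> \<eta>)"
proof -
  have n: "(\<eta>$1)\<^sup>2 + (\<eta>$2)\<^sup>2 + (\<eta>$3)\<^sup>2 = 1"
    using assms by (simp add: norm_vec_def L2_set_def sum_3 real_sqrt_eq_1_iff)
  define S where "S = \<omega> \<bullet> \<eta>"
  define A B where "A = P' S" and "B = P'' S"
  have S: "S = \<omega>$1 * \<eta>$1 + \<omega>$2 * \<eta>$2 + \<omega>$3 * \<eta>$3"
    by (simp add: S_def inner_vec_def sum_3)
  have "spherical_laplacian (\<lambda>i x. \<eta>$i *\<^sub>R P' (x \<bullet> \<eta>)) (\<lambda>i j x. (\<eta>$i * \<eta>$j) *\<^sub>R P'' (x \<bullet> \<eta>)) \<omega>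
     = ((\<eta>$1)\<^sup>2 + (\<eta>$2)\<^sup>2 + (\<eta>$3)\<^sup>2 - (\<omega>$1 * \<eta>$1 + \<omega>$2 * \<eta>$2 + \<omega>$3 * \<eta>$3)\<^sup>2) *\<^sub>R B
       - (2 * (\<omega>$1 * \<eta>$1 + \<omega>$2 * \<eta>$2 + \<omega>$3 * \<eta>$3)) *\<^sub>R A"
    unfolding spherical_laplacian_def S_def[symmetric] A_def[symmetric] B_def[symmetric]
    by (simp add: sum_3 scaleR_conv_of_real algebra_simps power2_eq_square)
  then show ?thesis unfolding n S[symmetric] A_def B_def S_def .
qed

lemma surf_green_ridge:
  assumes P: "\<And>s. (P has_vector_derivative P' s) (at s)" and P': "\<And>s. (P' has_vector_derivative P'' s) (at s)"
    and cP'': "continuous_on UNIV P''" and \<eta>: "norm \<eta> = 1"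
    and U: "sphere 0 1 \<subseteq> U" and f: "C2 U f D H"
  shows "surf (\<lambda>\<omega>. f \<omega> * ((1 - (\<omega> \<bullet> \<eta>)\<^sup>2) *\<^sub>R P'' (\<omega> \<bullet> \<eta>) - (2 * (\<omega> \<bullet> \<eta>)) *\<^sub>R P' (\<omega> \<bullet> \<eta>)))
    = surf (\<lambda>\<omega>. P (\<omega> \<bullet> \<eta>) * spherical_laplacian D H \<omega>)"
  using surf_green[OF U f C2_ridge[OF P P' cP'', of _ \<eta>]] by (simp add: spherical_laplacian_ridge[OF \<eta>])

lemma surf_ridge_laplacian_zero:
  assumes P: "\<And>s. (P has_vector_derivative P' s) (at s)" and P': "\<And>s. (P' has_vector_derivative P'' s) (at s)"
    and cP'': "continuous_on UNIV P''" and \<eta>: "norm \<eta> = 1"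
  shows "surf (\<lambda>\<omega>. (1 - (\<omega> \<bullet> \<eta>)\<^sup>2) *\<^sub>R P'' (\<omega> \<bullet> \<eta>) - (2 * (\<omega> \<bullet> \<eta>)) *\<^sub>R P' (\<omega> \<bullet> \<eta>)) = 0"
  using surf_green_ridge[OF P P' cP'' \<eta> subset_UNIV C2_const[of _ 1]]
  by (simp add: spherical_laplacian_def)

section \<open>Spherical Bessel functions\<close>

text \<open>\<open>bessel_chain k\<close> is the \<open>k\<close>-th derivative of \<open>sin (sqrt s) / sqrt s\<close>, and up to a constant \<open>t ^ k * bessel_chain k (t\<^sup>2)\<close> is
the spherical Bessel function of order \<open>k\<close>. Taking the three-term recurrence as the definition avoids power series;
the price is that the functions are meaningful for positive arguments only.\<close>

fun bessel_chain :: "nat \<Rightarrow> real \<Rightarrow> real" where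
  "bessel_chain 0 s = sin (sqrt s) / sqrt s"
| "bessel_chain (Suc 0) s = (cos (sqrt s) - sin (sqrt s) / sqrt s) / (2 * s)"
| "bessel_chain (Suc (Suc k)) s =
     - ((4 * real k + 6) * bessel_chain (Suc k) s + bessel_chain k s) / (4 * s)"

lemma bessel_chain_deriv:
  assumes "s > 0"
  shows "(bessel_chain k has_real_derivative bessel_chain (Suc k) s) (at s)"
  using assms
proof (induction k arbitrary: s rule: less_induct)
  case (less k)
  have d0: "(bessel_chain 0 has_real_derivative bessel_chain 1 s) (at s)" if "s > 0" for s
  proof -
    have ss: "sqrt s * sqrt s = s" using that by simp
    have "((\<lambda>s. sin (sqrt s) / sqrt s) has_real_derivative
       (cos (sqrt s) * (inverse (sqrt s) / 2) * sqrt s - sin (sqrt s) * (inverse (sqrt s) / 2)) / (sqrt s * sqrt s)) (at s)"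
      using that by (auto intro!: derivative_eq_intros)
    moreover have "(cos (sqrt s) * (inverse (sqrt s) / 2) * sqrt s - sin (sqrt s) * (inverse (sqrt s) / 2)) / (sqrt s * sqrt s) = bessel_chain 1 s"
      using that unfolding ss by (simp add: field_simps)
    moreover have "bessel_chain 0 = (\<lambda>s. sin (sqrt s) / sqrt s)" by auto
    ultimately show ?thesis by simp
  qed
  show ?case
  proof (cases k)
    case 0
    show ?thesis using d0[OF less.prems] unfolding 0 by (simp only: One_nat_def)
  next
    case (Suc m)
    show ?thesis
    proof (cases m)
      case 0
      have "((\<lambda>s. (cos (sqrt s) - bessel_chain 0 s) / (2 * s)) has_real_derivative
        ((- sin (sqrt s) * (inverse (sqrt s) / 2) - bessel_chain 1 s) * (2 * s) - (cos (sqrt s) - bessel_chain 0 s) * 2) / ((2 * s) * (2 * s))) (at s)"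
        using less by (auto intro!: derivative_eq_intros d0 simp del: bessel_chain.simps)
      moreover have "((- sin (sqrt s) * (inverse (sqrt s) / 2) - bessel_chain 1 s) * (2 * s) - (cos (sqrt s) - bessel_chain 0 s) * 2) / ((2 * s) * (2 * s))
         = bessel_chain (Suc (Suc 0)) s"
      proof -
        have c: "cos (sqrt s) = 2 * s * bessel_chain 1 s + bessel_chain 0 s" using less by (simp add: field_simps)
        have i: "- sin (sqrt s) * (inverse (sqrt s) / 2) = - bessel_chain 0 s / 2" by (simp add: field_simps)
        define a b where "a = bessel_chain 0 s" and "b = bessel_chain (Suc 0) s"
        show ?thesis
          using less unfolding i c by (simp add: field_simps del: bessel_chain.simps(1,2) flip: a_def b_def)
      qed
      moreover have "bessel_chain (Suc 0) = (\<lambda>s. (cos (sqrt s) - bessel_chain 0 s) / (2 * s))" by auto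
      ultimately show ?thesis using 0 Suc by simp
    next
      case (Suc j)
      have k: "k = Suc (Suc j)" using Suc \<open>k = Suc m\<close> by simp
      have d1: "(bessel_chain j has_real_derivative bessel_chain (Suc j) s) (at s)"
        and d2: "(bessel_chain (Suc j) has_real_derivative bessel_chain (Suc (Suc j)) s) (at s)"
        using less.IH[of j s] less.IH[of "Suc j" s] less.prems k by (simp_all del: bessel_chain.simps)
      define a b where "a = bessel_chain j s" and "b = bessel_chain (Suc j) s"
      have "((\<lambda>s. - ((4 * real j + 6) * bessel_chain (Suc j) s + bessel_chain j s) / (4 * s)) has_real_derivative
         (- ((4 * real j + 6) * bessel_chain (Suc (Suc j)) s + bessel_chain (Suc j) s) * (4 * s)
          - (- ((4 * real j + 6) * bessel_chain (Suc j) s + bessel_chain j s)) * 4) / ((4 * s) * (4 * s))) (at s)"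
        using less by (auto intro!: derivative_eq_intros d1 d2 simp del: bessel_chain.simps)
      also have "(- ((4 * real j + 6) * bessel_chain (Suc (Suc j)) s + bessel_chain (Suc j) s) * (4 * s)
          - (- ((4 * real j + 6) * bessel_chain (Suc j) s + bessel_chain j s)) * 4) / ((4 * s) * (4 * s)) = bessel_chain (Suc k) s"
        using less unfolding k bessel_chain.simps(3) a_def[symmetric] b_def[symmetric]
        by (simp add: divide_simps) (simp add: algebra_simps)
      finally show ?thesis unfolding k by (simp add: fun_eq_iff)
    qed
  qed
qed

text \<open>The recurrence can be run downwards, so two consecutive zeros would propagate to \<open>k = 0\<close>, where they say that
\<open>sin\<close> and \<open>cos\<close> vanish at the same point.\<close>

lemma bessel_chain_not_both_zero:
  assumes "s > 0"
  shows "bessel_chain k s \<noteq> 0 \<or> bessel_chain (Suc k) s \<noteq> 0"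
proof (induction k)
  case 0
  show ?case
  proof (rule ccontr)
    assume "\<not> ?thesis"
    then have "sin (sqrt s) = 0" "cos (sqrt s) = 0" using assms by auto
    then show False using sin_cos_squared_add[of "sqrt s"] by simp
  qed
next
  case (Suc k)
  then show ?case using assms by auto
qed

text \<open>The functions that occur as coefficients of plane wave moments. All that matters about them is that the class is
closed under differentiation.\<close>

inductive bessel_span :: "(real \<Rightarrow> complex) \<Rightarrow> bool" where
  chain: "bessel_span (\<lambda>s. of_real (bessel_chain k s))"
| add: "bessel_span p \<Longrightarrow> bessel_span q \<Longrightarrow> bessel_span (\<lambda>s. p s + q s)"
| scale: "bessel_span q \<Longrightarrow> bessel_span (\<lambda>s. c * q s)"

lemma bessel_span_deriv:
  assumes "bessel_span q"
  shows "\<exists>q'. bessel_span q' \<and> (\<forall>s>0. (q has_vector_derivative q' s) (at s))"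
  using assms
proof induction
  case (chain k)
  show ?case
    by (rule exI[of _ "\<lambda>s. of_real (bessel_chain (Suc k) s)"])
       (auto intro!: bessel_span.chain has_vector_derivative_of_real bessel_chain_deriv simp del: bessel_chain.simps)
next
  case (add p q)
  then obtain p' q' where *: "bessel_span p'" "\<forall>s>0. (p has_vector_derivative p' s) (at s)"
    "bessel_span q'" "\<forall>s>0. (q has_vector_derivative q' s) (at s)" by blast
  show ?case
    by (rule exI[of _ "\<lambda>s. p' s + q' s"]) (use * in \<open>auto intro!: bessel_span.add has_vector_derivative_add\<close>)
next
  case (scale q c)
  then obtain q' where q': "bessel_span q'" "\<forall>s>0. (q has_vector_derivative q' s) (at s)" by blast
  show ?case
    by (rule exI[of _ "\<lambda>s. c * q' s"]) (use q' in \<open>auto intro!: bessel_span.scale has_vector_derivative_mult_right\<close>)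
qed

section \<open>Moments of plane waves\<close>

text \<open>The Fourier transform of the zonal polynomial \<open>(\<omega> \<bullet> \<eta>)\<^sup>k\<close> times the surface measure.\<close>

definition plane_wave_moment :: "real^3 \<Rightarrow> nat \<Rightarrow> real^3 \<Rightarrow> complex" where
  "plane_wave_moment \<eta> k x = surf (\<lambda>\<omega>. of_real (\<omega> \<bullet> \<eta>) ^ k * exp (- \<i> * of_real (\<omega> \<bullet> x)))"

lemma plane_wave_moment_deriv:
  "((\<lambda>t. plane_wave_moment \<eta> k (x + t *\<^sub>R y)) has_vector_derivative
     surf (\<lambda>\<omega>. - \<i> * of_real (\<omega> \<bullet> y) * (of_real (\<omega> \<bullet> \<eta>) ^ k * exp (- \<i> * of_real (\<omega> \<bullet> (x + t *\<^sub>R y)))))) (at t within I)"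
proof -
  have "((\<lambda>t. plane_wave_moment \<eta> k (x + t *\<^sub>R y)) has_vector_derivative
     surf (\<lambda>\<omega>. - \<i> * of_real (\<omega> \<bullet> y) * (of_real (\<omega> \<bullet> \<eta>) ^ k * exp (- \<i> * of_real (\<omega> \<bullet> (x + t *\<^sub>R y)))))) (at t within UNIV)"
    unfolding plane_wave_moment_def
  proof (rule has_vector_derivative_surf)
    fix t \<omega>
    have "((\<lambda>z. of_real (\<omega> \<bullet> \<eta>) ^ k * exp (- \<i> * (of_real (\<omega> \<bullet> x) + z * of_real (\<omega> \<bullet> y)))) has_field_derivative
       - \<i> * of_real (\<omega> \<bullet> y) * (of_real (\<omega> \<bullet> \<eta>) ^ k * exp (- \<i> * (of_real (\<omega> \<bullet> x) + of_real t * of_real (\<omega> \<bullet> y))))) (at (of_real t))"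
      by (auto intro!: derivative_eq_intros simp: algebra_simps)
    from has_vector_derivative_real_field[OF this]
    show "((\<lambda>t. of_real (\<omega> \<bullet> \<eta>) ^ k * exp (- \<i> * of_real (\<omega> \<bullet> (x + t *\<^sub>R y)))) has_vector_derivative
      - \<i> * of_real (\<omega> \<bullet> y) * (of_real (\<omega> \<bullet> \<eta>) ^ k * exp (- \<i> * of_real (\<omega> \<bullet> (x + t *\<^sub>R y))))) (at t within UNIV)"
      by (simp add: inner_add_right)
  qed (auto simp: case_prod_beta intro!: continuous_intros)
  then show ?thesis by (rule has_vector_derivative_at_within)
qed

lemma plane_wave_moment_deriv_axis:
  "((\<lambda>t. plane_wave_moment \<eta> k (x + t *\<^sub>R \<eta>)) has_vector_derivative
     - \<i> * plane_wave_moment \<eta> (Suc k) (x + t *\<^sub>R \<eta>)) (at t)"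
proof (rule has_vector_derivative_eq_rhs[OF plane_wave_moment_deriv])
  show "surf (\<lambda>\<omega>. - \<i> * of_real (\<omega> \<bullet> \<eta>) * (of_real (\<omega> \<bullet> \<eta>) ^ k * exp (- \<i> * of_real (\<omega> \<bullet> (x + t *\<^sub>R \<eta>)))))
      = - \<i> * plane_wave_moment \<eta> (Suc k) (x + t *\<^sub>R \<eta>)"
    unfolding plane_wave_moment_def surf_cmul[symmetric] by (rule surf_cong) (simp add: mult_ac)
qed

text \<open>Along the ray through \<open>x\<close>, Green's identity for the plane wave itself yields a second order equation which says that
\<open>t\<close> times the transform is a solution of \<open>q'' = - q\<close>. The initial values identify it as \<open>4 \<pi> sin t\<close>.\<close>

lemma plane_wave_moment_0:
  assumes "x \<noteq> 0"
  shows "plane_wave_moment \<eta>' 0 x = 4 * pi * bessel_chain 0 ((norm x)\<^sup>2)"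
proof -
  define \<eta> where "\<eta> = x /\<^sub>R norm x"
  have \<eta>: "norm \<eta> = 1" using assms by (simp add: \<eta>_def)
  define z where "z k t = plane_wave_moment \<eta> k (t *\<^sub>R \<eta>)" for k t
  have dz: "(z k has_vector_derivative - \<i> * z (Suc k) t) (at t)" for k t
  proof -
    have "z k = (\<lambda>t. plane_wave_moment \<eta> k (0 + t *\<^sub>R \<eta>))" by (simp add: fun_eq_iff z_def)
    with plane_wave_moment_deriv_axis[of \<eta> k 0 t] show ?thesis by (simp add: z_def)
  qed
  have ode: "of_real t * (- z 0 t + z 2 t) * of_real t + 2 * \<i> * z 1 t * of_real t = 0" for t
  proof -
    define P where "P s = exp (- \<i> * of_real (t * s))" for s
    have dP: "(P has_vector_derivative (- \<i> * of_real t) * P s) (at s)" for s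
    proof -
      have "((\<lambda>z. exp (- \<i> * (of_real t * z))) has_field_derivative (- \<i> * of_real t) * exp (- \<i> * (of_real t * of_real s))) (at (of_real s))"
        by (auto intro!: derivative_eq_intros)
      from has_vector_derivative_real_field[OF this, of UNIV] show ?thesis
        unfolding P_def[abs_def] by simp
    qed
    have "surf (\<lambda>\<omega>. (1 - (\<omega> \<bullet> \<eta>)\<^sup>2) *\<^sub>R ((- \<i> * of_real t) * ((- \<i> * of_real t) * P (\<omega> \<bullet> \<eta>))) -
        (2 * (\<omega> \<bullet> \<eta>)) *\<^sub>R ((- \<i> * of_real t) * P (\<omega> \<bullet> \<eta>))) = 0"
      by (rule surf_ridge_laplacian_zero[OF dP has_vector_derivative_mult_right[OF dP] _ \<eta>])
         (unfold P_def, intro continuous_intros)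
    also have "(\<lambda>\<omega>. (1 - (\<omega> \<bullet> \<eta>)\<^sup>2) *\<^sub>R ((- \<i> * of_real t) * ((- \<i> * of_real t) * P (\<omega> \<bullet> \<eta>))) -
        (2 * (\<omega> \<bullet> \<eta>)) *\<^sub>R ((- \<i> * of_real t) * P (\<omega> \<bullet> \<eta>)))
       = (\<lambda>\<omega>. (- (of_real t)\<^sup>2) * P (\<omega> \<bullet> \<eta>) + (of_real t)\<^sup>2 * (of_real (\<omega> \<bullet> \<eta>) ^ 2 * P (\<omega> \<bullet> \<eta>))
          + (2 * \<i> * of_real t) * (of_real (\<omega> \<bullet> \<eta>) ^ 1 * P (\<omega> \<bullet> \<eta>)))"
      by (simp add: fun_eq_iff scaleR_conv_of_real algebra_simps power2_eq_square)
    also have "surf \<dots> = (- (of_real t)\<^sup>2) * surf (\<lambda>\<omega>. P (\<omega> \<bullet> \<eta>)) + (of_real t)\<^sup>2 * surf (\<lambda>\<omega>. of_real (\<omega> \<bullet> \<eta>) ^ 2 * P (\<omega> \<bullet> \<eta>))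
          + (2 * \<i> * of_real t) * surf (\<lambda>\<omega>. of_real (\<omega> \<bullet> \<eta>) ^ 1 * P (\<omega> \<bullet> \<eta>))"
    proof -
      have cP: "continuous_on A (\<lambda>\<omega>. P (\<omega> \<bullet> \<eta>))" for A unfolding P_def by (intro continuous_intros)
      show ?thesis
        by (simp only: surf_add surf_cmul[symmetric] surf_minus[symmetric] cP continuous_on_add continuous_intros)
    qed
    finally have eq0: "(- (of_real t)\<^sup>2) * surf (\<lambda>\<omega>. P (\<omega> \<bullet> \<eta>))
          + (of_real t)\<^sup>2 * surf (\<lambda>\<omega>. of_real (\<omega> \<bullet> \<eta>) ^ 2 * P (\<omega> \<bullet> \<eta>))
          + (2 * \<i> * of_real t) * surf (\<lambda>\<omega>. of_real (\<omega> \<bullet> \<eta>) ^ 1 * P (\<omega> \<bullet> \<eta>)) = 0" .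
    have zk: "surf (\<lambda>\<omega>. of_real (\<omega> \<bullet> \<eta>) ^ k * P (\<omega> \<bullet> \<eta>)) = z k t" for k
      by (simp add: z_def plane_wave_moment_def P_def)
    from zk[of 0] have z0: "surf (\<lambda>\<omega>. P (\<omega> \<bullet> \<eta>)) = z 0 t" by simp
    from eq0 show ?thesis unfolding z0 zk by (simp add: algebra_simps power2_eq_square)
  qed
  have z10: "z 1 0 = 0"
  proof -
    have "surf (\<lambda>\<omega>. (1 - (\<omega> \<bullet> \<eta>)\<^sup>2) *\<^sub>R 0 - (2 * (\<omega> \<bullet> \<eta>)) *\<^sub>R 1) = 0"
      by (rule surf_ridge_laplacian_zero[of of_real, OF _ _ _ \<eta>])
         (auto intro!: derivative_eq_intros)
    then have "surf (\<lambda>\<omega>. (-2) * of_real (\<omega> \<bullet> \<eta>)) = 0"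
      by (simp add: scaleR_conv_of_real)
    then show ?thesis unfolding surf_cmul by (simp add: z_def plane_wave_moment_def)
  qed
  have ode': "2 * (- \<i> * z 1 t) - of_real t * z 2 t = - (of_real t * z 0 t)" for t
  proof (cases "t = 0")
    case False
    have "of_real t * (of_real t * (- z 0 t + z 2 t) + 2 * \<i> * z 1 t) = 0"
      using ode[of t] by (simp add: algebra_simps)
    then have "of_real t * (- z 0 t + z 2 t) + 2 * \<i> * z 1 t = 0"
      using False by (simp only: mult_eq_0_iff of_real_eq_0_iff simp_thms)
    then show ?thesis by algebra
  qed (simp add: z10[simplified])
  define q where "q t = of_real t * z 0 t" for t
  define q' where "q' t = z 0 t + of_real t * (- \<i> * z 1 t)" for t
  have dt: "((\<lambda>t. of_real t) has_vector_derivative (1::complex)) (at t)" for t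
    by (auto intro!: derivative_eq_intros)
  have dq: "(q has_vector_derivative q' t) (at t)" for t
    unfolding q_def q'_def
    by (rule has_vector_derivative_eq_rhs[OF has_vector_derivative_mult[OF dt dz]]) (simp add: algebra_simps)
  have dq': "(q' has_vector_derivative - q t) (at t)" for t
    unfolding q'_def
    by (rule has_vector_derivative_eq_rhs[OF has_vector_derivative_add[OF dz has_vector_derivative_mult[OF dt has_vector_derivative_mult_right[OF dz]]]])
       (use ode'[of t] in \<open>simp add: q_def numeral_2_eq_2 algebra_simps\<close>)
  have ds: "((\<lambda>t. of_real (sin t)) has_vector_derivative complex_of_real (cos t)) (at t)"
    and dc: "((\<lambda>t. of_real (cos t)) has_vector_derivative complex_of_real (- sin t)) (at t)" for t
    by (rule has_vector_derivative_of_real, auto intro!: derivative_eq_intros)+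
  \<comment> \<open>Two first integrals of \<open>q'' = - q\<close>, which together determine \<open>q\<close>.\<close>
  have w: "q t * of_real (sin t) + q' t * of_real (cos t) = 4 * pi" for t
  proof -
    have "((\<lambda>t. q t * of_real (sin t) + q' t * of_real (cos t)) has_vector_derivative 0) (at t within UNIV)" for t
      by (rule has_vector_derivative_eq_rhs[OF has_vector_derivative_add[OF
            has_vector_derivative_mult[OF dq ds] has_vector_derivative_mult[OF dq' dc]]])
         simp
    from has_vector_derivative_zero_constant[OF convex_UNIV this]
    obtain c where c: "\<And>t. q t * of_real (sin t) + q' t * of_real (cos t) = c" by auto
    from c[of 0] have "c = 4 * pi"
      by (simp add: q_def q'_def z_def plane_wave_moment_def surf_one)
    with c show ?thesis by simp
  qed
  have u: "q t * of_real (cos t) - q' t * of_real (sin t) = 0" for t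
  proof -
    have "((\<lambda>t. q t * of_real (cos t) - q' t * of_real (sin t)) has_vector_derivative 0) (at t within UNIV)" for t
      by (rule has_vector_derivative_eq_rhs[OF has_vector_derivative_diff[OF
            has_vector_derivative_mult[OF dq dc] has_vector_derivative_mult[OF dq' ds]]])
         simp
    from has_vector_derivative_zero_constant[OF convex_UNIV this]
    obtain c where c: "\<And>t. q t * of_real (cos t) - q' t * of_real (sin t) = c" by auto
    from c[of 0] have "c = 0" by (simp add: q_def)
    with c show ?thesis by simp
  qed
  have "q t = 4 * pi * sin t" for t
  proof -
    have "(complex_of_real (sin t))\<^sup>2 + (of_real (cos t))\<^sup>2 = 1"
      by (metis of_real_1 of_real_add of_real_power sin_cos_squared_add)
    then show ?thesis using w[of t] u[of t] by simp algebra
  qed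
  from this[of "norm x"] have "z 0 (norm x) = 4 * pi * (sin (norm x) / norm x)"
    using assms by (simp add: q_def field_simps)
  then show ?thesis using assms by (simp add: z_def \<eta>_def plane_wave_moment_def)
qed

text \<open>Differentiating a plane wave moment in the direction \<open>\<eta>\<close> raises \<open>k\<close> by one, up to the factor \<open>- \<i>\<close>. Starting from the
radial function for \<open>k = 0\<close>, each step produces a polynomial in \<open>x \<bullet> \<eta>\<close> with radial coefficients. Only the leading
coefficient is needed explicitly; of the others it matters that they are differentiable.\<close>

lemma plane_wave_moment_expansion:
  assumes \<eta>: "norm \<eta> = 1"
  shows "\<exists>q. (\<forall>m. bessel_span (q m)) \<and> q k = (\<lambda>s. 4 * pi * (2 * \<i>) ^ k * of_real (bessel_chain k s)) \<and>
    (\<forall>x. x \<noteq> 0 \<longrightarrow> plane_wave_moment \<eta> k x = (\<Sum>m\<le>k. of_real (x \<bullet> \<eta>) ^ m * q m ((norm x)\<^sup>2)))"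
proof (induction k)
  case 0
  show ?case
    by (rule exI[of _ "\<lambda>m s. complex_of_real (4 * pi) * complex_of_real (bessel_chain 0 s)"])
       (use plane_wave_moment_0 in \<open>auto intro!: bessel_span.scale bessel_span.chain simp del: bessel_chain.simps\<close>)
next
  case (Suc k)
  then obtain q where q: "\<And>m. bessel_span (q m)" "q k = (\<lambda>s. 4 * pi * (2 * \<i>) ^ k * of_real (bessel_chain k s))"
    "\<And>x. x \<noteq> 0 \<Longrightarrow> plane_wave_moment \<eta> k x = (\<Sum>m\<le>k. of_real (x \<bullet> \<eta>) ^ m * q m ((norm x)\<^sup>2))" by blast
  obtain q0' where q0': "\<And>m. bessel_span (q0' m)" "\<And>m s. s > 0 \<Longrightarrow> (q m has_vector_derivative q0' m s) (at s)"
    using bessel_span_deriv[OF q(1)] by metis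
  \<comment> \<open>The derivative of the leading coefficient is made explicit, because it becomes the next leading coefficient.\<close>
  define q' where "q' m = (if m = k then (\<lambda>s. 4 * pi * (2 * \<i>) ^ k * of_real (bessel_chain (Suc k) s)) else q0' m)" for m
  have q': "bessel_span (q' m)" "s > 0 \<Longrightarrow> (q m has_vector_derivative q' m s) (at s)" for m s
  proof -
    show "bessel_span (q' m)" using q0'(1) by (auto simp: q'_def simp del: bessel_chain.simps intro!: bessel_span.scale bessel_span.chain)
    show "s > 0 \<Longrightarrow> (q m has_vector_derivative q' m s) (at s)"
      using q0'(2)[of s m]
      by (auto simp: q'_def q(2) simp del: bessel_chain.simps intro!: has_vector_derivative_mult_right has_vector_derivative_of_real bessel_chain_deriv)
  qed
  define Q where "Q m s = (if Suc m \<le> k then \<i> * of_nat (Suc m) else 0) * q (Suc m) s + (if m = 0 then 0 else 2 * \<i>) * q' (m - 1) s" for m s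
  have spanQ: "bessel_span (Q m)" for m
    unfolding Q_def by (intro bessel_span.add bessel_span.scale q q')
  have topQ: "Q (Suc k) = (\<lambda>s. 4 * pi * (2 * \<i>) ^ Suc k * of_real (bessel_chain (Suc k) s))"
    by (simp add: Q_def q'_def fun_eq_iff del: bessel_chain.simps)
  have "plane_wave_moment \<eta> (Suc k) x = (\<Sum>m\<le>Suc k. of_real (x \<bullet> \<eta>) ^ m * Q m ((norm x)\<^sup>2))" if x: "x \<noteq> 0" for x
  proof -
    let ?g = "\<lambda>t. x + t *\<^sub>R \<eta>"
    have 1: "((\<lambda>t. plane_wave_moment \<eta> k (?g t)) has_vector_derivative - \<i> * plane_wave_moment \<eta> (Suc k) x) (at 0)"
      using plane_wave_moment_deriv_axis[of \<eta> k x 0] by simp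
    have ds: "((\<lambda>t. complex_of_real (?g t \<bullet> \<eta>)) has_vector_derivative 1) (at 0)"
    proof -
      have "((\<lambda>t. complex_of_real (x \<bullet> \<eta> + t)) has_vector_derivative of_real 1) (at 0)"
        by (rule has_vector_derivative_of_real) (auto intro!: derivative_eq_intros)
      moreover have "?g t \<bullet> \<eta> = x \<bullet> \<eta> + t" for t
        using \<eta> by (simp add: inner_add_left norm_eq_1)
      ultimately show ?thesis by simp
    qed
    have dsm: "((\<lambda>t. complex_of_real (?g t \<bullet> \<eta>) ^ m) has_vector_derivative of_nat m * of_real (x \<bullet> \<eta>) ^ (m - 1)) (at 0)" for m
    proof -
      have "((\<lambda>z::complex. z ^ m) has_field_derivative of_nat m * of_real (x \<bullet> \<eta>) ^ (m - 1)) (at (of_real (?g 0 \<bullet> \<eta>)))"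
        by (auto intro!: derivative_eq_intros)
      from field_vector_diff_chain_at[OF ds this] show ?thesis by (simp add: o_def)
    qed
    have dn: "((\<lambda>t. (norm (?g t))\<^sup>2) has_real_derivative 2 * (x \<bullet> \<eta>)) (at 0)"
    proof -
      have "(\<lambda>t. (norm (?g t))\<^sup>2) = (\<lambda>t. (norm x)\<^sup>2 + t * (2 * (x \<bullet> \<eta>)) + t * t)"
        using \<eta> by (simp add: fun_eq_iff power2_norm_eq_inner inner_add_left inner_add_right inner_commute norm_eq_1 algebra_simps)
      then show ?thesis by (auto intro!: derivative_eq_intros)
    qed
    have dq: "((\<lambda>t. q m ((norm (?g t))\<^sup>2)) has_vector_derivative (2 * (x \<bullet> \<eta>)) *\<^sub>R q' m ((norm x)\<^sup>2)) (at 0)" for m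
      using vector_diff_chain_at[OF dn[unfolded has_real_derivative_iff_has_vector_derivative], of "q m" "q' m ((norm x)\<^sup>2)"] q'(2)[of "(norm x)\<^sup>2" m] x
      by (simp add: o_def)
    have "((\<lambda>t. \<Sum>m\<le>k. of_real (?g t \<bullet> \<eta>) ^ m * q m ((norm (?g t))\<^sup>2)) has_vector_derivative
      (\<Sum>m\<le>k. of_real (?g 0 \<bullet> \<eta>) ^ m * ((2 * (x \<bullet> \<eta>)) *\<^sub>R q' m ((norm x)\<^sup>2)) + (of_nat m * of_real (x \<bullet> \<eta>) ^ (m - 1)) * q m ((norm (?g 0))\<^sup>2))) (at 0)"
      by (intro has_vector_derivative_sum has_vector_derivative_mult dsm dq)
    then have 2: "((\<lambda>t. plane_wave_moment \<eta> k (?g t)) has_vector_derivative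
      (\<Sum>m\<le>k. of_real (x \<bullet> \<eta>) ^ m * ((2 * (x \<bullet> \<eta>)) *\<^sub>R q' m ((norm x)\<^sup>2)) + (of_nat m * of_real (x \<bullet> \<eta>) ^ (m - 1)) * q m ((norm x)\<^sup>2))) (at 0)"
      by (rule has_vector_derivative_transform_within_open[OF has_vector_derivative_eq_rhs, of _ _ _ _ "{t. ?g t \<noteq> 0}"])
         (use x q(3) in \<open>auto intro!: open_Collect_neq continuous_intros\<close>)
    define X where "X = complex_of_real (x \<bullet> \<eta>)"
    define N where "N = (norm x)\<^sup>2"
    have "plane_wave_moment \<eta> (Suc k) x = \<i> * (\<Sum>m\<le>k. X ^ m * ((2 * (x \<bullet> \<eta>)) *\<^sub>R q' m N) + (of_nat m * X ^ (m - 1)) * q m N)"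
    proof -
      have "plane_wave_moment \<eta> (Suc k) x = \<i> * (- \<i> * plane_wave_moment \<eta> (Suc k) x)" by simp
      then show ?thesis unfolding vector_derivative_unique_at[OF 1 2] X_def N_def .
    qed
    also have "\<dots> = (\<Sum>m\<le>k. 2 * \<i> * X ^ Suc m * q' m N) + (\<Sum>m\<le>k. \<i> * of_nat m * X ^ (m - 1) * q m N)"
      by (simp add: sum.distrib sum_distrib_left X_def scaleR_conv_of_real algebra_simps)
    also have "(\<Sum>m\<le>k. \<i> * of_nat m * X ^ (m - 1) * q m N) = (\<Sum>m<k. \<i> * of_nat (Suc m) * X ^ m * q (Suc m) N)"
      by (cases k) (simp_all add: sum.atMost_Suc_shift lessThan_Suc_atMost del: sum.atMost_Suc)
    also have "\<dots> = (\<Sum>m\<le>Suc k. X ^ m * ((if Suc m \<le> k then \<i> * of_nat (Suc m) else 0) * q (Suc m) N))"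
      by (rule sum.mono_neutral_cong_left) (auto simp: mult_ac)
    also have "(\<Sum>m\<le>k. 2 * \<i> * X ^ Suc m * q' m N) = (\<Sum>m\<le>Suc k. X ^ m * ((if m = 0 then 0 else 2 * \<i>) * q' (m - 1) N))"
      by (subst sum.atMost_Suc_shift) (simp add: mult_ac)
    finally show ?thesis
      unfolding Q_def X_def[symmetric] N_def[symmetric] distrib_left sum.distrib by (simp only: add.commute)
  qed
  with spanQ topQ show ?case by blast
qed

section \<open>Outgoing solutions of the radial equation\<close>

text \<open>The function \<open>b = r A\<close> satisfies \<open>b'' + (\<kappa>\<^sup>2 - l / r\<^sup>2) b = 0\<close>. Its flux \<open>W = Im (b' cnj b)\<close> is constant, and the real relation
between \<open>A\<close> and its derivative at \<open>R\<close> makes it zero. The energy \<open>H = |b'|\<^sup>2 + \<kappa>\<^sup>2 |b|\<^sup>2\<close> equals \<open>|b' - \<i> \<kappa> b|\<^sup>2 + 2 \<kappa> W\<close>, so it tends to zero by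
the radiation condition. But the energy can decay by at most a bounded factor, because its logarithmic derivative is
integrable at infinity; hence it is zero throughout.\<close>

lemma outgoing_ode_zero:
  fixes A A1 A2 :: "real \<Rightarrow> complex" and l \<kappa> R c c' :: real
  assumes R: "R > 0" and \<kappa>: "\<kappa> > 0" and l: "l \<ge> 0"
    and dA: "\<And>r. r \<ge> R \<Longrightarrow> (A has_vector_derivative A1 r) (at r)"
    and dA1: "\<And>r. r \<ge> R \<Longrightarrow> (A1 has_vector_derivative A2 r) (at r)"
    and ode: "\<And>r. r \<ge> R \<Longrightarrow> r\<^sup>2 *\<^sub>R A2 r + (2 * r) *\<^sub>R A1 r + (\<kappa>\<^sup>2 * r\<^sup>2 - l) *\<^sub>R A r = 0"
    and lim: "(A \<longlongrightarrow> 0) at_top" "((\<lambda>r. r *\<^sub>R (A1 r - \<i> * of_real \<kappa> * A r)) \<longlongrightarrow> 0) at_top"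
    and bc: "c *\<^sub>R A1 R + c' *\<^sub>R A R = 0" "c \<noteq> 0 \<or> c' \<noteq> 0"
    and r: "r \<ge> R"
  shows "A r = 0"
proof -
  \<comment> \<open>Real and imaginary parts of \<open>b\<close> and of its derivative.\<close>
  define x x1 y y1 where "x r = r * Re (A r)" and "x1 r = Re (A r) + r * Re (A1 r)"
    and "y r = r * Im (A r)" and "y1 r = Im (A r) + r * Im (A1 r)" for r
  define Q where "Q r = \<kappa>\<^sup>2 - l / r\<^sup>2" for r
  have dRe: "((\<lambda>r. Re (A r)) has_real_derivative Re (A1 r)) (at r)"
    "((\<lambda>r. Im (A r)) has_real_derivative Im (A1 r)) (at r)"
    "((\<lambda>r. Re (A1 r)) has_real_derivative Re (A2 r)) (at r)"
    "((\<lambda>r. Im (A1 r)) has_real_derivative Im (A2 r)) (at r)" if "r \<ge> R" for r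
    unfolding has_real_derivative_iff_has_vector_derivative
    by (rule bounded_linear.has_vector_derivative[OF bounded_linear_Re dA[OF that]]
        bounded_linear.has_vector_derivative[OF bounded_linear_Im dA[OF that]]
        bounded_linear.has_vector_derivative[OF bounded_linear_Re dA1[OF that]]
        bounded_linear.has_vector_derivative[OF bounded_linear_Im dA1[OF that]])+
  have dx: "(x has_real_derivative x1 r) (at r)" "(y has_real_derivative y1 r) (at r)" if "r \<ge> R" for r
    unfolding x_def x1_def y_def y1_def
    by (auto intro!: derivative_eq_intros dA dA1 that)
  have dx1: "(x1 has_real_derivative - Q r * x r) (at r)" "(y1 has_real_derivative - Q r * y r) (at r)" if "r \<ge> R" for r
  proof -
    have rp: "r > 0" using that R by simp
    have re: "r\<^sup>2 * Re (A2 r) + 2 * r * Re (A1 r) + (\<kappa>\<^sup>2 * r\<^sup>2 - l) * Re (A r) = 0"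
      using arg_cong[OF ode[OF that], of Re] by simp
    have im: "r\<^sup>2 * Im (A2 r) + 2 * r * Im (A1 r) + (\<kappa>\<^sup>2 * r\<^sup>2 - l) * Im (A r) = 0"
      using arg_cong[OF ode[OF that], of Im] by simp
    have Q: "Q r * (r * u) * r = (\<kappa>\<^sup>2 * r\<^sup>2 - l) * u" for u
      using rp by (simp add: Q_def field_simps power2_eq_square)
    have "(2 * Re (A1 r) + r * Re (A2 r)) * r = (- Q r * x r) * r"
      using re Q[of "Re (A r)"] by (simp add: x_def algebra_simps power2_eq_square)
    then have e1: "2 * Re (A1 r) + r * Re (A2 r) = - Q r * x r"
      using rp by (simp only: mult_cancel_right) simp
    have "(2 * Im (A1 r) + r * Im (A2 r)) * r = (- Q r * y r) * r"
      using im Q[of "Im (A r)"] by (simp add: y_def algebra_simps power2_eq_square)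
    then have e2: "2 * Im (A1 r) + r * Im (A2 r) = - Q r * y r"
      using rp by (simp only: mult_cancel_right) simp
    show "(x1 has_real_derivative - Q r * x r) (at r)"
      unfolding e1[symmetric] unfolding x1_def by (auto intro!: derivative_eq_intros dA dA1 that)
    show "(y1 has_real_derivative - Q r * y r) (at r)"
      unfolding e2[symmetric] unfolding y1_def by (auto intro!: derivative_eq_intros dA dA1 that)
  qed
  define W where "W r = y1 r * x r - x1 r * y r" for r
  have dW: "(W has_real_derivative 0) (at r)" if "r \<ge> R" for r
    unfolding W_def by (auto intro!: derivative_eq_intros dx dx1 that simp: algebra_simps)
  have WR: "W R = 0"
  proof -
    have re: "c * Re (A1 R) + c' * Re (A R) = 0" using arg_cong[OF bc(1), of Re] by simp
    have im: "c * Im (A1 R) + c' * Im (A R) = 0" using arg_cong[OF bc(1), of Im] by simp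
    have eq: "W R = R\<^sup>2 * (Im (A1 R) * Re (A R) - Re (A1 R) * Im (A R))"
      by (simp add: W_def x_def y_def x1_def y1_def algebra_simps power2_eq_square)
    have "c * (Im (A1 R) * Re (A R) - Re (A1 R) * Im (A R)) = 0"
      "c' * (Im (A1 R) * Re (A R) - Re (A1 R) * Im (A R)) = 0"
      using re im by algebra+
    with bc(2) have "Im (A1 R) * Re (A R) - Re (A1 R) * Im (A R) = 0"
      by (metis mult_eq_0_iff)
    then show ?thesis unfolding eq by simp
  qed
  have W0: "W r = 0" if "r \<ge> R" for r
  proof -
    have "W R = W r"
    proof (cases "r = R")
      case False
      show ?thesis
        by (rule DERIV_isconst_end[symmetric])
           (use False that dW in \<open>auto intro!: continuous_at_imp_continuous_on DERIV_isCont\<close>)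
    qed simp
    with WR show ?thesis by simp
  qed
  define H where "H r = (x1 r)\<^sup>2 + (y1 r)\<^sup>2 + \<kappa>\<^sup>2 * ((x r)\<^sup>2 + (y r)\<^sup>2)" for r
  have H0: "H r \<ge> 0" for r unfolding H_def by simp
  have limH: "(H \<longlongrightarrow> 0) at_top"
  proof -
    have "((\<lambda>r. (norm (A r + r *\<^sub>R (A1 r - \<i> * of_real \<kappa> * A r)))\<^sup>2) \<longlongrightarrow> (norm (0 + 0 :: complex))\<^sup>2) at_top"
      by (intro tendsto_intros lim)
    moreover have "\<forall>\<^sub>F r in at_top. (norm (A r + r *\<^sub>R (A1 r - \<i> * of_real \<kappa> * A r)))\<^sup>2 = H r"
    proof (rule eventually_mono[OF eventually_ge_at_top[of R]])
      fix r assume r: "r \<ge> R"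
      have "(norm (A r + r *\<^sub>R (A1 r - \<i> * of_real \<kappa> * A r)))\<^sup>2
        = (x1 r + \<kappa> * y r)\<^sup>2 + (y1 r - \<kappa> * x r)\<^sup>2"
        unfolding cmod_power2 by (simp add: x_def x1_def y_def y1_def algebra_simps)
      also have "\<dots> = H r - 2 * \<kappa> * W r"
        by (simp add: H_def W_def power2_eq_square algebra_simps)
      finally show "(norm (A r + r *\<^sub>R (A1 r - \<i> * of_real \<kappa> * A r)))\<^sup>2 = H r"
        using W0[OF r] by simp
    qed
    ultimately show ?thesis by (simp add: tendsto_cong)
  qed
  \<comment> \<open>The integrating factor compensates the largest possible decay of the energy, so that \<open>G\<close> is nondecreasing.\<close>
  define G where "G r = H r * exp (- l / (\<kappa> * r))" for r
  have monoG: "G r \<le> G s" if "R \<le> r" "r \<le> s" for r s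
  proof (rule DERIV_nonneg_imp_nondecreasing[OF that(2)])
    fix t assume t: "r \<le> t" "t \<le> s"
    then have tR: "t \<ge> R" and tp: "t > 0" using that R by auto
    have dH: "(H has_real_derivative 2 * (l / t\<^sup>2) * (x t * x1 t + y t * y1 t)) (at t)"
      unfolding H_def
      by (auto intro!: derivative_eq_intros dx dx1 tR simp: Q_def algebra_simps add_divide_distrib)
    have de: "((\<lambda>r. exp (- l / (\<kappa> * r))) has_real_derivative exp (- l / (\<kappa> * t)) * (l / (\<kappa> * t\<^sup>2))) (at t)"
      using tp \<kappa> by (auto intro!: derivative_eq_intros simp: field_simps power2_eq_square)
    have "(G has_real_derivative (H t * (exp (- l / (\<kappa> * t)) * (l / (\<kappa> * t\<^sup>2))) + (2 * (l / t\<^sup>2) * (x t * x1 t + y t * y1 t)) * exp (- l / (\<kappa> * t)))) (at t)"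
      unfolding G_def by (rule DERIV_cong[OF DERIV_mult[OF dH de]]) simp
    moreover have "H t * (exp (- l / (\<kappa> * t)) * (l / (\<kappa> * t\<^sup>2))) + (2 * (l / t\<^sup>2) * (x t * x1 t + y t * y1 t)) * exp (- l / (\<kappa> * t))
      = exp (- l / (\<kappa> * t)) * (l / (\<kappa> * t\<^sup>2)) * ((x1 t + \<kappa> * x t)\<^sup>2 + (y1 t + \<kappa> * y t)\<^sup>2)"
    proof -
      have "2 * (l / t\<^sup>2) = 2 * \<kappa> * (l / (\<kappa> * t\<^sup>2))" using \<kappa> by simp
      then show ?thesis using \<kappa> by (simp only: H_def) (simp add: algebra_simps power2_eq_square)
    qed
    ultimately show "\<exists>d. (G has_real_derivative d) (at t) \<and> 0 \<le> d"
      using l \<kappa> by (intro exI conjI) (assumption, simp)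
  qed
  have "G r \<le> 0"
  proof (rule tendsto_lowerbound[OF limH])
    show "\<forall>\<^sub>F s in at_top. G r \<le> H s"
    proof (rule eventually_mono[OF eventually_ge_at_top[of r]])
      fix s assume s: "s \<ge> r"
      have "G r \<le> G s" using monoG r s by simp
      also have "\<dots> \<le> H s * 1"
        unfolding G_def using s r R l \<kappa> by (intro mult_left_mono H0) simp
      finally show "G r \<le> H s" by simp
    qed
  qed simp
  then have "H r = 0" using H0[of r] by (simp add: G_def mult_le_0_iff not_less)
  then have "(x r)\<^sup>2 + (y r)\<^sup>2 = 0"
    using \<kappa> unfolding H_def by (smt (verit) mult_nonneg_nonneg mult_eq_0_iff zero_le_power2 zero_eq_power2)
  then have "x r = 0" "y r = 0" by (simp_all add: sum_power2_eq_zero_iff)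
  then show ?thesis using R r by (simp add: x_def y_def complex_eq_iff)
qed

section \<open>Completeness of the zonal moments\<close>

text \<open>Legendre's operator applied to the power \<open>n + 1\<close> of \<open>(1 + s) / 2\<close> is a combination of the powers \<open>n\<close> and \<open>n + 1\<close>. It
integrates to zero, which gives a recursion for the integrals.\<close>

lemma surf_peak:
  assumes \<eta>: "norm \<eta> = 1"
  shows "surf (\<lambda>\<omega>. of_real (((1 + \<omega> \<bullet> \<eta>) / 2) ^ n)) = of_real (4 * pi / real (Suc n))"
proof (induction n)
  case 0
  then show ?case by (simp add: surf_one)
next
  case (Suc n)
  define P where "P s = complex_of_real (((1 + s) / 2) ^ Suc n)" for s
  define P' where "P' s = complex_of_real (real (Suc n) * ((1 + s) / 2) ^ n / 2)" for s
  define P'' where "P'' s = complex_of_real (real (Suc n) * (real n * ((1 + s) / 2) ^ (n - 1) / 2) / 2)" for s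
  have dX: "((\<lambda>s. (1 + s) / 2) has_real_derivative 1 / 2) (at s)" for s :: real
    by (auto intro!: derivative_eq_intros)
  have 1: "(P has_vector_derivative P' s) (at s)" "(P' has_vector_derivative P'' s) (at s)" for s
    unfolding P_def P'_def P''_def
    by (rule has_vector_derivative_of_real, rule DERIV_cong[OF DERIV_power[OF dX]], simp)
       (rule has_vector_derivative_of_real, rule DERIV_cong[OF DERIV_cdivide[OF DERIV_cmult[OF DERIV_power[OF dX]]]], simp)
  have "surf (\<lambda>\<omega>. (1 - (\<omega> \<bullet> \<eta>)\<^sup>2) *\<^sub>R P'' (\<omega> \<bullet> \<eta>) - (2 * (\<omega> \<bullet> \<eta>)) *\<^sub>R P' (\<omega> \<bullet> \<eta>)) = 0"
    by (rule surf_ridge_laplacian_zero[OF 1 _ \<eta>]) (auto simp: P''_def intro!: continuous_intros)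
  also have "(\<lambda>\<omega>. (1 - (\<omega> \<bullet> \<eta>)\<^sup>2) *\<^sub>R P'' (\<omega> \<bullet> \<eta>) - (2 * (\<omega> \<bullet> \<eta>)) *\<^sub>R P' (\<omega> \<bullet> \<eta>))
     = (\<lambda>\<omega>. of_real ((real (Suc n))\<^sup>2) * of_real (((1 + \<omega> \<bullet> \<eta>) / 2) ^ n)
          - of_real (real (Suc n) * real (Suc (Suc n))) * of_real (((1 + \<omega> \<bullet> \<eta>) / 2) ^ Suc n))"
  proof
    fix \<omega>
    define s where "s = \<omega> \<bullet> \<eta>"
    define X where "X = (1 + s) / 2"
    have s: "s = 2 * X - 1" by (simp add: X_def field_simps)
    have "(1 - s\<^sup>2) * (real (Suc n) * (real n * X ^ (n - 1) / 2) / 2) - (2 * s) * (real (Suc n) * X ^ n / 2)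
       = (real (Suc n))\<^sup>2 * X ^ n - real (Suc n) * real (Suc (Suc n)) * X ^ Suc n"
    proof -
      have nX: "real n * X ^ (n - 1) * X = real n * X ^ n" by (cases n) auto
      define Y Z where "Y = X ^ (n - 1)" and "Z = X ^ n"
      have "(1 - s\<^sup>2) * (real (Suc n) * (real n * Y / 2) / 2) - (2 * s) * (real (Suc n) * Z / 2)
         = real (Suc n) * (real n * Y * X) * (1 - X) - (2 * X - 1) * real (Suc n) * Z"
        unfolding s by (simp add: field_simps power2_eq_square)
      also have "real n * Y * X = real n * Z" using nX by (simp add: Y_def Z_def)
      also have "real (Suc n) * (real n * Z) * (1 - X) - (2 * X - 1) * real (Suc n) * Z
         = (real (Suc n))\<^sup>2 * Z - real (Suc n) * real (Suc (Suc n)) * (X * Z)"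
        by (simp add: algebra_simps power2_eq_square)
      finally show ?thesis by (simp add: Y_def Z_def)
    qed
    from arg_cong[OF this, of complex_of_real]
    show "(1 - (\<omega> \<bullet> \<eta>)\<^sup>2) *\<^sub>R P'' (\<omega> \<bullet> \<eta>) - (2 * (\<omega> \<bullet> \<eta>)) *\<^sub>R P' (\<omega> \<bullet> \<eta>) =
       of_real ((real (Suc n))\<^sup>2) * of_real (((1 + \<omega> \<bullet> \<eta>) / 2) ^ n)
          - of_real (real (Suc n) * real (Suc (Suc n))) * of_real (((1 + \<omega> \<bullet> \<eta>) / 2) ^ Suc n)"
      unfolding P'_def P''_def scaleR_conv_of_real s_def[symmetric] X_def[symmetric] of_real_mult[symmetric] of_real_diff[symmetric] .
  qed
  also have "surf \<dots> = of_real ((real (Suc n))\<^sup>2) * surf (\<lambda>\<omega>. of_real (((1 + \<omega> \<bullet> \<eta>) / 2) ^ n))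
     - of_real (real (Suc n) * real (Suc (Suc n))) * surf (\<lambda>\<omega>. of_real (((1 + \<omega> \<bullet> \<eta>) / 2) ^ Suc n))"
    by (subst surf_diff) (auto intro!: continuous_intros simp: surf_cmul simp del: of_real_power power_Suc)
  finally have "of_real (real (Suc n) * real (Suc (Suc n))) * surf (\<lambda>\<omega>. of_real (((1 + \<omega> \<bullet> \<eta>) / 2) ^ Suc n))
     = complex_of_real ((real (Suc n))\<^sup>2) * of_real (4 * pi / real (Suc n))"
    unfolding Suc.IH by simp
  also have "\<dots> = of_real (real (Suc n) * real (Suc (Suc n))) * of_real (4 * pi / real (Suc (Suc n)))"
    unfolding of_real_mult[symmetric] by (rule arg_cong[of _ _ of_real]) (simp add: field_simps power2_eq_square)
  finally show ?case
    by (subst (asm) mult_cancel_left) (simp del: of_nat_Suc of_real_mult)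
qed

text \<open>By linearity \<open>f\<close> integrates to zero against the polynomials \<open>((1 + \<omega> \<bullet> \<eta>) / 2)\<^sup>n\<close>. Away from \<open>\<eta>\<close> they decay
geometrically in \<open>n\<close>, while by \<open>surf_peak\<close> their integrals decay only like \<open>1 / n\<close>. After normalisation they
therefore concentrate at \<open>\<eta>\<close>.\<close>

lemma zero_of_surf_moments_zero:
  assumes f: "continuous_on (sphere 0 1) f" and \<eta>: "norm \<eta> = 1"
    and mom: "\<And>k. surf (\<lambda>\<omega>. f \<omega> * of_real (\<omega> \<bullet> \<eta>) ^ k) = 0"
  shows "f \<eta> = 0"
proof -
  let ?K = "\<lambda>n \<omega>. ((1 + \<omega> \<bullet> \<eta>) / 2) ^ n"
  have sK: "surf (\<lambda>\<omega>. f \<omega> * of_real (?K n \<omega>)) = 0" for n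
  proof -
    have "(\<lambda>\<omega>. f \<omega> * of_real (?K n \<omega>)) = (\<lambda>\<omega>. of_real (1 / 2 ^ n) * (\<Sum>k\<le>n. of_nat (n choose k) * (f \<omega> * of_real (\<omega> \<bullet> \<eta>) ^ k)))"
    proof
      fix \<omega>
      have "(1 + complex_of_real (\<omega> \<bullet> \<eta>)) ^ n = (\<Sum>k\<le>n. of_nat (n choose k) * of_real (\<omega> \<bullet> \<eta>) ^ k)"
        using binomial_ring[of "complex_of_real (\<omega> \<bullet> \<eta>)" 1 n] by (simp add: add.commute)
      then show "f \<omega> * of_real (?K n \<omega>) = of_real (1 / 2 ^ n) * (\<Sum>k\<le>n. of_nat (n choose k) * (f \<omega> * of_real (\<omega> \<bullet> \<eta>) ^ k))"
        by (simp add: power_divide sum_distrib_left sum_divide_distrib mult_ac)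
    qed
    moreover have "surf \<dots> = of_real (1 / 2 ^ n) * (\<Sum>k\<le>n. of_nat (n choose k) * surf (\<lambda>\<omega>. f \<omega> * of_real (\<omega> \<bullet> \<eta>) ^ k))"
      by (simp only: surf_cmul) (subst surf_sum, auto intro!: continuous_intros f simp: surf_cmul)
    ultimately show ?thesis by (simp add: mom)
  qed
  obtain M where M: "\<And>\<omega>. norm \<omega> = 1 \<Longrightarrow> norm (f \<omega>) \<le> M"
    using compact_imp_bounded[OF compact_continuous_image[OF f compact_sphere]]
    by (metis bounded_iff imageI mem_sphere_0)
  have M0: "M \<ge> 0" using M[OF \<eta>] norm_ge_zero order_trans by blast
  have "norm (f \<eta>) \<le> \<epsilon>" if \<epsilon>: "\<epsilon> > 0" for \<epsilon>
  proof -
    obtain d where d: "d > 0" "\<And>\<omega>. norm \<omega> = 1 \<Longrightarrow> dist \<omega> \<eta> < d \<Longrightarrow> dist (f \<omega>) (f \<eta>) < \<epsilon>"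
      using f[unfolded continuous_on_iff, rule_format, of \<eta> \<epsilon>] \<eta> \<epsilon> by (metis mem_sphere_0)
    \<comment> \<open>A bound for the base of the power at distance at least \<open>d\<close> from \<open>\<eta>\<close>. For \<open>d > 2\<close> there are no such points
and the formula may be negative.\<close>
    define q where "q = max 0 (1 - d\<^sup>2 / 4)"
    have q: "0 \<le> q" "q < 1" using d by (auto simp: q_def)
    have bound: "norm (f \<eta>) \<le> \<epsilon> + 2 * M * (real (Suc n) * q ^ n)" for n
    proof -
      have inner01: "0 \<le> (1 + \<omega> \<bullet> \<eta>) / 2" "(1 + \<omega> \<bullet> \<eta>) / 2 \<le> 1" if "norm \<omega> = 1" for \<omega>
        using Cauchy_Schwarz_ineq2[of \<omega> \<eta>] that \<eta> by auto
      have pt: "norm ((f \<eta> - f \<omega>) * of_real (?K n \<omega>)) \<le> \<epsilon> * ?K n \<omega> + 2 * M * q ^ n" if w: "norm \<omega> = 1" for \<omega>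
      proof (cases "dist \<omega> \<eta> < d")
        case True
        have "norm (f \<eta> - f \<omega>) \<le> \<epsilon>" using d(2)[OF w True] by (simp add: dist_norm norm_minus_commute)
        then have "norm ((f \<eta> - f \<omega>) * of_real (?K n \<omega>)) \<le> \<epsilon> * ?K n \<omega>"
          using inner01[OF w] \<epsilon> unfolding norm_mult norm_of_real by (intro mult_mono) auto
        also have "\<dots> \<le> \<epsilon> * ?K n \<omega> + 2 * M * q ^ n" using M0 q by simp
        finally show ?thesis .
      next
        case False
        have "(norm (\<omega> - \<eta>))\<^sup>2 = 2 - 2 * (\<omega> \<bullet> \<eta>)"
          using w \<eta> by (simp add: power2_norm_eq_inner inner_diff_left inner_diff_right inner_commute norm_eq_1)
        moreover have "d\<^sup>2 \<le> (norm (\<omega> - \<eta>))\<^sup>2"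
          using False d by (intro power_mono) (auto simp: dist_norm)
        ultimately have "(1 + \<omega> \<bullet> \<eta>) / 2 \<le> 1 - d\<^sup>2 / 4" by simp
        also have "\<dots> \<le> q" by (simp add: q_def)
        finally have "(1 + \<omega> \<bullet> \<eta>) / 2 \<le> q" .
        then have "?K n \<omega> \<le> q ^ n" using inner01[OF w] by (intro power_mono)
        moreover have "norm (f \<eta> - f \<omega>) \<le> 2 * M" using M[OF w] M[OF \<eta>] norm_triangle_ineq4[of "f \<eta>" "f \<omega>"] by simp
        ultimately have "norm ((f \<eta> - f \<omega>) * of_real (?K n \<omega>)) \<le> 2 * M * q ^ n"
          using inner01[OF w] M0 unfolding norm_mult norm_of_real by (intro mult_mono) auto
        also have "\<dots> \<le> \<epsilon> * ?K n \<omega> + 2 * M * q ^ n" using inner01[OF w] \<epsilon> by simp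
        finally show ?thesis .
      qed
      have cK: "continuous_on A (\<lambda>\<omega>. complex_of_real (?K n \<omega>))" "continuous_on A (?K n)" for A
        by (intro continuous_intros; simp)+
      have "f \<eta> * of_real (4 * pi / real (Suc n)) = surf (\<lambda>\<omega>. f \<eta> * of_real (?K n \<omega>)) - surf (\<lambda>\<omega>. f \<omega> * of_real (?K n \<omega>))"
        unfolding sK surf_cmul surf_peak[OF \<eta>] by simp
      also have "\<dots> = surf (\<lambda>\<omega>. (f \<eta> - f \<omega>) * of_real (?K n \<omega>))"
        by (subst surf_diff[symmetric]) (intro continuous_intros f cK | simp add: left_diff_distrib)+
      finally have "norm (f \<eta>) * (4 * pi / real (Suc n)) = norm (surf (\<lambda>\<omega>. (f \<eta> - f \<omega>) * of_real (?K n \<omega>)))"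
        by (metis norm_mult norm_of_real abs_of_nonneg divide_nonneg_nonneg mult_nonneg_nonneg of_nat_0_le_iff pi_ge_zero zero_le_numeral)
      also have "\<dots> \<le> Re (surf (\<lambda>\<omega>. of_real (\<epsilon> * ?K n \<omega> + 2 * M * q ^ n)))"
        by (rule surf_of_real_norm_le) (intro continuous_intros f cK pt | simp)+
      also have "surf (\<lambda>\<omega>. of_real (\<epsilon> * ?K n \<omega> + 2 * M * q ^ n)) = of_real \<epsilon> * of_real (4 * pi / real (Suc n)) + of_real (2 * M * q ^ n) * of_real (4 * pi)"
      proof -
        have "surf (\<lambda>\<omega>. of_real (\<epsilon> * ?K n \<omega> + 2 * M * q ^ n)) = surf (\<lambda>\<omega>. of_real \<epsilon> * of_real (?K n \<omega>) + of_real (2 * M * q ^ n) * 1)"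
          by (rule surf_cong) simp
        also have "\<dots> = surf (\<lambda>\<omega>. of_real \<epsilon> * of_real (?K n \<omega>)) + surf (\<lambda>\<omega>. of_real (2 * M * q ^ n) * 1)"
          by (rule surf_add) (intro continuous_intros cK)+
        finally show ?thesis unfolding surf_cmul surf_peak[OF \<eta>] surf_one .
      qed
      also have "Re \<dots> = \<epsilon> * (4 * pi / real (Suc n)) + (2 * M * q ^ n) * (4 * pi)"
        unfolding of_real_mult[symmetric] of_real_add[symmetric] Re_complex_of_real ..
      also have "\<dots> = (\<epsilon> + 2 * M * (real (Suc n) * q ^ n)) * (4 * pi / real (Suc n))"
        by (simp add: field_simps del: of_nat_Suc)
      finally show ?thesis by (rule mult_right_le_imp_le) (simp del: of_nat_Suc)
    qed
    have "(\<lambda>n. real n * q ^ n) \<longlonglongrightarrow> 0"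
      using powser_times_n_limit_0[of q] q by simp
    moreover have "(\<lambda>n. q ^ n) \<longlonglongrightarrow> 0" using q by (intro LIMSEQ_power_zero) simp
    ultimately have "(\<lambda>n. real n * q ^ n + q ^ n) \<longlonglongrightarrow> 0 + 0" by (rule tendsto_add)
    then have "(\<lambda>n. real (Suc n) * q ^ n) \<longlonglongrightarrow> 0" by (simp add: algebra_simps)
    then have "(\<lambda>n. \<epsilon> + 2 * M * (real (Suc n) * q ^ n)) \<longlonglongrightarrow> \<epsilon> + 2 * M * 0"
      by (intro tendsto_intros)
    then have "norm (f \<eta>) \<le> \<epsilon> + 2 * M * 0"
      by (rule LIMSEQ_le_const) (use bound in blast)
    then show ?thesis by simp
  qed
  then have "norm (f \<eta>) \<le> 0" by (meson dense_ge)
  then show ?thesis by simp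
qed


section \<open>Radiating scalar fields\<close>

lemma C2_scale:
  assumes "C2 U e D H"
  shows "C2 {x. r *\<^sub>R x \<in> U} (\<lambda>x. e (r *\<^sub>R x)) (\<lambda>i x. r *\<^sub>R D i (r *\<^sub>R x)) (\<lambda>i j x. r\<^sup>2 *\<^sub>R H i j (r *\<^sub>R x))"
proof -
  have chain: "((\<lambda>x. f (r *\<^sub>R x)) has_derivative (\<lambda>h. \<Sum>i\<in>UNIV. h$i *\<^sub>R (r *\<^sub>R E i (r *\<^sub>R x)))) (at x)"
    if "grad U f E" "r *\<^sub>R x \<in> U" for f E x
  proof -
    have "((\<lambda>x. f (r *\<^sub>R x)) has_derivative (\<lambda>h. \<Sum>i\<in>UNIV. (r *\<^sub>R h)$i *\<^sub>R E i (r *\<^sub>R x))) (at x)"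
      by (rule has_derivative_compose[where f = "\<lambda>x. r *\<^sub>R x" and g = f, OF _ gradD[OF that]]) (auto intro!: derivative_eq_intros)
    then show ?thesis by (simp add: mult.commute)
  qed
  have "grad {x. r *\<^sub>R x \<in> U} (\<lambda>x. e (r *\<^sub>R x)) (\<lambda>i x. r *\<^sub>R D i (r *\<^sub>R x))"
    unfolding grad_def using chain[OF C2D(1)[OF assms]] by blast
  moreover have "grad {x. r *\<^sub>R x \<in> U} (\<lambda>x. r *\<^sub>R D i (r *\<^sub>R x)) (\<lambda>j x. r\<^sup>2 *\<^sub>R H i j (r *\<^sub>R x))" for i
    unfolding grad_def
  proof
    fix x assume "x \<in> {x. r *\<^sub>R x \<in> U}"
    then have x: "r *\<^sub>R x \<in> U" by simp
    show "((\<lambda>x. r *\<^sub>R D i (r *\<^sub>R x)) has_derivative (\<lambda>h. \<Sum>j\<in>UNIV. h$j *\<^sub>R r\<^sup>2 *\<^sub>R H i j (r *\<^sub>R x))) (at x)"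
      by (rule has_derivative_eq_rhs[OF has_derivative_scaleR_right[OF chain[OF C2D(2)[OF assms] x]]])
         (simp add: fun_eq_iff scaleR_sum_right power2_eq_square mult_ac)
  qed
  moreover have "continuous_on {x. r *\<^sub>R x \<in> U} (\<lambda>x. r\<^sup>2 *\<^sub>R H i j (r *\<^sub>R x))" for i j
    by (intro continuous_intros continuous_on_compose2[OF C2D(3)[OF assms]]) auto
  ultimately show ?thesis using C2D(4)[OF assms] by (auto simp: C2_def)
qed

lemma tendsto_surf_zero:
  assumes cont: "\<forall>\<^sub>F r in F. continuous_on (sphere 0 1) (f r)"
    and lim: "\<And>\<epsilon>. \<epsilon> > 0 \<Longrightarrow> \<forall>\<^sub>F r in F. \<forall>\<omega>. norm \<omega> = 1 \<longrightarrow> norm (f r \<omega>) \<le> \<epsilon>"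
  shows "((\<lambda>r. surf (f r)) \<longlongrightarrow> 0) F"
proof (rule tendstoI)
  fix \<epsilon> :: real assume \<epsilon>: "\<epsilon> > 0"
  then have "\<forall>\<^sub>F r in F. \<forall>\<omega>. norm \<omega> = 1 \<longrightarrow> norm (f r \<omega>) \<le> \<epsilon> / (8 * pi)"
    by (intro lim) simp
  with cont show "\<forall>\<^sub>F r in F. dist (surf (f r)) 0 < \<epsilon>"
  proof eventually_elim
    case (elim r)
    have "norm (surf (f r)) \<le> Re (surf (\<lambda>\<omega>. of_real (\<epsilon> / (8 * pi))))"
      by (rule surf_of_real_norm_le[OF elim(1)]) (use elim(2) in auto)
    also have "surf (\<lambda>\<omega>. of_real (\<epsilon> / (8 * pi))) = of_real (\<epsilon> / (8 * pi)) * of_real (4 * pi)"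
      unfolding surf_one[symmetric] surf_cmul[symmetric] by simp
    also have "Re \<dots> = \<epsilon> / 2" unfolding of_real_mult[symmetric] Re_complex_of_real by simp
    finally show ?case using \<epsilon> by simp
  qed
qed

definition radial_deriv :: "(3 \<Rightarrow> real^3 \<Rightarrow> complex) \<Rightarrow> real \<Rightarrow> real^3 \<Rightarrow> complex" where
  "radial_deriv D r \<omega> = (\<Sum>i\<in>UNIV. \<omega>$i *\<^sub>R D i (r *\<^sub>R \<omega>))"

lemma surf_radial_deriv:
  assumes g: "grad {x. norm x > \<rho>} f D" and cD: "\<And>i. continuous_on {x. norm x > \<rho>} (D i)"
    and cp: "continuous_on (sphere 0 1) p" and \<rho>: "\<rho> \<ge> 0" and r: "r > \<rho>"
  shows "((\<lambda>r. surf (\<lambda>\<omega>. f (r *\<^sub>R \<omega>) * p \<omega>)) has_vector_derivative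
    surf (\<lambda>\<omega>. radial_deriv D r \<omega> * p \<omega>)) (at r)"
proof -
  have "((\<lambda>r. surf (\<lambda>\<omega>. f (r *\<^sub>R \<omega>) * p \<omega>)) has_vector_derivative
    surf (\<lambda>\<omega>. radial_deriv D r \<omega> * p \<omega>)) (at r within {\<rho><..})"
  proof (rule has_vector_derivative_surf)
    fix t and \<omega> :: "real^3" assume t: "t \<in> {\<rho><..}" and w: "norm \<omega> = 1"
    have d: "((\<lambda>t. t *\<^sub>R \<omega>) has_vector_derivative \<omega>) (at t within {\<rho><..})"
      by (auto intro!: derivative_eq_intros)
    have "((\<lambda>t. f (t *\<^sub>R \<omega>)) has_vector_derivative radial_deriv D t \<omega>) (at t within {\<rho><..})"
      unfolding radial_deriv_def by (rule grad_chain[OF g _ d]) (use t w \<rho> in simp)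
    then show "((\<lambda>t. f (t *\<^sub>R \<omega>) * p \<omega>) has_vector_derivative
        radial_deriv D t \<omega> * p \<omega>) (at t within {\<rho><..})"
      by (rule has_vector_derivative_mult_left)
  next
    fix t assume t: "t \<in> {\<rho><..}"
    show "continuous_on (sphere 0 1) (\<lambda>\<omega>. f (t *\<^sub>R \<omega>) * p \<omega>)"
      by (intro continuous_intros cp continuous_on_compose2[OF grad_imp_continuous_on[OF g]]) (use t \<rho> in auto)
  next
    have "continuous_on ({\<rho><..} \<times> sphere 0 1) (\<lambda>q. D i (fst q *\<^sub>R snd q))" for i
      by (intro continuous_intros continuous_on_compose2[OF cD]) (use \<rho> in auto)
    moreover have "continuous_on ({\<rho><..} \<times> sphere 0 1) (\<lambda>q. p (snd q))"
      by (rule continuous_on_compose2[OF cp continuous_on_snd[OF continuous_on_id]]) auto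
    ultimately show "continuous_on ({\<rho><..} \<times> sphere 0 1) (\<lambda>(t, \<omega>). radial_deriv D t \<omega> * p \<omega>)"
      unfolding case_prod_beta radial_deriv_def by (intro continuous_intros)
  qed (use r in auto)
  then show ?thesis using r by (simp add: at_within_open[OF _ open_greaterThan])
qed

text \<open>A scalar field outside a ball that solves the Helmholtz equation and is outgoing. The Sommerfeld condition is
written after multiplication by \<open>norm x\<close>, which makes \<open>\<Sum>i. x$i *\<^sub>R D i x\<close> the derivative in the direction \<open>x\<close>.\<close>

locale radiating_field =
  fixes \<kappa> \<rho> :: real and e :: "real^3 \<Rightarrow> complex"
    and D :: "3 \<Rightarrow> real^3 \<Rightarrow> complex" and H :: "3 \<Rightarrow> 3 \<Rightarrow> real^3 \<Rightarrow> complex"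
  assumes \<kappa>: "\<kappa> > 0" and \<rho>: "\<rho> \<ge> 0"
    and C2: "C2 {x. norm x > \<rho>} e D H"
    and helmholtz: "\<And>x. norm x > \<rho> \<Longrightarrow> (\<Sum>i\<in>UNIV. H i i x) = - (of_real (\<kappa>\<^sup>2) * e x)"
    and decay: "(e \<longlongrightarrow> 0) at_infinity"
    and sommerfeld: "((\<lambda>x. (\<Sum>i\<in>UNIV. x$i *\<^sub>R D i x) - \<i> * of_real (\<kappa> * norm x) * e x) \<longlongrightarrow> 0) at_infinity"
begin

lemma cont: "continuous_on {x. norm x > \<rho>} e" "continuous_on {x. norm x > \<rho>} (D i)" "continuous_on {x. norm x > \<rho>} (H i j)"
  using C2D[OF C2] by auto

lemma cont_sphere:
  assumes "r > \<rho>"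
  shows "continuous_on (sphere 0 1) (\<lambda>\<omega>. e (r *\<^sub>R \<omega>))" "continuous_on (sphere 0 1) (\<lambda>\<omega>. D i (r *\<^sub>R \<omega>))"
    "continuous_on (sphere 0 1) (\<lambda>\<omega>. H i j (r *\<^sub>R \<omega>))"
  by (intro continuous_on_compose2[OF cont(1)] continuous_on_compose2[OF cont(2)] continuous_on_compose2[OF cont(3)] continuous_intros;
      use assms \<rho> in auto)+

lemma cont_radial:
  assumes "r > \<rho>"
  shows "continuous_on (sphere 0 1) (radial_deriv D r)"
  unfolding radial_deriv_def by (intro continuous_intros cont_sphere assms)

text \<open>The three moments belong to the field, its first and its second radial derivative. They are the successive
derivatives of \<open>moment \<eta> k\<close> in \<open>r\<close>.\<close>

definition moment :: "real^3 \<Rightarrow> nat \<Rightarrow> real \<Rightarrow> complex" where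
  "moment \<eta> k r = surf (\<lambda>\<omega>. e (r *\<^sub>R \<omega>) * of_real (\<omega> \<bullet> \<eta>) ^ k)"

definition moment' :: "real^3 \<Rightarrow> nat \<Rightarrow> real \<Rightarrow> complex" where
  "moment' \<eta> k r = surf (\<lambda>\<omega>. radial_deriv D r \<omega> * of_real (\<omega> \<bullet> \<eta>) ^ k)"

definition moment'' :: "real^3 \<Rightarrow> nat \<Rightarrow> real \<Rightarrow> complex" where
  "moment'' \<eta> k r = surf (\<lambda>\<omega>. (\<Sum>i\<in>UNIV. \<Sum>j\<in>UNIV. (\<omega>$i * \<omega>$j) *\<^sub>R H i j (r *\<^sub>R \<omega>)) * of_real (\<omega> \<bullet> \<eta>) ^ k)"

lemma moment_deriv:
  assumes "r > \<rho>"
  shows "(moment \<eta> k has_vector_derivative moment' \<eta> k r) (at r)"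
  unfolding moment_def[abs_def] moment'_def
  by (rule surf_radial_deriv[OF C2D(1)[OF C2] cont(2) _ \<rho> assms]) (intro continuous_intros)

lemma moment'_deriv:
  assumes r: "r > \<rho>"
  shows "(moment' \<eta> k has_vector_derivative moment'' \<eta> k r) (at r)"
proof -
  let ?w = "\<lambda>i \<omega>. complex_of_real (\<omega>$i) * of_real (\<omega> \<bullet> \<eta>) ^ k"
  have cw: "continuous_on (sphere 0 1) (?w i)" for i by (intro continuous_intros)
  have sum: "surf (\<lambda>\<omega>. \<Sum>i\<in>UNIV. g i \<omega> * ?w i \<omega>) = (\<Sum>i\<in>UNIV. surf (\<lambda>\<omega>. g i \<omega> * ?w i \<omega>))"
    if "\<And>i. continuous_on (sphere 0 1) (g i)" for g :: "3 \<Rightarrow> _"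
    by (rule surf_sum) (auto intro: continuous_on_mult that cw)
  have "((\<lambda>r. \<Sum>i\<in>UNIV. surf (\<lambda>\<omega>. D i (r *\<^sub>R \<omega>) * ?w i \<omega>)) has_vector_derivative
      (\<Sum>i\<in>UNIV. surf (\<lambda>\<omega>. radial_deriv (H i) r \<omega> * ?w i \<omega>))) (at r)"
    by (intro has_vector_derivative_sum surf_radial_deriv[OF C2D(2)[OF C2] cont(3) cw \<rho> r])
  also have "(\<Sum>i\<in>UNIV. surf (\<lambda>\<omega>. radial_deriv (H i) r \<omega> * ?w i \<omega>)) = moment'' \<eta> k r"
  proof -
    have "continuous_on (sphere 0 1) (radial_deriv (H i) r)" for i
      unfolding radial_deriv_def by (intro continuous_intros cont_sphere r)
    from sum[OF this] show ?thesis
      by (simp add: moment''_def radial_deriv_def scaleR_conv_of_real sum_distrib_left sum_distrib_right mult_ac)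
  qed
  finally show ?thesis
  proof (rule has_vector_derivative_transform_within_open[of _ _ _ "{\<rho><..}"])
    fix t assume "t \<in> {\<rho><..}"
    then have "t > \<rho>" by simp
    from sum[of "\<lambda>i \<omega>. D i (t *\<^sub>R \<omega>)", OF cont_sphere(2)[OF this]]
    show "(\<Sum>i\<in>UNIV. surf (\<lambda>\<omega>. D i (t *\<^sub>R \<omega>) * ?w i \<omega>)) = moment' \<eta> k t"
      by (simp add: moment'_def radial_deriv_def scaleR_conv_of_real sum_distrib_left sum_distrib_right mult_ac)
  qed (use r in auto)
qed

text \<open>The Helmholtz equation expresses the Laplace-Beltrami operator of \<open>e\<close> on the sphere of radius \<open>r\<close> by \<open>e\<close> and its radial
derivatives, and Green's identity moves that operator to the polynomial. It maps the power \<open>k\<close> of \<open>\<omega> \<bullet> \<eta>\<close> to a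
combination of the powers \<open>k\<close> and \<open>k - 2\<close>. For \<open>k < 2\<close> the truncated subtraction is harmless since the factor
in front of \<open>moment \<eta> (k - 2)\<close> is zero.\<close>

lemma moment_ode:
  assumes r: "r > \<rho>" and \<eta>: "norm \<eta> = 1"
  shows "r\<^sup>2 *\<^sub>R moment'' \<eta> k r + (2 * r) *\<^sub>R moment' \<eta> k r + (\<kappa>\<^sup>2 * r\<^sup>2 - real k * (real k + 1)) *\<^sub>R moment \<eta> k r
    = - (real k * (real k - 1)) *\<^sub>R moment \<eta> (k - 2) r"
proof -
  define P P' P'' where "P s = complex_of_real (s ^ k)" and "P' s = complex_of_real (real k * s ^ (k - 1))"
    and "P'' s = complex_of_real (real k * (real (k - 1) * s ^ (k - 2)))" for s
  have dP: "(P has_vector_derivative P' s) (at s)" for s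
    unfolding P_def P'_def by (rule has_vector_derivative_of_real) (auto intro!: derivative_eq_intros)
  have dP': "(P' has_vector_derivative P'' s) (at s)" for s
    unfolding P''_def P'_def
    by (rule has_vector_derivative_of_real, rule DERIV_cong[OF DERIV_cmult[OF DERIV_pow]])
       (simp add: numeral_2_eq_2)
  have cP'': "continuous_on UNIV P''" unfolding P''_def by (intro continuous_intros)
  note cs = cont_sphere[OF r] cont_radial[OF r]
  let ?f = "\<lambda>\<omega>. e (r *\<^sub>R \<omega>)"
  let ?p = "\<lambda>k \<omega>. complex_of_real (\<omega> \<bullet> \<eta>) ^ k"
  let ?rr = "\<lambda>\<omega>. \<Sum>i\<in>UNIV. \<Sum>j\<in>UNIV. (\<omega>$i * \<omega>$j) *\<^sub>R H i j (r *\<^sub>R \<omega>)"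
  have U: "sphere 0 1 \<subseteq> {x. r *\<^sub>R x \<in> {x. norm x > \<rho>}}" using r \<rho> by auto
  have "surf (\<lambda>\<omega>. ?f \<omega> * ((1 - (\<omega> \<bullet> \<eta>)\<^sup>2) *\<^sub>R P'' (\<omega> \<bullet> \<eta>) - (2 * (\<omega> \<bullet> \<eta>)) *\<^sub>R P' (\<omega> \<bullet> \<eta>)))
    = surf (\<lambda>\<omega>. P (\<omega> \<bullet> \<eta>) * spherical_laplacian (\<lambda>i x. r *\<^sub>R D i (r *\<^sub>R x)) (\<lambda>i j x. r\<^sup>2 *\<^sub>R H i j (r *\<^sub>R x)) \<omega>)"
    by (rule surf_green_ridge[OF dP dP' cP'' \<eta> U C2_scale[OF C2]])
  also have "\<dots> = surf (\<lambda>\<omega>. (- of_real (\<kappa>\<^sup>2 * r\<^sup>2)) * (?f \<omega> * ?p k \<omega>) - of_real (r\<^sup>2) * (?rr \<omega> * ?p k \<omega>)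
       - of_real (2 * r) * (radial_deriv D r \<omega> * ?p k \<omega>))"
  proof (rule surf_cong)
    fix \<omega> :: "real^3" assume w: "norm \<omega> = 1"
    have h: "(\<Sum>i\<in>UNIV. H i i (r *\<^sub>R \<omega>)) = - (of_real (\<kappa>\<^sup>2) * e (r *\<^sub>R \<omega>))"
      by (rule helmholtz) (use w r \<rho> in simp)
    have "spherical_laplacian (\<lambda>i x. r *\<^sub>R D i (r *\<^sub>R x)) (\<lambda>i j x. r\<^sup>2 *\<^sub>R H i j (r *\<^sub>R x)) \<omega>
       = of_real (r\<^sup>2) * (\<Sum>i\<in>UNIV. H i i (r *\<^sub>R \<omega>)) - of_real (r\<^sup>2) * ?rr \<omega> - of_real (2 * r) * radial_deriv D r \<omega>"
      unfolding spherical_laplacian_def radial_deriv_def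
      by (simp add: scaleR_conv_of_real sum_distrib_left mult_ac)
    also have "\<dots> = - of_real (\<kappa>\<^sup>2 * r\<^sup>2) * ?f \<omega> - of_real (r\<^sup>2) * ?rr \<omega> - of_real (2 * r) * radial_deriv D r \<omega>"
      unfolding h by (simp add: mult_ac)
    finally show "P (\<omega> \<bullet> \<eta>) * spherical_laplacian (\<lambda>i x. r *\<^sub>R D i (r *\<^sub>R x)) (\<lambda>i j x. r\<^sup>2 *\<^sub>R H i j (r *\<^sub>R x)) \<omega>
      = (- of_real (\<kappa>\<^sup>2 * r\<^sup>2)) * (?f \<omega> * ?p k \<omega>) - of_real (r\<^sup>2) * (?rr \<omega> * ?p k \<omega>)
       - of_real (2 * r) * (radial_deriv D r \<omega> * ?p k \<omega>)"
      by (simp only:) (simp add: P_def right_diff_distrib mult_ac)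
  qed
  also have "\<dots> = (- of_real (\<kappa>\<^sup>2 * r\<^sup>2)) * moment \<eta> k r - of_real (r\<^sup>2) * moment'' \<eta> k r - of_real (2 * r) * moment' \<eta> k r"
  proof -
    have c1: "continuous_on (sphere 0 1) (\<lambda>\<omega>. (- of_real (\<kappa>\<^sup>2 * r\<^sup>2)) * (?f \<omega> * ?p k \<omega>))"
      and c2: "continuous_on (sphere 0 1) (\<lambda>\<omega>. of_real (r\<^sup>2) * (?rr \<omega> * ?p k \<omega>))"
      and c3: "continuous_on (sphere 0 1) (\<lambda>\<omega>. of_real (2 * r) * (radial_deriv D r \<omega> * ?p k \<omega>))"
      by (intro continuous_intros cs)+
    show ?thesis
      unfolding moment_def moment'_def moment''_def surf_cmul[symmetric]
      by (subst surf_diff[OF continuous_on_diff[OF c1 c2] c3], subst surf_diff[OF c1 c2]) (rule refl)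
  qed
  also have "surf (\<lambda>\<omega>. ?f \<omega> * ((1 - (\<omega> \<bullet> \<eta>)\<^sup>2) *\<^sub>R P'' (\<omega> \<bullet> \<eta>) - (2 * (\<omega> \<bullet> \<eta>)) *\<^sub>R P' (\<omega> \<bullet> \<eta>)))
    = surf (\<lambda>\<omega>. of_real (real k * (real k - 1)) * (?f \<omega> * ?p (k - 2) \<omega>) - of_real (real k * (real k + 1)) * (?f \<omega> * ?p k \<omega>))"
  proof (rule surf_cong)
    fix \<omega> :: "real^3"
    define s where "s = \<omega> \<bullet> \<eta>"
    have "(1 - s\<^sup>2) * (real k * (real (k - 1) * s ^ (k - 2))) - (2 * s) * (real k * s ^ (k - 1))
      = real k * (real k - 1) * s ^ (k - 2) - real k * (real k + 1) * s ^ k"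
    proof (cases "k < 2")
      case True
      then have "k = 0 \<or> k = 1" by auto
      then show ?thesis by auto
    next
      case False
      then obtain m where "k = Suc (Suc m)" by (metis add_2_eq_Suc le_Suc_ex not_less)
      then show ?thesis by (simp add: algebra_simps power2_eq_square)
    qed
    from arg_cong[OF this, of complex_of_real]
    have "(1 - s\<^sup>2) *\<^sub>R P'' s - (2 * s) *\<^sub>R P' s
       = of_real (real k * (real k - 1)) * of_real s ^ (k - 2) - of_real (real k * (real k + 1)) * of_real s ^ k"
      unfolding P'_def P''_def scaleR_conv_of_real of_real_mult[symmetric] of_real_diff[symmetric] of_real_power[symmetric] .
    then show "?f \<omega> * ((1 - (\<omega> \<bullet> \<eta>)\<^sup>2) *\<^sub>R P'' (\<omega> \<bullet> \<eta>) - (2 * (\<omega> \<bullet> \<eta>)) *\<^sub>R P' (\<omega> \<bullet> \<eta>))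
      = of_real (real k * (real k - 1)) * (?f \<omega> * ?p (k - 2) \<omega>) - of_real (real k * (real k + 1)) * (?f \<omega> * ?p k \<omega>)"
      unfolding s_def[symmetric] by (simp only: right_diff_distrib mult_ac)
  qed
  also have "\<dots> = of_real (real k * (real k - 1)) * moment \<eta> (k - 2) r - of_real (real k * (real k + 1)) * moment \<eta> k r"
    unfolding moment_def surf_cmul[symmetric] by (intro surf_diff continuous_intros cs)
  finally have "of_real (real k * (real k - 1)) * moment \<eta> (k - 2) r - of_real (real k * (real k + 1)) * moment \<eta> k r
    = (- of_real (\<kappa>\<^sup>2 * r\<^sup>2)) * moment \<eta> k r - of_real (r\<^sup>2) * moment'' \<eta> k r - of_real (2 * r) * moment' \<eta> k r" .
  then show ?thesis
    unfolding scaleR_conv_of_real of_real_minus of_real_diff by (simp only: left_diff_distrib) algebra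
qed

lemma moment_decay:
  assumes \<eta>: "norm \<eta> = 1"
  shows "(moment \<eta> k \<longlongrightarrow> 0) at_top"
    and "((\<lambda>r. r *\<^sub>R (moment' \<eta> k r - \<i> * of_real \<kappa> * moment \<eta> k r)) \<longlongrightarrow> 0) at_top"
proof -
  have p1: "norm (complex_of_real (\<omega> \<bullet> \<eta>) ^ k) \<le> 1" if "norm \<omega> = 1" for \<omega>
    unfolding norm_power norm_of_real
    using Cauchy_Schwarz_ineq2[of \<omega> \<eta>] that \<eta> by (intro power_le_one) auto
  have unif: "\<forall>\<^sub>F r in at_top. \<forall>\<omega>. norm \<omega> = 1 \<longrightarrow> norm (f (r *\<^sub>R \<omega>) * of_real (\<omega> \<bullet> \<eta>) ^ k) \<le> \<epsilon>"
    if f: "(f \<longlongrightarrow> 0) at_infinity" and \<epsilon>: "\<epsilon> > 0" for f :: "real^3 \<Rightarrow> complex" and \<epsilon>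
  proof -
    obtain b where b: "\<And>x. norm x \<ge> b \<Longrightarrow> norm (f x) < \<epsilon>"
      using tendstoD[OF f \<epsilon>] by (auto simp: eventually_at_infinity)
    show ?thesis
    proof (rule eventually_mono[OF eventually_ge_at_top[of "max b 0"]], intro allI impI)
      fix r and \<omega> :: "real^3" assume r: "r \<ge> max b 0" and w: "norm \<omega> = 1"
      have "norm (f (r *\<^sub>R \<omega>)) < \<epsilon>" by (rule b) (use r w in simp)
      then have "norm (f (r *\<^sub>R \<omega>)) * norm (complex_of_real (\<omega> \<bullet> \<eta>) ^ k) \<le> \<epsilon> * 1"
        using \<epsilon> p1[OF w] by (intro mult_mono) auto
      then show "norm (f (r *\<^sub>R \<omega>) * of_real (\<omega> \<bullet> \<eta>) ^ k) \<le> \<epsilon>" by (simp add: norm_mult)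
    qed
  qed
  show "(moment \<eta> k \<longlongrightarrow> 0) at_top"
    unfolding moment_def[abs_def]
    by (intro tendsto_surf_zero unif decay eventually_mono[OF eventually_gt_at_top[of \<rho>]] continuous_intros cont_sphere)
  define g where "g x = (\<Sum>i\<in>UNIV. x$i *\<^sub>R D i x) - \<i> * of_real (\<kappa> * norm x) * e x" for x
  have cg: "continuous_on (sphere 0 1) (\<lambda>\<omega>. g (r *\<^sub>R \<omega>))" if "r > \<rho>" for r
    unfolding g_def using that by (intro continuous_intros cont_sphere)
  have "((\<lambda>r. surf (\<lambda>\<omega>. g (r *\<^sub>R \<omega>) * of_real (\<omega> \<bullet> \<eta>) ^ k)) \<longlongrightarrow> 0) at_top"
    by (intro tendsto_surf_zero unif sommerfeld[folded g_def] eventually_mono[OF eventually_gt_at_top[of \<rho>]] continuous_intros cg)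
  moreover have "\<forall>\<^sub>F r in at_top. surf (\<lambda>\<omega>. g (r *\<^sub>R \<omega>) * of_real (\<omega> \<bullet> \<eta>) ^ k) = r *\<^sub>R (moment' \<eta> k r - \<i> * of_real \<kappa> * moment \<eta> k r)"
  proof (rule eventually_mono[OF eventually_gt_at_top[of \<rho>]])
    fix r assume r: "r > \<rho>"
    have "surf (\<lambda>\<omega>. g (r *\<^sub>R \<omega>) * of_real (\<omega> \<bullet> \<eta>) ^ k) = surf (\<lambda>\<omega>. of_real r * (radial_deriv D r \<omega> * of_real (\<omega> \<bullet> \<eta>) ^ k
        - \<i> * of_real \<kappa> * (e (r *\<^sub>R \<omega>) * of_real (\<omega> \<bullet> \<eta>) ^ k)))"
    proof (rule surf_cong)
      fix \<omega> :: "real^3" assume w: "norm \<omega> = 1"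
      have "g (r *\<^sub>R \<omega>) = of_real r * (radial_deriv D r \<omega> - \<i> * of_real \<kappa> * e (r *\<^sub>R \<omega>))"
      proof -
        have "(r * u) *\<^sub>R z = u *\<^sub>R (of_real r * z)" for u and z :: complex
          by (simp add: scaleR_conv_of_real)
        then show ?thesis
          using r \<rho> w by (simp add: g_def radial_deriv_def sum_distrib_left right_diff_distrib)
      qed
      then show "g (r *\<^sub>R \<omega>) * of_real (\<omega> \<bullet> \<eta>) ^ k = of_real r * (radial_deriv D r \<omega> * of_real (\<omega> \<bullet> \<eta>) ^ k
        - \<i> * of_real \<kappa> * (e (r *\<^sub>R \<omega>) * of_real (\<omega> \<bullet> \<eta>) ^ k))"
        by (simp only:) (simp add: algebra_simps)
    qed
    also have "\<dots> = of_real r * (moment' \<eta> k r - \<i> * of_real \<kappa> * moment \<eta> k r)"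
      unfolding surf_cmul moment_def moment'_def
      by (subst surf_diff) (intro continuous_intros cont_radial cont_sphere r | simp add: surf_cmul)+
    finally show "surf (\<lambda>\<omega>. g (r *\<^sub>R \<omega>) * of_real (\<omega> \<bullet> \<eta>) ^ k) = r *\<^sub>R (moment' \<eta> k r - \<i> * of_real \<kappa> * moment \<eta> k r)"
      by (simp add: scaleR_conv_of_real)
  qed
  ultimately show "((\<lambda>r. r *\<^sub>R (moment' \<eta> k r - \<i> * of_real \<kappa> * moment \<eta> k r)) \<longlongrightarrow> 0) at_top"
    by (simp add: tendsto_cong)
qed

text \<open>The hypothesis on \<open>\<xi>\<close> is multiplied by \<open>(\<xi> \<bullet> \<eta>)\<^sup>k\<close> and integrated over the unit sphere. After exchanging the integrals
the plane wave and its radial derivative become \<open>\<Sum>m\<le>k. (\<omega> \<bullet> \<eta>)\<^sup>m g\<^sub>m(R)\<close> and \<open>\<Sum>m\<le>k. (\<omega> \<bullet> \<eta>)\<^sup>m g\<^sub>m'(R)\<close>, and the integral over \<open>\<omega>\<close> is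
minus the sum of \<open>g\<^sub>m' A\<^sub>m + g\<^sub>m A\<^sub>m'\<close> at \<open>R\<close>. Only \<open>m = k\<close> survives, and \<open>g\<^sub>k\<close> is a constant times a real function
that does not vanish at \<open>R\<close> together with its derivative.\<close>

lemma boundary_relation:
  assumes R: "R > \<rho>" and \<eta>: "norm \<eta> = 1"
    and V: "\<And>\<xi>. norm \<xi> = 1 \<Longrightarrow> surf (\<lambda>\<omega>. exp (- \<i> * of_real (\<xi> \<bullet> (R *\<^sub>R \<kappa> *\<^sub>R \<omega>))) *
      (\<i> * of_real (\<kappa> * (\<xi> \<bullet> \<omega>)) * e (R *\<^sub>R \<omega>) - radial_deriv D R \<omega>)) = 0"
    and low: "\<And>m. m < k \<Longrightarrow> moment \<eta> m R = 0 \<and> moment' \<eta> m R = 0"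
  shows "\<exists>c c'. (c \<noteq> 0 \<or> c' \<noteq> 0) \<and> c *\<^sub>R moment' \<eta> k R + c' *\<^sub>R moment \<eta> k R = 0"
proof -
  have R0: "R > 0" using R \<rho> by simp
  obtain q where q: "\<And>m. bessel_span (q m)" "q k = (\<lambda>s. 4 * pi * (2 * \<i>) ^ k * of_real (bessel_chain k s))"
    "\<And>x. x \<noteq> 0 \<Longrightarrow> plane_wave_moment \<eta> k x = (\<Sum>m\<le>k. of_real (x \<bullet> \<eta>) ^ m * q m ((norm x)\<^sup>2))"
    using plane_wave_moment_expansion[OF \<eta>, of k] by blast
  obtain q' where q': "\<And>m s. s > 0 \<Longrightarrow> (q m has_vector_derivative q' m s) (at s)"
    using bessel_span_deriv[OF q(1)] by metis
  define g where "g m r = of_real ((\<kappa> * r) ^ m) * q m ((\<kappa> * r)\<^sup>2)" for m r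
  define C where "C = 4 * pi * (2 * \<i>) ^ k"
  \<comment> \<open>The value and the derivative at \<open>R\<close> of the real factor of \<open>g k\<close>, the spherical Bessel function of order \<open>k\<close> up to
a constant.\<close>
  define c c' where "c = (\<kappa> * R) ^ k * bessel_chain k ((\<kappa> * R)\<^sup>2)"
    and "c' = real k * (\<kappa> * R) ^ (k - 1) * \<kappa> * bessel_chain k ((\<kappa> * R)\<^sup>2)
      + (\<kappa> * R) ^ k * (bessel_chain (Suc k) ((\<kappa> * R)\<^sup>2) * (2 * (\<kappa> * R) * \<kappa>))"
  have sp: "(\<kappa> * R)\<^sup>2 > 0" using \<kappa> R0 by simp
  have dsq: "((\<lambda>r. (\<kappa> * r)\<^sup>2) has_real_derivative 2 * (\<kappa> * R) * \<kappa>) (at R)"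
    by (auto intro!: derivative_eq_intros)
  have dpow: "((\<lambda>r. (\<kappa> * r) ^ m) has_real_derivative real m * (\<kappa> * R) ^ (m - 1) * \<kappa>) (at R)" for m
    by (auto intro!: derivative_eq_intros)
  have "\<exists>d. (g m has_vector_derivative d) (at R)" for m
    unfolding g_def[abs_def]
    using has_vector_derivative_mult[OF has_vector_derivative_of_real[OF dpow[of m]]
        vector_diff_chain_at[OF dsq[unfolded has_real_derivative_iff_has_vector_derivative] q'[OF sp, of m], unfolded o_def]]
    by blast
  then obtain g0 where g0: "\<And>m. (g m has_vector_derivative g0 m) (at R)" by metis
  have gk: "g k = (\<lambda>r. C * of_real ((\<kappa> * r) ^ k * bessel_chain k ((\<kappa> * r)\<^sup>2)))"
    by (simp add: g_def fun_eq_iff q(2) C_def mult_ac del: bessel_chain.simps)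
  have gkd: "(g k has_vector_derivative C * of_real c') (at R)"
    unfolding gk
  proof (intro has_vector_derivative_mult_right has_vector_derivative_of_real)
    show "((\<lambda>r. (\<kappa> * r) ^ k * bessel_chain k ((\<kappa> * r)\<^sup>2)) has_real_derivative c') (at R)"
      by (rule DERIV_cong[OF DERIV_mult[OF dpow DERIV_chain2[OF bessel_chain_deriv[OF sp] dsq]]])
         (simp add: c'_def mult_ac del: bessel_chain.simps)
  qed
  define g' where "g' m = (if m = k then C * of_real c' else g0 m)" for m
  have g': "(g m has_vector_derivative g' m) (at R)" for m
    using g0[of m] gkd by (auto simp: g'_def)
  define E where "E \<xi> \<omega> = of_real (\<xi> \<bullet> \<eta>) ^ k * exp (- \<i> * of_real (\<xi> \<bullet> (R *\<^sub>R \<kappa> *\<^sub>R \<omega>)))" for \<xi> \<omega>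
  have pw: "plane_wave_moment \<eta> k (r *\<^sub>R \<kappa> *\<^sub>R \<omega>) = (\<Sum>m\<le>k. of_real (\<omega> \<bullet> \<eta>) ^ m * g m r)"
    if "norm \<omega> = 1" "r > 0" for \<omega> r
  proof -
    have "r *\<^sub>R \<kappa> *\<^sub>R \<omega> \<noteq> 0" using that \<kappa> by auto
    moreover have "norm (r *\<^sub>R \<kappa> *\<^sub>R \<omega>) = \<kappa> * r" using that \<kappa> by simp
    ultimately show ?thesis
      using q(3)[of "r *\<^sub>R \<kappa> *\<^sub>R \<omega>"] by (simp add: g_def power_mult_distrib mult_ac)
  qed
  have Y: "surf (\<lambda>\<xi>. E \<xi> \<omega>) = (\<Sum>m\<le>k. of_real (\<omega> \<bullet> \<eta>) ^ m * g m R)" if "norm \<omega> = 1" for \<omega>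
    using pw[OF that R0] by (simp add: plane_wave_moment_def E_def)
  have X: "surf (\<lambda>\<xi>. - \<i> * of_real (\<xi> \<bullet> (\<kappa> *\<^sub>R \<omega>)) * E \<xi> \<omega>) = (\<Sum>m\<le>k. of_real (\<omega> \<bullet> \<eta>) ^ m * g' m)" if w: "norm \<omega> = 1" for \<omega>
  proof (rule vector_derivative_unique_at)
    show "((\<lambda>r. plane_wave_moment \<eta> k (r *\<^sub>R \<kappa> *\<^sub>R \<omega>)) has_vector_derivative surf (\<lambda>\<xi>. - \<i> * of_real (\<xi> \<bullet> (\<kappa> *\<^sub>R \<omega>)) * E \<xi> \<omega>)) (at R)"
      using plane_wave_moment_deriv[of \<eta> k 0 "\<kappa> *\<^sub>R \<omega>" R UNIV] unfolding E_def add_0 .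
    have "((\<lambda>r. \<Sum>m\<le>k. of_real (\<omega> \<bullet> \<eta>) ^ m * g m r) has_vector_derivative (\<Sum>m\<le>k. of_real (\<omega> \<bullet> \<eta>) ^ m * g' m)) (at R)"
      by (intro has_vector_derivative_sum has_vector_derivative_mult_right g')
    then show "((\<lambda>r. plane_wave_moment \<eta> k (r *\<^sub>R \<kappa> *\<^sub>R \<omega>)) has_vector_derivative (\<Sum>m\<le>k. of_real (\<omega> \<bullet> \<eta>) ^ m * g' m)) (at R)"
      by (rule has_vector_derivative_transform_within_open[of _ _ _ "{0<..}"]) (use R0 pw[OF w] in auto)
  qed
  let ?F = "\<lambda>\<xi> \<omega>. exp (- \<i> * of_real (\<xi> \<bullet> (R *\<^sub>R \<kappa> *\<^sub>R \<omega>))) * (\<i> * of_real (\<kappa> * (\<xi> \<bullet> \<omega>)) * e (R *\<^sub>R \<omega>) - radial_deriv D R \<omega>)"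
  have cE: "continuous_on A (\<lambda>\<xi>. E \<xi> \<omega>)" for A \<omega> unfolding E_def by (intro continuous_intros)
  have "0 = surf (\<lambda>\<xi>. of_real (\<xi> \<bullet> \<eta>) ^ k * surf (\<lambda>\<omega>. ?F \<xi> \<omega>))"
  proof -
    have "surf (\<lambda>\<xi>. of_real (\<xi> \<bullet> \<eta>) ^ k * surf (\<lambda>\<omega>. ?F \<xi> \<omega>)) = surf (\<lambda>\<xi>. 0)"
      by (rule surf_cong) (simp only: V mult_zero_right)
    then show ?thesis by simp
  qed
  also have "\<dots> = surf (\<lambda>\<xi>. surf (\<lambda>\<omega>. of_real (\<xi> \<bullet> \<eta>) ^ k * ?F \<xi> \<omega>))"
    unfolding surf_cmul ..
  also have "\<dots> = surf (\<lambda>\<omega>. surf (\<lambda>\<xi>. of_real (\<xi> \<bullet> \<eta>) ^ k * ?F \<xi> \<omega>))"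
  proof (rule surf_swap)
    have 1: "continuous_on (sphere 0 1 \<times> sphere 0 1) (\<lambda>p. e (R *\<^sub>R snd p))"
      by (rule continuous_on_compose2[OF cont_sphere(1)[OF R] continuous_on_snd[OF continuous_on_id]]) auto
    have 2: "continuous_on (sphere 0 1 \<times> sphere 0 1) (\<lambda>p. radial_deriv D R (snd p))"
      by (rule continuous_on_compose2[OF cont_radial[OF R] continuous_on_snd[OF continuous_on_id]]) auto
    show "continuous_on (sphere 0 1 \<times> sphere 0 1) (\<lambda>(\<xi>, \<omega>). of_real (\<xi> \<bullet> \<eta>) ^ k * ?F \<xi> \<omega>)"
      unfolding case_prod_beta by (intro continuous_intros 1 2)
  qed
  also have "\<dots> = surf (\<lambda>\<omega>. \<Sum>m\<le>k. (- g' m) * (e (R *\<^sub>R \<omega>) * of_real (\<omega> \<bullet> \<eta>) ^ m) + (- g m R) * (radial_deriv D R \<omega> * of_real (\<omega> \<bullet> \<eta>) ^ m))"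
  proof (rule surf_cong)
    fix \<omega> :: "real^3" assume w: "norm \<omega> = 1"
    have "surf (\<lambda>\<xi>. of_real (\<xi> \<bullet> \<eta>) ^ k * ?F \<xi> \<omega>)
      = surf (\<lambda>\<xi>. (- e (R *\<^sub>R \<omega>)) * (- \<i> * of_real (\<xi> \<bullet> (\<kappa> *\<^sub>R \<omega>)) * E \<xi> \<omega>) + (- radial_deriv D R \<omega>) * E \<xi> \<omega>)"
      by (rule surf_cong) (simp add: E_def algebra_simps)
    also have "\<dots> = (- e (R *\<^sub>R \<omega>)) * surf (\<lambda>\<xi>. - \<i> * of_real (\<xi> \<bullet> (\<kappa> *\<^sub>R \<omega>)) * E \<xi> \<omega>) + (- radial_deriv D R \<omega>) * surf (\<lambda>\<xi>. E \<xi> \<omega>)"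
      unfolding surf_cmul[symmetric] by (rule surf_add) (intro continuous_intros cE)+
    also have "\<dots> = (\<Sum>m\<le>k. (- g' m) * (e (R *\<^sub>R \<omega>) * of_real (\<omega> \<bullet> \<eta>) ^ m) + (- g m R) * (radial_deriv D R \<omega> * of_real (\<omega> \<bullet> \<eta>) ^ m))"
      unfolding X[OF w] Y[OF w] sum_distrib_left sum.distrib[symmetric] by (rule sum.cong) (simp_all add: algebra_simps)
    finally show "surf (\<lambda>\<xi>. of_real (\<xi> \<bullet> \<eta>) ^ k * ?F \<xi> \<omega>) = \<dots>" .
  qed
  also have "\<dots> = (\<Sum>m\<le>k. surf (\<lambda>\<omega>. (- g' m) * (e (R *\<^sub>R \<omega>) * of_real (\<omega> \<bullet> \<eta>) ^ m) + (- g m R) * (radial_deriv D R \<omega> * of_real (\<omega> \<bullet> \<eta>) ^ m)))"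
    by (rule surf_sum) (auto intro!: continuous_intros cont_sphere cont_radial R)
  also have "\<dots> = (\<Sum>m\<le>k. (- g' m) * moment \<eta> m R + (- g m R) * moment' \<eta> m R)"
    unfolding moment_def moment'_def surf_cmul[symmetric]
    by (rule sum.cong[OF refl], rule surf_add) (intro continuous_intros cont_sphere cont_radial R)+
  also have "\<dots> = (- g' k) * moment \<eta> k R + (- g k R) * moment' \<eta> k R"
    using low by (simp add: lessThan_Suc_atMost[symmetric] lessThan_Suc)
  finally have "C * (of_real c * moment' \<eta> k R + of_real c' * moment \<eta> k R) = 0"
    unfolding gk by (simp add: g'_def c_def algebra_simps del: bessel_chain.simps)
  moreover have "C \<noteq> 0" by (simp add: C_def)
  ultimately have "c *\<^sub>R moment' \<eta> k R + c' *\<^sub>R moment \<eta> k R = 0"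
    by (simp add: scaleR_conv_of_real)
  moreover have "c \<noteq> 0 \<or> c' \<noteq> 0"
  proof (rule disjCI)
    assume "\<not> c' \<noteq> 0"
    then show "c \<noteq> 0"
      using bessel_chain_not_both_zero[OF sp, of k] \<kappa> R0
      by (auto simp: c_def c'_def simp del: bessel_chain.simps)
  qed
  ultimately show ?thesis by blast
qed

text \<open>Once the moments below \<open>k\<close> vanish from \<open>R\<close> on, so do their derivatives at \<open>R\<close>, and \<open>moment \<eta> k\<close> satisfies the
homogeneous radial equation with a real boundary relation at \<open>R\<close>.\<close>

lemma moment_zero:
  assumes R: "R > \<rho>" and \<eta>: "norm \<eta> = 1"
    and V: "\<And>\<xi>. norm \<xi> = 1 \<Longrightarrow> surf (\<lambda>\<omega>. exp (- \<i> * of_real (\<xi> \<bullet> (R *\<^sub>R \<kappa> *\<^sub>R \<omega>))) *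
      (\<i> * of_real (\<kappa> * (\<xi> \<bullet> \<omega>)) * e (R *\<^sub>R \<omega>) - radial_deriv D R \<omega>)) = 0"
  shows "r \<ge> R \<Longrightarrow> moment \<eta> k r = 0"
proof (induction k arbitrary: r rule: less_induct)
  case (less k)
  have zero': "moment' \<eta> m R = 0" if m: "m < k" for m
  proof -
    have "(moment \<eta> m has_vector_derivative moment' \<eta> m R) (at R within {R..})"
      by (rule has_vector_derivative_at_within[OF moment_deriv[OF R]])
    then have "((\<lambda>_. 0) has_vector_derivative moment' \<eta> m R) (at R within {R..})"
      by (rule has_vector_derivative_transform[rotated 2]) (use less.IH[OF m] in auto)
    moreover have "((\<lambda>_. 0) has_vector_derivative 0) (at R within {R..})" by simp
    ultimately show ?thesis
      by (rule vector_derivative_unique_within[rotated]) (simp add: at_within_Ici_at_right)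
  qed
  obtain c c' where c: "c \<noteq> 0 \<or> c' \<noteq> 0" "c *\<^sub>R moment' \<eta> k R + c' *\<^sub>R moment \<eta> k R = 0"
    using boundary_relation[OF R \<eta> V, of k] zero' less.IH by blast
  show ?case
  proof (rule outgoing_ode_zero[OF _ \<kappa> _ _ _ _ moment_decay[OF \<eta>] c(2,1) less.prems])
    fix r assume r: "r \<ge> R"
    then have r': "r > \<rho>" using R by simp
    show "(moment \<eta> k has_vector_derivative moment' \<eta> k r) (at r)" by (rule moment_deriv[OF r'])
    show "(moment' \<eta> k has_vector_derivative moment'' \<eta> k r) (at r)" by (rule moment'_deriv[OF r'])
    have "- (real k * (real k - 1)) *\<^sub>R moment \<eta> (k - 2) r = 0"
    proof (cases "k < 2")
      case True
      then have "k = 0 \<or> k = 1" by auto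
      then show ?thesis by auto
    next
      case False
      then show ?thesis using less.IH[of "k - 2" r] r by simp
    qed
    then show "r\<^sup>2 *\<^sub>R moment'' \<eta> k r + (2 * r) *\<^sub>R moment' \<eta> k r + (\<kappa>\<^sup>2 * r\<^sup>2 - real k * (real k + 1)) *\<^sub>R moment \<eta> k r = 0"
      using moment_ode[OF r' \<eta>] by simp
  qed (use R \<rho> in auto)
qed

text \<open>The hypothesis is that \<open>V_field\<close> vanishes at the wave vectors \<open>\<kappa> *\<^sub>R \<xi>\<close>, without the factor \<open>R\<^sup>2\<close> of the surface
element. The moments vanish then, and they determine the field.\<close>

theorem zero_outside:
  assumes R: "R > \<rho>"
    and V: "\<And>\<xi>. norm \<xi> = 1 \<Longrightarrow> surf (\<lambda>\<omega>. exp (- \<i> * of_real (\<xi> \<bullet> (R *\<^sub>R \<kappa> *\<^sub>R \<omega>))) *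
      (\<i> * of_real (\<kappa> * (\<xi> \<bullet> \<omega>)) * e (R *\<^sub>R \<omega>) - radial_deriv D R \<omega>)) = 0"
    and x: "norm x \<ge> R"
  shows "e x = 0"
proof -
  define \<eta> where "\<eta> = x /\<^sub>R norm x"
  have x0: "norm x > 0" using x R \<rho> by linarith
  then have \<eta>: "norm \<eta> = 1" and x\<eta>: "norm x *\<^sub>R \<eta> = x" by (auto simp: \<eta>_def)
  have "e (norm x *\<^sub>R \<eta>) = 0"
    using moment_zero[OF R \<eta> V x]
    by (intro zero_of_surf_moments_zero[of "\<lambda>\<omega>. e (norm x *\<^sub>R \<omega>)"] cont_sphere \<eta>) (use x R in \<open>auto simp: moment_def\<close>)
  then show ?thesis by (simp only: x\<eta>)
qed

end

section \<open>Partial derivatives in three dimensions\<close>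

text \<open>The mixed second difference \<open>\<Delta> i j h\<close> is symmetric in \<open>i\<close> and \<open>j\<close>, and by the mean value theorem, used twice, it is
\<open>h\<^sup>2\<close> times a value of either mixed derivative near \<open>x\<close>. The mean value theorem needs real values, so it is
applied to the real and the imaginary part.\<close>

lemma second_partials_symmetric:
  assumes U: "open U" "x \<in> U" and f: "grad U f D" and D: "\<And>i. grad U (D i) (H i)"
    and cH: "\<And>i j. continuous_on U (H i j)"
  shows "H i j x = H j i x"
proof -
  obtain r where r: "r > 0" "ball x r \<subseteq> U" using U by (meson open_contains_ball)
  let ?e = "\<lambda>i. axis i 1 :: real^3"
  define \<Delta> where "\<Delta> i j h = f (x + h *\<^sub>R ?e i + h *\<^sub>R ?e j) - f (x + h *\<^sub>R ?e i) - f (x + h *\<^sub>R ?e j) + f x" for i j h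
  have axis_sum: "(\<Sum>l\<in>UNIV. (?e i)$l *\<^sub>R E l) = E i" for i and E :: "3 \<Rightarrow> complex"
    using exhaust_3[of i] by (auto simp: sum_3 axis_def)
  have inU: "x + s *\<^sub>R ?e i + t *\<^sub>R ?e j \<in> U" if "\<bar>s\<bar> + \<bar>t\<bar> < r" for s t i j
  proof -
    have "norm (s *\<^sub>R ?e i + t *\<^sub>R ?e j) \<le> norm (s *\<^sub>R ?e i) + norm (t *\<^sub>R ?e j)"
      by (rule norm_triangle_ineq)
    with that have "norm (s *\<^sub>R ?e i + t *\<^sub>R ?e j) < r" by simp
    then have "x + (s *\<^sub>R ?e i + t *\<^sub>R ?e j) \<in> ball x r"
      unfolding mem_ball dist_norm by (subst norm_minus_commute) simp
    with r show ?thesis by (auto simp: add.assoc)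
  qed
  have path: "((\<lambda>s. g (y + s *\<^sub>R ?e i)) has_vector_derivative E i (y + s *\<^sub>R ?e i)) (at s)"
    if "grad U g E" "y + s *\<^sub>R ?e i \<in> U" for g E y s i
  proof -
    have "((\<lambda>s. y + s *\<^sub>R ?e i) has_vector_derivative ?e i) (at s)"
      by (auto intro!: derivative_eq_intros)
    from grad_chain[OF that this] show ?thesis unfolding axis_sum .
  qed
  \<comment> \<open>\<open>L\<close> stands for the real or the imaginary part.\<close>
  have mvt: "\<exists>p. norm (p - x) \<le> 2 * h \<and> L (\<Delta> i j h) = h * h * L (H i j p)"
    if h: "0 < h" "2 * h < r" and L: "bounded_linear L" for L :: "complex \<Rightarrow> real" and h i j
  proof -
    interpret L: bounded_linear L by (rule L)
    have d1: "((\<lambda>s. L (f (x + h *\<^sub>R ?e j + s *\<^sub>R ?e i) - f (x + s *\<^sub>R ?e i))) has_real_derivative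
        L (D i (x + h *\<^sub>R ?e j + s *\<^sub>R ?e i) - D i (x + s *\<^sub>R ?e i))) (at s)" if "0 \<le> s" "s \<le> h" for s
      unfolding has_real_derivative_iff_has_vector_derivative
      by (intro L.has_vector_derivative has_vector_derivative_diff path[OF f])
         (use inU[of h s j i] inU[of s 0 i i] that h in auto)
    obtain \<sigma> where \<sigma>: "0 < \<sigma>" "\<sigma> < h"
      "L (f (x + h *\<^sub>R ?e j + h *\<^sub>R ?e i) - f (x + h *\<^sub>R ?e i)) - L (f (x + h *\<^sub>R ?e j + 0 *\<^sub>R ?e i) - f (x + 0 *\<^sub>R ?e i))
        = (h - 0) * L (D i (x + h *\<^sub>R ?e j + \<sigma> *\<^sub>R ?e i) - D i (x + \<sigma> *\<^sub>R ?e i))"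
      using MVT2[OF h(1) d1] by blast
    have d2: "((\<lambda>t. L (D i (x + \<sigma> *\<^sub>R ?e i + t *\<^sub>R ?e j))) has_real_derivative
        L (H i j (x + \<sigma> *\<^sub>R ?e i + t *\<^sub>R ?e j))) (at t)" if "0 \<le> t" "t \<le> h" for t
      unfolding has_real_derivative_iff_has_vector_derivative
      by (intro L.has_vector_derivative path[OF D]) (use inU[of \<sigma> t i j] that h \<sigma> in auto)
    obtain \<tau> where \<tau>: "0 < \<tau>" "\<tau> < h"
      "L (D i (x + \<sigma> *\<^sub>R ?e i + h *\<^sub>R ?e j)) - L (D i (x + \<sigma> *\<^sub>R ?e i + 0 *\<^sub>R ?e j))
        = (h - 0) * L (H i j (x + \<sigma> *\<^sub>R ?e i + \<tau> *\<^sub>R ?e j))"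
      using MVT2[OF h(1) d2] by blast
    let ?p = "x + \<sigma> *\<^sub>R ?e i + \<tau> *\<^sub>R ?e j"
    have "norm (?p - x) \<le> norm (\<sigma> *\<^sub>R ?e i) + norm (\<tau> *\<^sub>R ?e j)"
      using norm_triangle_ineq[of "\<sigma> *\<^sub>R ?e i" "\<tau> *\<^sub>R ?e j"] by (simp add: algebra_simps)
    then have "norm (?p - x) \<le> 2 * h" using \<sigma> \<tau> by simp
    moreover have "L (\<Delta> i j h) = h * h * L (H i j ?p)"
    proof -
      have "L (\<Delta> i j h) = h * L (D i (x + h *\<^sub>R ?e j + \<sigma> *\<^sub>R ?e i) - D i (x + \<sigma> *\<^sub>R ?e i))"
        using \<sigma>(3) by (simp add: \<Delta>_def L.diff L.add algebra_simps)
      also have "\<dots> = h * (h * L (H i j ?p))"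
        using \<tau>(3) by (simp add: L.diff add.commute add.left_commute)
      finally show ?thesis by simp
    qed
    ultimately show ?thesis by blast
  qed
  have eqL: "L (H i j x) = L (H j i x)" if L: "bounded_linear L" for L :: "complex \<Rightarrow> real"
  proof -
    define h where "h n = r / 3 * inverse (real (Suc n))" for n :: nat
    have h: "0 < h n" "2 * h n < r" for n
      using r(1) by (auto simp: h_def field_simps add_pos_nonneg)
    obtain p where p: "\<And>n. norm (p n - x) \<le> 2 * h n" "\<And>n. L (\<Delta> i j (h n)) = h n * h n * L (H i j (p n))"
      using mvt[OF h L, of _ i j] by metis
    obtain p' where p': "\<And>n. norm (p' n - x) \<le> 2 * h n" "\<And>n. L (\<Delta> j i (h n)) = h n * h n * L (H j i (p' n))"
      using mvt[OF h L, of _ j i] by metis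
    have eq: "L (H i j (p n)) = L (H j i (p' n))" for n
    proof -
      have "\<Delta> i j (h n) = \<Delta> j i (h n)" by (simp add: \<Delta>_def algebra_simps)
      then have "h n * h n * L (H i j (p n)) = h n * h n * L (H j i (p' n))"
        using p(2)[of n] p'(2)[of n] by metis
      then show ?thesis using h(1)[of n] by simp
    qed
    have "h \<longlonglongrightarrow> 0" unfolding h_def
      by (rule tendsto_mult_right_zero[OF LIMSEQ_inverse_real_of_nat])
    then have h0: "(\<lambda>n. 2 * h n) \<longlonglongrightarrow> 0" using tendsto_mult_right_zero by blast
    have lim: "(\<lambda>n. L (H i j (q n))) \<longlonglongrightarrow> L (H i j x)" if q: "\<And>n. norm (q n - x) \<le> 2 * h n" for q i j
    proof -
      have "(\<lambda>n. q n - x) \<longlonglongrightarrow> 0"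
        by (rule Lim_null_comparison[OF _ h0]) (use q in simp)
      then have "q \<longlonglongrightarrow> x" by (rule LIM_zero_cancel)
      moreover have "isCont (H i j) x" using cH U continuous_on_eq_continuous_at by blast
      ultimately have "(\<lambda>n. H i j (q n)) \<longlonglongrightarrow> H i j x" by (simp add: isCont_tendsto_compose)
      then show ?thesis by (rule bounded_linear.tendsto[OF L])
    qed
    show ?thesis
      using LIMSEQ_unique[OF lim[OF p(1), of i j] lim[OF p'(1), of j i, folded eq]] .
  qed
  show ?thesis
    using eqL[OF bounded_linear_Re] eqL[OF bounded_linear_Im] by (simp add: complex_eq_iff)
qed

lemma grad_add:
  assumes "grad U f D" "grad U g E"
  shows "grad U (\<lambda>x. f x + g x) (\<lambda>i x. D i x + E i x)"
  unfolding grad_def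
proof
  fix x assume x: "x \<in> U"
  show "((\<lambda>x. f x + g x) has_derivative (\<lambda>h. \<Sum>i\<in>UNIV. h$i *\<^sub>R (D i x + E i x))) (at x)"
    by (rule has_derivative_eq_rhs[OF has_derivative_add[OF gradD[OF assms(1) x] gradD[OF assms(2) x]]])
       (simp add: scaleR_add_right sum.distrib fun_eq_iff)
qed

lemma grad_const: "grad U (\<lambda>_. c) (\<lambda>_ _. 0)"
  by (simp add: grad_def)

lemma grad_cong:
  assumes "open U" "grad U f D" "\<And>x. x \<in> U \<Longrightarrow> f x = g x" "\<And>i x. x \<in> U \<Longrightarrow> D i x = E i x"
  shows "grad U g E"
  unfolding grad_def
proof
  fix x assume x: "x \<in> U"
  have "(g has_derivative (\<lambda>h. \<Sum>i\<in>UNIV. h$i *\<^sub>R D i x)) (at x)"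
    by (rule has_derivative_transform_within_open[OF gradD[OF assms(2) x] assms(1) x assms(3)])
  then show "(g has_derivative (\<lambda>h. \<Sum>i\<in>UNIV. h$i *\<^sub>R E i x)) (at x)" using assms(4)[OF x] by simp
qed

lemma partial_eq_grad:
  assumes "grad U f D" "x \<in> U"
  shows "partial i f x = D i x"
proof -
  have "frechet_derivative f (at x) = (\<lambda>h. \<Sum>i\<in>UNIV. h$i *\<^sub>R D i x)"
    using frechet_derivative_at[OF gradD[OF assms]] by simp
  then show ?thesis
    using exhaust_3[of i] by (auto simp: partial_def sum_3 axis_def)
qed

lemma grad_partial:
  assumes "open U" "grad U f D"
  shows "grad U f (\<lambda>i. partial i f)"
  by (rule grad_cong[OF assms]) (use partial_eq_grad[OF assms(2)] in auto)

lemma grad_radial: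
  assumes "\<And>r. r > 0 \<Longrightarrow> (\<phi> has_vector_derivative \<phi>' r) (at r)"
  shows "grad (-{0}) (\<lambda>x. \<phi> (norm x)) (\<lambda>i x. (x$i / norm x) *\<^sub>R \<phi>' (norm x))"
  unfolding grad_def
proof
  fix x :: "real^3" assume "x \<in> -{0}"
  then have x: "x \<noteq> 0" by simp
  have "((\<lambda>x. \<phi> (norm x)) has_derivative (\<lambda>h. (h \<bullet> sgn x) *\<^sub>R \<phi>' (norm x))) (at x)"
    by (rule has_derivative_compose[OF has_derivative_norm[OF x] assms[unfolded has_vector_derivative_def]])
       (use x in simp)
  then show "((\<lambda>x. \<phi> (norm x)) has_derivative (\<lambda>h. \<Sum>i\<in>UNIV. h$i *\<^sub>R ((x$i / norm x) *\<^sub>R \<phi>' (norm x)))) (at x)"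
    by (simp add: sgn_div_norm inner_vec_def scaleR_sum_left divide_inverse mult_ac)
qed

lemma grad_coord: "grad U (\<lambda>x. of_real (x$i)) (\<lambda>j x. if i = j then 1 else 0)"
proof -
  have "((\<lambda>x. complex_of_real (x$i)) has_derivative (\<lambda>h. complex_of_real (h$i))) (at x)" for x :: "real^3"
    by (intro has_derivative_of_real bounded_linear.has_derivative[OF bounded_linear_vec_nth has_derivative_ident])
  moreover have "(\<lambda>h. complex_of_real (h$i)) = (\<lambda>h. \<Sum>j\<in>UNIV. (h$j) *\<^sub>R (if i = j then 1 else 0))" 
    using exhaust_3[of i] by (auto simp: sum_3 of_real_def)
  ultimately show ?thesis unfolding grad_def by metis
qed

section \<open>Outgoing kernels\<close>

text \<open>\<open>amplitude m f\<close> expresses that \<open>f\<close> behaves at infinity like a classical symbol of order \<open>- m\<close>: it decays at least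
like \<open>1 / norm x ^ m\<close>, and each differentiation gains one power. The class is generated by the constants, the
components of \<open>x / norm x\<close> and \<open>1 / norm x\<close>.\<close>

inductive amplitude :: "nat \<Rightarrow> (real^3 \<Rightarrow> complex) \<Rightarrow> bool" where
  const: "amplitude 0 (\<lambda>_. c)"
| dir: "amplitude 0 (\<lambda>x. of_real (x$i / norm x))"
| inv: "amplitude 1 (\<lambda>x. of_real (1 / norm x))"
| add: "amplitude m f \<Longrightarrow> amplitude m g \<Longrightarrow> amplitude m (\<lambda>x. f x + g x)"
| mult: "amplitude m f \<Longrightarrow> amplitude n g \<Longrightarrow> amplitude (m + n) (\<lambda>x. f x * g x)"
| weaken: "amplitude (Suc m) f \<Longrightarrow> amplitude m f"

lemma amplitude_bound:
  assumes "amplitude m f"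
  shows "\<exists>C\<ge>0. \<forall>x. norm x \<ge> 1 \<longrightarrow> norm (f x) \<le> C / norm x ^ m"
  using assms
proof induction
  case (const c)
  show ?case by (intro exI[of _ "norm c"]) simp
next
  case (dir i)
  show ?case
  proof (intro exI[of _ 1] conjI allI impI)
    fix x :: "real^3" assume "norm x \<ge> 1"
    then show "norm (complex_of_real (x$i / norm x)) \<le> 1 / norm x ^ 0"
      using component_le_norm_cart[of x i] by (simp add: norm_divide divide_simps)
  qed simp
next
  case inv
  show ?case by (intro exI[of _ 1]) (simp add: norm_divide)
next
  case (add m f g)
  then obtain C C' where *: "C \<ge> 0" "\<And>x. norm x \<ge> 1 \<Longrightarrow> norm (f x) \<le> C / norm x ^ m"
    "C' \<ge> 0" "\<And>x. norm x \<ge> 1 \<Longrightarrow> norm (g x) \<le> C' / norm x ^ m" by blast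
  show ?case
  proof (intro exI[of _ "C + C'"] conjI allI impI)
    fix x :: "real^3" assume x: "norm x \<ge> 1"
    show "norm (f x + g x) \<le> (C + C') / norm x ^ m"
      using norm_triangle_ineq[of "f x" "g x"] *(2)[OF x] *(4)[OF x] by (simp add: add_divide_distrib)
  qed (use * in simp)
next
  case (mult m f n g)
  then obtain C C' where *: "C \<ge> 0" "\<And>x. norm x \<ge> 1 \<Longrightarrow> norm (f x) \<le> C / norm x ^ m"
    "C' \<ge> 0" "\<And>x. norm x \<ge> 1 \<Longrightarrow> norm (g x) \<le> C' / norm x ^ n" by blast
  show ?case
  proof (intro exI[of _ "C * C'"] conjI allI impI)
    fix x :: "real^3" assume x: "norm x \<ge> 1"
    have "norm (f x) * norm (g x) \<le> (C / norm x ^ m) * (C' / norm x ^ n)"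
      by (rule mult_mono[OF *(2)[OF x] *(4)[OF x]]) (use *(1) in auto)
    then show "norm (f x * g x) \<le> (C * C') / norm x ^ (m + n)"
      by (simp add: norm_mult power_add)
  qed (use * in simp)
next
  case (weaken m f)
  then obtain C where *: "C \<ge> 0" "\<And>x. norm x \<ge> 1 \<Longrightarrow> norm (f x) \<le> C / norm x ^ Suc m" by blast
  show ?case
  proof (intro exI[of _ C] conjI allI impI)
    fix x :: "real^3" assume x: "norm x \<ge> 1"
    have "norm x ^ m \<le> norm x ^ Suc m" using x by (intro power_increasing) auto
    moreover have "0 < norm x ^ m" "0 < norm x ^ Suc m" using x by (intro zero_less_power, linarith)+
    ultimately have "C / norm x ^ Suc m \<le> C / norm x ^ m" using *(1)
      by (intro divide_left_mono mult_pos_pos)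
    with *(2)[OF x] show "norm (f x) \<le> C / norm x ^ m" by linarith
  qed (use * in simp)
qed

lemma amplitude_zero: "amplitude m (\<lambda>_. 0)"
proof (induction m)
  case 0
  show ?case by (rule amplitude.const)
next
  case (Suc m)
  from amplitude.mult[OF Suc amplitude.inv] show ?case by simp
qed

lemma grad_inv: "grad (-{0}) (\<lambda>x. of_real (1 / norm x)) (\<lambda>i x. (- 1) * (of_real (x$i / norm x) * (of_real (1 / norm x) * of_real (1 / norm x))))"
proof (rule grad_cong[OF _ grad_radial[of "\<lambda>r. of_real (1 / r)" "\<lambda>r. of_real (- (1 / r\<^sup>2))"]])
  show "((\<lambda>r. complex_of_real (1 / r)) has_vector_derivative of_real (- (1 / r\<^sup>2))) (at r)" if "r > 0" for r
    by (rule has_vector_derivative_of_real) (use that in \<open>auto intro!: derivative_eq_intros simp: power2_eq_square\<close>)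
qed (auto simp: scaleR_conv_of_real power2_eq_square)

lemma amplitude_grad:
  assumes "amplitude m f"
  shows "\<exists>D. (\<forall>i. amplitude (Suc m) (D i)) \<and> grad (-{0}) f D"
  using assms
proof induction
  case (const c)
  show ?case by (intro exI[of _ "\<lambda>_ _. 0"]) (simp add: amplitude_zero grad_const)
next
  case (dir i)
  let ?D = "\<lambda>j x. ((if i = j then 1 else 0) + (- 1) * (complex_of_real (x$i / norm x) * complex_of_real (x$j / norm x))) * complex_of_real (1 / norm x)"
  have "amplitude (Suc 0) (?D j)" for j
    using amplitude.mult[OF amplitude.add[OF amplitude.const[of "if i = j then 1 else 0"] amplitude.mult[OF amplitude.const[of "- 1"] amplitude.mult[OF amplitude.dir[of i] amplitude.dir[of j]], simplified]] amplitude.inv]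
    by simp
  moreover have "grad (-{0}) (\<lambda>x. of_real (x$i / norm x)) ?D"
    by (rule grad_cong[OF _ grad_mult[OF grad_coord[of _ i] grad_inv]]) (auto simp: algebra_simps)
  ultimately show ?case by (intro exI[of _ ?D] conjI allI)
next
  case inv
  have "amplitude (Suc 1) (\<lambda>x. (- 1) * (of_real (x$i / norm x) * (of_real (1 / norm x) * of_real (1 / norm x))))" for i
    using amplitude.mult[OF amplitude.const[of "-1"] amplitude.mult[OF amplitude.dir[of i] amplitude.mult[OF amplitude.inv amplitude.inv]]] by simp
  then show ?case using grad_inv by (intro exI[of _ "\<lambda>i x. (- 1) * (of_real (x$i / norm x) * (of_real (1 / norm x) * of_real (1 / norm x)))"] conjI allI)
next
  case (add m f g)
  then obtain D E where "\<And>i. amplitude (Suc m) (D i)" "grad (-{0}) f D" "\<And>i. amplitude (Suc m) (E i)" "grad (-{0}) g E" by blast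
  then show ?case by (intro exI[of _ "\<lambda>i x. D i x + E i x"] conjI allI amplitude.add grad_add)
next
  case (mult m f n g)
  then obtain D E where *: "\<And>i. amplitude (Suc m) (D i)" "grad (-{0}) f D" "\<And>i. amplitude (Suc n) (E i)" "grad (-{0}) g E" by blast
  have "amplitude (Suc (m + n)) (\<lambda>x. f x * E i x + D i x * g x)" for i
    using amplitude.add[OF amplitude.mult[OF mult.hyps(1) *(3)[of i], unfolded add_Suc_right]
        amplitude.mult[OF *(1)[of i] mult.hyps(2), unfolded add_Suc]] .
  then show ?case using grad_mult[OF *(2,4)] by (intro exI[of _ "\<lambda>i x. f x * E i x + D i x * g x"] conjI allI)
next
  case (weaken m f)
  then show ?case using amplitude.weaken by blast
qed

text \<open>An outgoing wave: the oscillating factor times an amplitude of order \<open>-1\<close>. The class is closed under partial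
derivatives. At the origin, where the kernels are singular, no condition is imposed, so that the total function
\<open>partial i k\<close> belongs to the class whatever its value there.\<close>

definition wave :: "real \<Rightarrow> (real^3 \<Rightarrow> complex) \<Rightarrow> bool" where
  "wave \<kappa> k \<longleftrightarrow> (\<exists>u. amplitude 1 u \<and> (\<forall>x. x \<noteq> 0 \<longrightarrow> k x = exp (\<i> * of_real (\<kappa> * norm x)) * u x))"

lemma grad_exp_norm:
  "grad (-{0}) (\<lambda>x. exp (\<i> * of_real (\<kappa> * norm x))) (\<lambda>i x. \<i> * of_real \<kappa> * of_real (x$i / norm x) * exp (\<i> * of_real (\<kappa> * norm x)))"
proof (rule grad_cong[OF _ grad_radial[of "\<lambda>r. exp (\<i> * of_real (\<kappa> * r))" "\<lambda>r. \<i> * of_real \<kappa> * exp (\<i> * of_real (\<kappa> * r))"]])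
  show "((\<lambda>r. exp (\<i> * complex_of_real (\<kappa> * r))) has_vector_derivative \<i> * of_real \<kappa> * exp (\<i> * of_real (\<kappa> * r))) (at r)" for r
  proof -
    have "((\<lambda>z. exp (\<i> * (of_real \<kappa> * z))) has_field_derivative \<i> * of_real \<kappa> * exp (\<i> * (of_real \<kappa> * of_real r))) (at (of_real r))"
      by (auto intro!: derivative_eq_intros)
    from has_vector_derivative_real_field[OF this] show ?thesis by simp
  qed
qed (auto simp: scaleR_conv_of_real)

text \<open>Differentiation of the oscillating factor gives \<open>\<i> \<kappa> x\<^sub>i / |x|\<close> times the wave itself; the derivative of the amplitude is smaller
by one order. This is the radiation condition in the form in which it passes to potentials.\<close>

lemma wave_derivatives:
  assumes "wave \<kappa> k"
  shows wave_grad: "grad (-{0}) k (\<lambda>i. partial i k)"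
    and wave_partial: "wave \<kappa> (partial i k)"
    and wave_partial_bound: "\<exists>C\<ge>0. \<forall>x i. norm x \<ge> 1 \<longrightarrow>
      norm (partial i k x - \<i> * of_real (\<kappa> * (x$i / norm x)) * k x) \<le> C / (norm x)\<^sup>2"
proof -
  obtain u where u: "amplitude 1 u" and k: "\<And>x. x \<noteq> 0 \<Longrightarrow> k x = exp (\<i> * of_real (\<kappa> * norm x)) * u x"
    using assms by (auto simp: wave_def)
  obtain D where D: "\<And>i. amplitude (Suc 1) (D i)" and gD: "grad (-{0}) u D"
    using amplitude_grad[OF u] by blast
  let ?w = "\<lambda>x. exp (\<i> * complex_of_real (\<kappa> * norm x))"
  have g: "grad (-{0}) k (\<lambda>i x. ?w x * D i x + \<i> * of_real \<kappa> * of_real (x$i / norm x) * ?w x * u x)"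
    by (rule grad_cong[OF _ grad_mult[OF grad_exp_norm gD]]) (use k in auto)
  show "grad (-{0}) k (\<lambda>i. partial i k)" by (rule grad_partial[OF _ g]) auto
  have p: "partial i k x = ?w x * (D i x + \<i> * of_real \<kappa> * (of_real (x$i / norm x) * u x))" if "x \<noteq> 0" for x i
    using partial_eq_grad[OF g, of x i] that by (simp add: algebra_simps)
  have "amplitude 1 (\<lambda>x. D i x + \<i> * of_real \<kappa> * (of_real (x$i / norm x) * u x))" for i
    using amplitude.add[OF amplitude.weaken[OF D[of i]] amplitude.mult[OF amplitude.const[of "\<i> * of_real \<kappa>"] amplitude.mult[OF amplitude.dir[of i] u], unfolded add_0]] .
  then show "wave \<kappa> (partial i k)" unfolding wave_def using p by blast
  obtain B where B: "\<And>i. B i \<ge> 0" "\<And>i x. norm x \<ge> 1 \<Longrightarrow> norm (D i x) \<le> B i / norm x ^ Suc 1"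
    using amplitude_bound[OF D] by metis
  show "\<exists>C\<ge>0. \<forall>x i. norm x \<ge> 1 \<longrightarrow> norm (partial i k x - \<i> * of_real (\<kappa> * (x$i / norm x)) * k x) \<le> C / (norm x)\<^sup>2"
  proof (intro exI[of _ "\<Sum>i\<in>UNIV. B i"] conjI allI impI)
    fix x :: "real^3" and i assume x: "norm x \<ge> 1"
    then have x0: "x \<noteq> 0" by auto
    have "partial i k x - \<i> * of_real (\<kappa> * (x$i / norm x)) * k x = ?w x * D i x"
      unfolding p[OF x0] k[OF x0] by (simp add: algebra_simps)
    moreover have "norm (?w x) = 1" by (simp only: norm_exp_i_times)
    ultimately have "norm (partial i k x - \<i> * of_real (\<kappa> * (x$i / norm x)) * k x) = norm (D i x)"
      by (simp add: norm_mult)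
    also have "\<dots> \<le> B i / (norm x)\<^sup>2" using B(2)[OF x, of i] by (simp add: numeral_2_eq_2)
    also have "\<dots> \<le> (\<Sum>i\<in>UNIV. B i) / (norm x)\<^sup>2"
      by (intro divide_right_mono member_le_sum B) auto
    finally show "norm (partial i k x - \<i> * of_real (\<kappa> * (x$i / norm x)) * k x) \<le> (\<Sum>i\<in>UNIV. B i) / (norm x)\<^sup>2" .
  qed (simp add: sum_nonneg B)
qed

lemma wave_bound:
  assumes "wave \<kappa> k"
  shows "\<exists>C\<ge>0. \<forall>x. norm x \<ge> 1 \<longrightarrow> norm (k x) \<le> C / norm x"
proof -
  obtain u where u: "amplitude 1 u" and k: "\<And>x. x \<noteq> 0 \<Longrightarrow> k x = exp (\<i> * of_real (\<kappa> * norm x)) * u x"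
    using assms by (auto simp: wave_def)
  obtain C where C: "C \<ge> 0" "\<And>x. norm x \<ge> 1 \<Longrightarrow> norm (u x) \<le> C / norm x ^ 1"
    using amplitude_bound[OF u] by blast
  show ?thesis
  proof (intro exI[of _ C] conjI allI impI C(1))
    fix x :: "real^3" assume x: "norm x \<ge> 1"
    then have "x \<noteq> 0" by auto
    then have "norm (k x) = norm (u x)" by (simp only: k norm_mult norm_exp_i_times mult_1 simp_thms)
    with C(2)[OF x] show "norm (k x) \<le> C / norm x" by simp
  qed
qed

lemma wave_lincomb:
  assumes "wave \<kappa> k" "wave \<kappa> l"
  shows "wave \<kappa> (\<lambda>x. a * k x + b * l x)"
proof -
  obtain u v where "amplitude 1 u" "\<And>x. x \<noteq> 0 \<Longrightarrow> k x = exp (\<i> * of_real (\<kappa> * norm x)) * u x"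
    "amplitude 1 v" "\<And>x. x \<noteq> 0 \<Longrightarrow> l x = exp (\<i> * of_real (\<kappa> * norm x)) * v x"
    using assms unfolding wave_def by blast
  note * = this
  show ?thesis
    unfolding wave_def
  proof (intro exI conjI allI impI)
    show "amplitude 1 (\<lambda>x. a * u x + b * v x)"
      using amplitude.add[OF amplitude.mult[OF amplitude.const[of a] *(1)] amplitude.mult[OF amplitude.const[of b] *(3)]] by simp
    fix x :: "real^3" assume "x \<noteq> 0"
    then show "a * k x + b * l x = exp (\<i> * of_real (\<kappa> * norm x)) * (a * u x + b * v x)"
      by (simp add: * algebra_simps)
  qed
qed

lemma wave_continuous: "wave \<kappa> k \<Longrightarrow> continuous_on (-{0}) k"
  by (rule grad_imp_continuous_on[OF wave_grad])

lemma wave_partial_commute: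
  assumes "wave \<kappa> k" "x \<noteq> 0"
  shows "partial j (partial i k) x = partial i (partial j k) x"
  by (rule second_partials_symmetric[where U = "-{0}" and f = k and D = "\<lambda>i. partial i k" and H = "\<lambda>i j. partial j (partial i k)"])
     (use assms wave_continuous wave_partial wave_grad in blast)+

definition helmholtz_wave :: "real \<Rightarrow> (real^3 \<Rightarrow> complex) \<Rightarrow> bool" where
  "helmholtz_wave \<kappa> k \<longleftrightarrow> wave \<kappa> k \<and> (\<forall>x. x \<noteq> 0 \<longrightarrow> (\<Sum>i\<in>UNIV. partial i (partial i k) x) = - (of_real (\<kappa>\<^sup>2) * k x))"

lemma partial_cong_open:
  assumes "grad U f D" "open U" "x \<in> U" "\<And>y. y \<in> U \<Longrightarrow> f y = g y"
  shows "partial i f x = partial i g x"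
proof -
  have "f differentiable (at x)" using gradD[OF assms(1,3)] by (auto simp: differentiable_def)
  then show ?thesis
    using frechet_derivative_transform_within_open[OF _ assms(2,3,4)] by (simp add: partial_def)
qed

lemma partial_lincomb:
  assumes "grad U f D" "grad U g E" "x \<in> U"
  shows "partial i (\<lambda>x. a * f x + b * g x) x = a * partial i f x + b * partial i g x"
proof -
  have "grad U (\<lambda>x. a * f x + b * g x) (\<lambda>i x. (a * D i x + 0 * f x) + (b * E i x + 0 * g x))"
    by (intro grad_add grad_mult grad_const assms)
  from partial_eq_grad[OF this assms(3)] show ?thesis
    using partial_eq_grad[OF assms(1,3)] partial_eq_grad[OF assms(2,3)] by simp
qed

lemma helmholtz_wave_lincomb:
  assumes "helmholtz_wave \<kappa> k" "helmholtz_wave \<kappa> l"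
  shows "helmholtz_wave \<kappa> (\<lambda>x. a * k x + b * l x)"
proof -
  have w: "wave \<kappa> k" "wave \<kappa> l" using assms by (auto simp: helmholtz_wave_def)
  have 1: "partial i (\<lambda>x. a * k x + b * l x) x = a * partial i k x + b * partial i l x" if "x \<noteq> 0" for x i
    by (rule partial_lincomb[OF wave_grad[OF w(1)] wave_grad[OF w(2)]]) (use that in simp)
  have 2: "partial i (partial i (\<lambda>x. a * k x + b * l x)) x = a * partial i (partial i k) x + b * partial i (partial i l) x" if x: "x \<noteq> 0" for x i
  proof -
    have "partial i (partial i (\<lambda>x. a * k x + b * l x)) x = partial i (\<lambda>x. a * partial i k x + b * partial i l x) x"
      by (rule partial_cong_open[OF wave_grad[OF wave_partial[OF wave_lincomb[OF w]]]]) (use x 1 in auto)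
    also have "\<dots> = a * partial i (partial i k) x + b * partial i (partial i l) x"
      by (rule partial_lincomb[OF wave_grad[OF wave_partial[OF w(1)]] wave_grad[OF wave_partial[OF w(2)]]]) (use x in simp)
    finally show ?thesis .
  qed
  show ?thesis
    unfolding helmholtz_wave_def
    using wave_lincomb[OF w] assms
    by (auto simp: helmholtz_wave_def 2 sum.distrib sum_distrib_left[symmetric] algebra_simps)
qed

text \<open>Partial derivatives of all orders commute on waves, so derivatives of a solution are solutions.\<close>

lemma helmholtz_wave_partial:
  assumes "helmholtz_wave \<kappa> k"
  shows "helmholtz_wave \<kappa> (partial a k)"
  unfolding helmholtz_wave_def
proof (intro conjI allI impI)
  have w: "wave \<kappa> k" using assms by (auto simp: helmholtz_wave_def)
  show "wave \<kappa> (partial a k)" by (rule wave_partial[OF w])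
  fix x :: "real^3" assume x: "x \<noteq> 0"
  note w1 = wave_partial[OF w] and w2 = wave_partial[OF wave_partial[OF w]]
  have swap: "partial i (partial i (partial a k)) x = partial a (partial i (partial i k)) x" for i
  proof -
    have "partial i (partial i (partial a k)) x = partial i (partial a (partial i k)) x"
      by (rule partial_cong_open[OF wave_grad[OF w2]]) (use x wave_partial_commute[OF w] in auto)
    also have "\<dots> = partial a (partial i (partial i k)) x"
      by (rule wave_partial_commute[OF w1 x])
    finally show ?thesis .
  qed
  have gs: "grad (-{0}) (\<lambda>x. \<Sum>i\<in>UNIV. partial i (partial i k) x) (\<lambda>j x. \<Sum>i\<in>UNIV. partial j (partial i (partial i k)) x)"
    unfolding sum_3 by (intro grad_add wave_grad[OF w2])
  have "(\<Sum>i\<in>UNIV. partial i (partial i (partial a k)) x) = partial a (\<lambda>x. \<Sum>i\<in>UNIV. partial i (partial i k) x) x"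
    unfolding swap using partial_eq_grad[OF gs, of x a] x by simp
  also have "\<dots> = partial a (\<lambda>x. (- of_real (\<kappa>\<^sup>2)) * k x + 0 * k x) x"
    by (rule partial_cong_open[OF gs]) (use x assms in \<open>auto simp: helmholtz_wave_def\<close>)
  also have "\<dots> = - (of_real (\<kappa>\<^sup>2) * partial a k x)"
    using partial_lincomb[OF wave_grad[OF w] wave_grad[OF w], of x a "- of_real (\<kappa>\<^sup>2)" 0] x by simp
  finally show "(\<Sum>i\<in>UNIV. partial i (partial i (partial a k)) x) = - (of_real (\<kappa>\<^sup>2) * partial a k x)" .
qed

definition outgoing_wave :: "real \<Rightarrow> real^3 \<Rightarrow> complex" where
  "outgoing_wave \<kappa> x = exp (\<i> * of_real (\<kappa> * norm x)) / of_real (4 * pi * norm x)"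

text \<open>For a radial function \<open>\<phi>\<close> with \<open>\<phi>' = r \<psi>\<close> the Laplacian is \<open>r \<psi>' + 3 \<psi>\<close>, which is evaluated for
\<open>\<phi> = exp (\<i> \<kappa> r) / (4 \<pi> r)\<close>.\<close>

lemma helmholtz_wave_outgoing: "helmholtz_wave \<kappa> (outgoing_wave \<kappa>)"
  unfolding helmholtz_wave_def
proof (intro conjI allI impI)
  have "amplitude 1 (\<lambda>x. of_real (1 / (4 * pi)) * of_real (1 / norm x))"
    using amplitude.mult[OF amplitude.const amplitude.inv, unfolded add_0] .
  then show "wave \<kappa> (outgoing_wave \<kappa>)"
    unfolding wave_def by (intro exI conjI) (assumption, simp add: outgoing_wave_def)
  fix x :: "real^3" assume x: "x \<noteq> 0"
  define \<phi> where "\<phi> r = exp (\<i> * of_real (\<kappa> * r)) / of_real (4 * pi * r)" for r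
  define \<psi> where "\<psi> r = (\<i> * of_real \<kappa> / of_real r - 1 / of_real r ^ 2) * \<phi> r" for r
  define \<psi>' where "\<psi>' r = (- \<i> * of_real \<kappa> / of_real r ^ 2 + 2 / of_real r ^ 3) * \<phi> r
    + (\<i> * of_real \<kappa> / of_real r - 1 / of_real r ^ 2) * (of_real r * \<psi> r)" for r
  have d\<phi>: "(\<phi> has_vector_derivative of_real r * \<psi> r) (at r)" if "r > 0" for r
  proof -
    have "((\<lambda>z. exp (\<i> * (of_real \<kappa> * z)) / (4 * of_real pi * z)) has_field_derivative
       of_real r * \<psi> r) (at (of_real r))"
      using that by (auto intro!: derivative_eq_intros simp: \<psi>_def \<phi>_def field_simps power2_eq_square)
    from has_vector_derivative_real_field[OF this] show ?thesis by (simp add: \<phi>_def[abs_def])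
  qed
  have dp: "((\<lambda>r. \<i> * of_real \<kappa> / of_real r - 1 / of_real r ^ 2) has_vector_derivative
      (- \<i> * of_real \<kappa> / of_real r ^ 2 + 2 / of_real r ^ 3)) (at r)" if "r > 0" for r
  proof -
    have "((\<lambda>z. \<i> * of_real \<kappa> / z - 1 / z ^ 2) has_field_derivative
      (- \<i> * of_real \<kappa> / of_real r ^ 2 + 2 / of_real r ^ 3)) (at (of_real r))"
      using that by (auto intro!: derivative_eq_intros simp: field_simps power2_eq_square power3_eq_cube)
    from has_vector_derivative_real_field[OF this] show ?thesis by simp
  qed
  have d\<psi>: "(\<psi> has_vector_derivative \<psi>' r) (at r)" if "r > 0" for r
    unfolding \<psi>_def[abs_def]
    by (rule has_vector_derivative_eq_rhs[OF has_vector_derivative_mult[OF dp[OF that] d\<phi>[OF that]]])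
       (simp add: \<psi>'_def \<psi>_def)
  have o: "outgoing_wave \<kappa> = (\<lambda>x. \<phi> (norm x))" by (simp add: fun_eq_iff outgoing_wave_def \<phi>_def)
  have g1: "grad (-{0}) (outgoing_wave \<kappa>) (\<lambda>i x. of_real (x$i) * \<psi> (norm x))"
    unfolding o by (rule grad_cong[OF _ grad_radial[OF d\<phi>]]) (auto simp: scaleR_conv_of_real)
  have g2: "grad (-{0}) (\<lambda>x. of_real (x$i) * \<psi> (norm x))
     (\<lambda>j x. of_real (x$i) * ((x$j / norm x) *\<^sub>R \<psi>' (norm x)) + (if i = j then 1 else 0) * \<psi> (norm x))" for i
    by (intro grad_mult grad_coord grad_radial d\<psi>)
  have p2: "partial i (partial i (outgoing_wave \<kappa>)) x = of_real ((x$i)\<^sup>2) * (\<psi>' (norm x) / norm x) + \<psi> (norm x)" for i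
  proof -
    have "partial i (partial i (outgoing_wave \<kappa>)) x = partial i (\<lambda>x. of_real (x$i) * \<psi> (norm x)) x"
      by (rule partial_cong_open[OF g2[of i], symmetric]) (use partial_eq_grad[OF g1] x in auto)
    also have "\<dots> = of_real ((x$i)\<^sup>2) * (\<psi>' (norm x) / norm x) + \<psi> (norm x)"
      using partial_eq_grad[OF g2, of x i i] x by (simp add: scaleR_conv_of_real power2_eq_square)
    finally show ?thesis .
  qed
  define r where "r = norm x"
  have r: "r > 0" using x by (simp add: r_def)
  have n: "(x$1)\<^sup>2 + (x$2)\<^sup>2 + (x$3)\<^sup>2 = r\<^sup>2"
    by (simp add: r_def norm_vec_def L2_set_def sum_3)
  have "(\<Sum>i\<in>UNIV. partial i (partial i (outgoing_wave \<kappa>)) x) = of_real ((x$1)\<^sup>2 + (x$2)\<^sup>2 + (x$3)\<^sup>2) * (\<psi>' r / r) + 3 * \<psi> r"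
    unfolding p2 sum_3 r_def[symmetric] by (simp add: algebra_simps)
  also have "\<dots> = of_real r * \<psi>' r + 3 * \<psi> r"
    unfolding n using r by (simp add: power2_eq_square)
  also have "\<dots> = - (of_real (\<kappa>\<^sup>2) * \<phi> r)"
  proof -
    define z \<alpha> w where "z = complex_of_real r" and "\<alpha> = \<i> * complex_of_real \<kappa>" and "w = \<phi> r"
    have z: "z \<noteq> 0" using r by (simp add: z_def)
    have a2: "\<alpha> * \<alpha> = - of_real (\<kappa>\<^sup>2)" by (simp add: \<alpha>_def power2_eq_square algebra_simps)
    have "z * ((- \<alpha> / z ^ 2 + 2 / z ^ 3) * w + (\<alpha> / z - 1 / z ^ 2) * (z * ((\<alpha> / z - 1 / z ^ 2) * w))) + 3 * ((\<alpha> / z - 1 / z ^ 2) * w)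
      = \<alpha> * \<alpha> * w"
      using z by (simp add: field_simps power2_eq_square power3_eq_cube)
    then show ?thesis
      unfolding \<psi>'_def \<psi>_def a2 by (simp add: z_def \<alpha>_def w_def)
  qed
  finally show "(\<Sum>i\<in>UNIV. partial i (partial i (outgoing_wave \<kappa>)) x) = - (of_real (\<kappa>\<^sup>2) * outgoing_wave \<kappa> x)"
    by (simp add: o r_def)
qed

section \<open>Potentials of compactly supported sources\<close>

text \<open>The error of the linear approximation is small uniformly on an annulus, because the partial derivatives are
uniformly continuous on a slightly larger one. With this, differentiation under the integral sign reduces to an estimate
of integrals.\<close>

lemma taylor_uniform:
  assumes g: "grad (-{0}) k D" and cD: "\<And>i. continuous_on (-{0}) (D i)"
    and a: "0 < a" and \<epsilon>: "\<epsilon> > 0"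
  shows "\<exists>\<delta>>0. \<forall>z h. a \<le> norm z \<and> norm z \<le> b \<and> norm h < \<delta> \<longrightarrow>
    norm (k (z + h) - k z - (\<Sum>i\<in>UNIV. h$i *\<^sub>R D i z)) \<le> \<epsilon> * norm h"
proof -
  define S :: "(real^3) set" where "S = {z. a / 2 \<le> norm z \<and> norm z \<le> b + a / 2}"
  have "closed S" unfolding S_def by (intro closed_Collect_conj closed_Collect_le continuous_intros)
  moreover have "bounded S" unfolding S_def by (auto simp: bounded_iff)
  ultimately have S: "compact S" by (simp add: compact_eq_bounded_closed)
  have S0: "S \<subseteq> -{0}" using a by (auto simp: S_def)
  have "\<exists>d>0. \<forall>z\<in>S. \<forall>z'\<in>S. dist z' z < d \<longrightarrow> dist (D i z') (D i z) < \<epsilon> / 3" for i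
  proof -
    have "\<epsilon> / 3 > 0" using \<epsilon> by simp
    then show ?thesis
      using compact_uniformly_continuous[OF continuous_on_subset[OF cD S0] S, of i]
      unfolding uniformly_continuous_on_def by blast
  qed
  then obtain d where d: "\<And>i. d i > 0" "\<And>i z z'. z \<in> S \<Longrightarrow> z' \<in> S \<Longrightarrow> dist z' z < d i \<Longrightarrow> dist (D i z') (D i z) < \<epsilon> / 3"
    by metis
  define \<delta> where "\<delta> = Min (insert (a / 2) (range d))"
  have \<delta>: "\<delta> > 0" "\<delta> \<le> a / 2" "\<delta> \<le> d i" for i
  proof -
    have fin: "finite (insert (a / 2) (range d))" by simp
    show "\<delta> > 0" unfolding \<delta>_def using d(1) a by (subst Min_gr_iff[OF fin]) auto
    show "\<delta> \<le> a / 2" "\<delta> \<le> d i" unfolding \<delta>_def by (rule Min_le[OF fin]; simp)+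
  qed
  show ?thesis
  proof (intro exI[of _ \<delta>] conjI allI impI \<delta>(1))
    fix z h :: "real^3" assume *: "a \<le> norm z \<and> norm z \<le> b \<and> norm h < \<delta>"
    define f where "f w = k w - (\<Sum>i\<in>UNIV. w$i *\<^sub>R D i z)" for w
    define B where "B = ball z \<delta>"
    have BS: "w \<in> S" if "w \<in> B" for w
    proof -
      have "norm (w - z) < a / 2" using that \<delta> by (auto simp: B_def dist_norm norm_minus_commute)
      then show ?thesis using * norm_triangle_ineq2[of z w] norm_triangle_ineq2[of w z]
        by (auto simp: S_def norm_minus_commute)
    qed
    have zB: "z \<in> B" using \<delta> by (simp add: B_def)
    have "norm (f (z + h) - f z) \<le> \<epsilon> * norm ((z + h) - z)"
    proof (rule differentiable_bound[of B f "\<lambda>w h. \<Sum>i\<in>UNIV. h$i *\<^sub>R (D i w - D i z)"])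
      show "convex B" by (simp add: B_def)
      fix w assume w: "w \<in> B"
      have "((\<lambda>w. \<Sum>i\<in>UNIV. w$i *\<^sub>R D i z) has_derivative (\<lambda>h. \<Sum>i\<in>UNIV. h$i *\<^sub>R D i z)) (at w)"
        by (intro has_derivative_sum has_derivative_scaleR_left
            bounded_linear.has_derivative[OF bounded_linear_vec_nth has_derivative_ident])
      from has_derivative_diff[OF gradD[OF g] this]
      have "(f has_derivative (\<lambda>h. (\<Sum>i\<in>UNIV. h$i *\<^sub>R D i w) - (\<Sum>i\<in>UNIV. h$i *\<^sub>R D i z))) (at w)"
        using BS[OF w] S0 unfolding f_def by auto
      then show "(f has_derivative (\<lambda>h. \<Sum>i\<in>UNIV. h$i *\<^sub>R (D i w - D i z))) (at w within B)"
        by (simp add: scaleR_diff_right sum_subtractf has_derivative_at_withinI)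
      show "onorm (\<lambda>h. \<Sum>i\<in>UNIV. h$i *\<^sub>R (D i w - D i z)) \<le> \<epsilon>"
      proof (rule onorm_le)
        fix v :: "real^3"
        have "norm (\<Sum>i\<in>UNIV. v$i *\<^sub>R (D i w - D i z)) \<le> (\<Sum>i\<in>(UNIV::3 set). norm v * (\<epsilon> / 3))"
        proof (rule sum_norm_le)
          fix i :: 3
          have "dist w z < d i" using w \<delta>(3)[of i] by (auto simp: B_def dist_commute)
          then have "norm (D i w - D i z) \<le> \<epsilon> / 3"
            using d(2)[OF BS[OF zB] BS[OF w]] by (simp add: dist_norm less_imp_le)
          then show "norm (v$i *\<^sub>R (D i w - D i z)) \<le> norm v * (\<epsilon> / 3)"
            unfolding norm_scaleR using component_le_norm_cart[of v i] by (intro mult_mono) auto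
        qed
        then show "norm (\<Sum>i\<in>UNIV. v$i *\<^sub>R (D i w - D i z)) \<le> \<epsilon> * norm v" by (simp add: mult.commute)
      qed
    next
      show "z + h \<in> B" using * by (simp add: B_def dist_norm)
    qed (rule zB)
    moreover have "f (z + h) - f z = k (z + h) - k z - (\<Sum>i\<in>UNIV. h$i *\<^sub>R D i z)"
      by (simp add: f_def scaleR_add_left sum.distrib)
    ultimately show "norm (k (z + h) - k z - (\<Sum>i\<in>UNIV. h$i *\<^sub>R D i z)) \<le> \<epsilon> * norm h" by simp
  qed
qed

definition potential :: "(real^3 \<Rightarrow> complex) \<Rightarrow> (real^3 \<Rightarrow> complex) \<Rightarrow> real^3 \<Rightarrow> complex" where
  "potential k f x = (LINT y|lebesgue. k (x - y) * f y)"

text \<open>An integrable source supported in the closed ball of radius \<open>\<rho>\<close>. Its vanishing is demanded at each point of the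
complement and not just almost everywhere, so that the singularity of a kernel at \<open>y = x\<close> is cancelled pointwise.\<close>

locale source =
  fixes \<rho> :: real and f :: "real^3 \<Rightarrow> complex"
  assumes \<rho>: "\<rho> \<ge> 0" and int: "integrable lebesgue f" and supp: "\<And>y. norm y > \<rho> \<Longrightarrow> f y = 0"
begin

lemma integrable_potential:
  assumes k: "continuous_on (-{0}) k" and x: "norm x > \<rho>"
  shows "integrable lebesgue (\<lambda>y. k (x - y) * f y)"
proof -
  define S :: "(real^3) set" where "S = {z. norm x - \<rho> \<le> norm z \<and> norm z \<le> norm x + \<rho>}"
  have "closed S" unfolding S_def by (intro closed_Collect_conj closed_Collect_le continuous_intros)
  moreover have "bounded S" unfolding S_def by (auto simp: bounded_iff)
  ultimately have "compact S" by (simp add: compact_eq_bounded_closed)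
  moreover have "S \<subseteq> -{0}" using x by (auto simp: S_def)
  ultimately have "bounded (k ` S)"
    by (meson compact_continuous_image compact_imp_bounded continuous_on_subset k)
  then obtain B where B: "\<And>z. z \<in> S \<Longrightarrow> norm (k z) \<le> B" by (auto simp: bounded_iff)
  have "(\<lambda>y. indicator (-{x}) y *\<^sub>R k (x - y)) \<in> borel_measurable borel"
    by (intro borel_measurable_continuous_on_indicator continuous_on_compose2[OF k] continuous_intros) auto
  then have m: "(\<lambda>y. indicator (-{x}) y *\<^sub>R k (x - y)) \<in> borel_measurable lebesgue"
    using measurable_completion by (metis measurable_lborel2)
  \<comment> \<open>The value of \<open>k\<close> at \<open>0\<close> is arbitrary, and at \<open>y = x\<close> the source vanishes.\<close>
  have eq: "(\<lambda>y. k (x - y) * f y) = (\<lambda>y. (indicator (-{x}) y *\<^sub>R k (x - y)) * f y)"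
    using supp[OF x] by (auto simp: fun_eq_iff indicator_def)
  have meas: "(\<lambda>y. k (x - y) * f y) \<in> borel_measurable lebesgue"
    unfolding eq by (intro borel_measurable_times m borel_measurable_integrable int)
  show ?thesis
  proof (rule Bochner_Integration.integrable_bound[OF _ meas])
    show "integrable lebesgue (\<lambda>y. B * norm (f y))" by (intro integrable_mult_right integrable_norm int)
    show "AE y in lebesgue. norm (k (x - y) * f y) \<le> norm (B * norm (f y))"
    proof (rule AE_I2)
      fix y
      show "norm (k (x - y) * f y) \<le> norm (B * norm (f y))"
      proof (cases "norm y > \<rho>")
        case False
        then have "x - y \<in> S"
          using norm_triangle_ineq2[of x y] norm_triangle_ineq4[of x y] by (auto simp: S_def)
        from B[OF this] have "norm (k (x - y)) \<le> \<bar>B\<bar>" by linarith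
        then show ?thesis by (simp add: norm_mult abs_mult mult_right_mono)
      qed (simp add: supp)
    qed
  qed
qed

lemma norm_potential_le:
  assumes k: "continuous_on (-{0}) k" and x: "norm x > \<rho>"
    and B: "\<And>y. norm y \<le> \<rho> \<Longrightarrow> norm (k (x - y)) \<le> B"
  shows "norm (potential k f x) \<le> B * (LINT y|lebesgue. norm (f y))"
proof -
  have "norm (potential k f x) \<le> (LINT y|lebesgue. norm (k (x - y) * f y))"
    unfolding potential_def by (rule integral_norm_bound)
  also have "\<dots> \<le> (LINT y|lebesgue. B * norm (f y))"
  proof (rule integral_mono)
    fix y
    show "norm (k (x - y) * f y) \<le> B * norm (f y)"
      using B[of y] supp[of y] by (cases "norm y > \<rho>") (auto simp: norm_mult mult_right_mono)
  qed (intro integrable_norm integrable_potential k x integrable_mult_right int)+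
  finally show ?thesis by simp
qed

lemma grad_potential:
  assumes g: "grad (-{0}) k D" and cD: "\<And>i. continuous_on (-{0}) (D i)"
  shows "grad {x. norm x > \<rho>} (potential k f) (\<lambda>i. potential (D i) f)"
  unfolding grad_def
proof
  fix x :: "real^3" assume "x \<in> {x. norm x > \<rho>}"
  then have x: "norm x > \<rho>" by simp
  define a where "a = norm x - \<rho>"
  have a: "a > 0" using x by (simp add: a_def)
  have ck: "continuous_on (-{0}) k" by (rule grad_imp_continuous_on[OF g])
  define N where "N = (LINT y|lebesgue. norm (f y))"
  have N: "N \<ge> 0" unfolding N_def by simp
  show "(potential k f has_derivative (\<lambda>h. \<Sum>i\<in>UNIV. h$i *\<^sub>R potential (D i) f x)) (at x)"
    unfolding has_derivative_at_alt
  proof (intro conjI allI impI)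
    show "bounded_linear (\<lambda>h. \<Sum>i\<in>UNIV. h$i *\<^sub>R potential (D i) f x)"
      by (intro bounded_linear_sum bounded_linear_scaleR_const bounded_linear_vec_nth)
    fix \<epsilon> :: real assume \<epsilon>: "\<epsilon> > 0"
    have "\<epsilon> / (N + 1) > 0" using \<epsilon> N by simp
    from taylor_uniform[OF g cD a this, of "norm x + \<rho>"]
    obtain \<delta> where \<delta>: "\<delta> > 0" "\<And>z h. a \<le> norm z \<Longrightarrow> norm z \<le> norm x + \<rho> \<Longrightarrow> norm h < \<delta> \<Longrightarrow>
        norm (k (z + h) - k z - (\<Sum>i\<in>UNIV. h$i *\<^sub>R D i z)) \<le> \<epsilon> / (N + 1) * norm h" by blast
    show "\<exists>d>0. \<forall>y. norm (y - x) < d \<longrightarrow>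
       norm (potential k f y - potential k f x - (\<Sum>i\<in>UNIV. (y - x)$i *\<^sub>R potential (D i) f x)) \<le> \<epsilon> * norm (y - x)"
    \<comment> \<open>The bound \<open>a\<close> keeps the shifted point outside the closed ball that carries the source.\<close>
    proof (intro exI[of _ "min \<delta> a"] conjI allI impI)
      fix x' assume x': "norm (x' - x) < min \<delta> a"
      define h where "h = x' - x"
      have nx': "norm x' > \<rho>" using x' norm_triangle_ineq2[of x x'] by (simp add: a_def norm_minus_commute)
      define q where "q z = k (z + h) - k z - (\<Sum>i\<in>UNIV. h$i *\<^sub>R D i z)" for z
      have i1: "integrable lebesgue (\<lambda>y. k (x' - y) * f y)" by (rule integrable_potential[OF ck nx'])
      have i2: "integrable lebesgue (\<lambda>y. k (x - y) * f y)" by (rule integrable_potential[OF ck x])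
      have i3: "integrable lebesgue (\<lambda>y. D i (x - y) * f y)" for i by (rule integrable_potential[OF cD x])
      have qe: "q (x - y) * f y = k (x' - y) * f y - k (x - y) * f y - (\<Sum>i\<in>UNIV. h$i *\<^sub>R (D i (x - y) * f y))" for y
      proof -
        have "x - y + h = x' - y" by (simp add: h_def)
        then show ?thesis by (simp only: q_def left_diff_distrib sum_distrib_right mult_scaleR_left)
      qed
      have iq: "integrable lebesgue (\<lambda>y. q (x - y) * f y)"
        unfolding qe by (intro Bochner_Integration.integrable_diff i1 i2 Bochner_Integration.integrable_sum integrable_scaleR_right i3)
      have "potential k f x' - potential k f x - (\<Sum>i\<in>UNIV. h$i *\<^sub>R potential (D i) f x) = (LINT y|lebesgue. q (x - y) * f y)"
        unfolding qe potential_def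
        by (simp add: Bochner_Integration.integral_diff i1 i2 i3 Bochner_Integration.integral_sum integral_scaleR_right integrable_scaleR_right Bochner_Integration.integrable_sum Bochner_Integration.integrable_diff del: integral_mult_right_zero)
      also have "norm \<dots> \<le> (LINT y|lebesgue. norm (q (x - y) * f y))" by (rule integral_norm_bound)
      also have "\<dots> \<le> (LINT y|lebesgue. (\<epsilon> / (N + 1) * norm h) * norm (f y))"
      proof (rule integral_mono)
        fix y
        show "norm (q (x - y) * f y) \<le> (\<epsilon> / (N + 1) * norm h) * norm (f y)"
        proof (cases "norm y > \<rho>")
          case False
          have "norm (q (x - y)) \<le> \<epsilon> / (N + 1) * norm h"
            unfolding q_def using False x' norm_triangle_ineq2[of x y] norm_triangle_ineq4[of x y]
            by (intro \<delta>(2)) (auto simp: a_def h_def)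
          then show ?thesis unfolding norm_mult by (rule mult_right_mono) simp
        qed (simp add: supp)
      qed (intro integrable_norm iq integrable_mult_right int)+
      also have "\<dots> = (\<epsilon> / (N + 1) * norm h) * N" by (simp add: N_def)
      also have "\<dots> \<le> \<epsilon> * norm h"
      proof -
        have "N / (N + 1) \<le> 1" using N by simp
        then have "(\<epsilon> * norm h) * (N / (N + 1)) \<le> (\<epsilon> * norm h) * 1" using \<epsilon> by (intro mult_left_mono) auto
        then show ?thesis by (simp add: mult_ac)
      qed
      finally show "norm (potential k f x' - potential k f x - (\<Sum>i\<in>UNIV. (x' - x)$i *\<^sub>R potential (D i) f x)) \<le> \<epsilon> * norm (x' - x)"
        by (simp add: h_def)
    qed (use \<delta> a in simp)
  qed
qed

lemma tendsto_zero_at_infinity: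
  fixes F :: "real^3 \<Rightarrow> complex"
  assumes "\<And>x. norm x \<ge> B \<Longrightarrow> norm (F x) \<le> C / (norm x - \<rho>)"
  shows "(F \<longlongrightarrow> 0) at_infinity"
proof (rule Lim_null_comparison)
  show "\<forall>\<^sub>F x in at_infinity. norm (F x) \<le> C / (norm x - \<rho>)"
    using assms by (auto simp: eventually_at_infinity)
  have "filterlim (\<lambda>x::real^3. - \<rho> + norm x) at_top at_infinity"
    by (rule filterlim_tendsto_add_at_top[OF tendsto_const filterlim_norm_at_top])
  then have "filterlim (\<lambda>x::real^3. norm x - \<rho>) at_top at_infinity" by simp
  then show "((\<lambda>x::real^3. C / (norm x - \<rho>)) \<longlongrightarrow> 0) at_infinity"
    by (intro tendsto_divide_0[OF tendsto_const] filterlim_at_top_imp_at_infinity)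
qed

text \<open>The equation and the regularity pass from the kernel to the potential by differentiation under the integral. For the
Sommerfeld condition, \<open>l\<close> is the kernel \<open>x \<bullet> \<nabla>k - \<i> \<kappa> |x| k\<close>. With \<open>d = x - y\<close>, its leading part is \<open>\<i> \<kappa> (x \<bullet> d / |d| - |x|) k(d)\<close>, where the factor
in parentheses is at most \<open>2 \<rho>\<close> in absolute value, and the remaining part is of lower order.\<close>

lemma radiating_potential:
  assumes \<kappa>: "\<kappa> > 0" and h: "helmholtz_wave \<kappa> k"
  shows "radiating_field \<kappa> \<rho> (potential k f) (\<lambda>i. potential (partial i k) f)
    (\<lambda>i j. potential (partial j (partial i k)) f)"
proof
  have w: "wave \<kappa> k" using h by (simp add: helmholtz_wave_def)
  note w1 = wave_partial[OF w] and w2 = wave_partial[OF wave_partial[OF w]]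
  note c = wave_continuous[OF w] wave_continuous[OF w1] wave_continuous[OF w2]
  define N where "N = (LINT y|lebesgue. norm (f y))"
  have N: "N \<ge> 0" unfolding N_def by simp
  show "0 < \<kappa>" "0 \<le> \<rho>" using \<kappa> \<rho> by auto
  show "C2 {x. norm x > \<rho>} (potential k f) (\<lambda>i. potential (partial i k) f)
    (\<lambda>i j. potential (partial j (partial i k)) f)"
    unfolding C2_def
  proof (intro conjI allI ballI)
    show "grad {x. norm x > \<rho>} (potential k f) (\<lambda>i. potential (partial i k) f)"
      by (rule grad_potential[OF wave_grad[OF w] c(2)])
    show "grad {x. norm x > \<rho>} (potential (partial i k) f) (\<lambda>j. potential (partial j (partial i k)) f)" for i
      by (rule grad_potential[OF wave_grad[OF w1] c(3)])
    show "continuous_on {x. norm x > \<rho>} (potential (partial j (partial i k)) f)" for i j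
      by (rule grad_imp_continuous_on[OF grad_potential[OF wave_grad[OF w2] wave_continuous[OF wave_partial[OF w2]]]])
    fix x :: "real^3" and i j assume "x \<in> {x. norm x > \<rho>}"
    then have x: "norm x > \<rho>" by simp
    show "potential (partial j (partial i k)) f x = potential (partial i (partial j k)) f x"
      unfolding potential_def
    proof (rule Bochner_Integration.integral_cong[OF refl])
      fix y show "partial j (partial i k) (x - y) * f y = partial i (partial j k) (x - y) * f y"
        using wave_partial_commute[OF w, of "x - y" j i] supp[OF x] by (cases "x = y") auto
    qed
  qed
  show "(\<Sum>i\<in>UNIV. potential (partial i (partial i k)) f x) = - (of_real (\<kappa>\<^sup>2) * potential k f x)" if x: "norm x > \<rho>" for x
  proof -
    have "(\<Sum>i\<in>UNIV. potential (partial i (partial i k)) f x) = (LINT y|lebesgue. (\<Sum>i\<in>UNIV. partial i (partial i k) (x - y) * f y))"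
      unfolding potential_def by (rule Bochner_Integration.integral_sum[symmetric]) (rule integrable_potential[OF c(3) x])
    also have "\<dots> = (LINT y|lebesgue. - of_real (\<kappa>\<^sup>2) * (k (x - y) * f y))"
    proof (rule Bochner_Integration.integral_cong[OF refl])
      fix y
      show "(\<Sum>i\<in>UNIV. partial i (partial i k) (x - y) * f y) = - of_real (\<kappa>\<^sup>2) * (k (x - y) * f y)"
      proof (cases "x = y")
        case False
        then have "(\<Sum>i\<in>UNIV. partial i (partial i k) (x - y)) = - (of_real (\<kappa>\<^sup>2) * k (x - y))"
          using h by (simp add: helmholtz_wave_def)
        then show ?thesis by (simp add: sum_distrib_right[symmetric])
      qed (use supp[OF x] in simp)
    qed
    also have "\<dots> = - (of_real (\<kappa>\<^sup>2) * potential k f x)"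
      unfolding potential_def by simp
    finally show ?thesis .
  qed
  obtain C where C: "C \<ge> 0" "\<And>x. norm x \<ge> 1 \<Longrightarrow> norm (k x) \<le> C / norm x" using wave_bound[OF w] by blast
  have far: "norm (x - y) \<ge> norm x - \<rho>" "norm (x - y) \<ge> 1" if "norm x \<ge> \<rho> + 1" "norm y \<le> \<rho>" for x y :: "real^3"
    using that norm_triangle_ineq2[of x y] by auto
  have kb: "norm (k (x - y)) \<le> C / (norm x - \<rho>)" if "norm x \<ge> \<rho> + 1" "norm y \<le> \<rho>" for x y
  proof -
    have "norm (k (x - y)) \<le> C / norm (x - y)" by (rule C(2)[OF far(2)[OF that]])
    also have "\<dots> \<le> C / (norm x - \<rho>)"
      using that far[OF that] C(1) by (intro divide_left_mono mult_pos_pos) auto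
    finally show ?thesis .
  qed
  show "(potential k f \<longlongrightarrow> 0) at_infinity"
  proof (rule tendsto_zero_at_infinity)
    fix x :: "real^3" assume x: "norm x \<ge> \<rho> + 1"
    have "norm (potential k f x) \<le> (C / (norm x - \<rho>)) * N"
      unfolding N_def by (rule norm_potential_le[OF c(1)]) (use x kb in auto)
    then show "norm (potential k f x) \<le> (C * N) / (norm x - \<rho>)" by simp
  qed
  obtain C' where C': "C' \<ge> 0" "\<And>x i. norm x \<ge> 1 \<Longrightarrow>
      norm (partial i k x - \<i> * of_real (\<kappa> * (x$i / norm x)) * k x) \<le> C' / (norm x)\<^sup>2"
    using wave_partial_bound[OF w] by blast
  show "((\<lambda>x. (\<Sum>i\<in>UNIV. x$i *\<^sub>R potential (partial i k) f x) - \<i> * of_real (\<kappa> * norm x) * potential k f x) \<longlongrightarrow> 0) at_infinity"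
  proof (rule tendsto_zero_at_infinity)
    fix x :: "real^3" assume x: "norm x \<ge> 2 * \<rho> + 1"
    then have x1: "norm x \<ge> \<rho> + 1" and x0: "norm x > \<rho>" using \<rho> by auto
    define l where "l z = (\<Sum>i\<in>UNIV. x$i *\<^sub>R partial i k z) - \<i> * of_real (\<kappa> * norm x) * k z" for z
    have cl: "continuous_on (-{0}) l" unfolding l_def by (intro continuous_intros c)
    have "(\<Sum>i\<in>UNIV. x$i *\<^sub>R potential (partial i k) f x) - \<i> * of_real (\<kappa> * norm x) * potential k f x = potential l f x"
    proof -
      have "l (x - y) * f y = (\<Sum>i\<in>UNIV. x$i *\<^sub>R (partial i k (x - y) * f y)) - \<i> * of_real (\<kappa> * norm x) * (k (x - y) * f y)" for y
        by (simp add: l_def left_diff_distrib sum_distrib_right)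
      then show ?thesis
        unfolding potential_def
        by (simp add: Bochner_Integration.integral_diff Bochner_Integration.integral_sum Bochner_Integration.integrable_sum integrable_scaleR_right integrable_potential[OF c(1) x0]
            integrable_potential[OF c(2) x0] integral_scaleR_right)
    qed
    also have "norm \<dots> \<le> ((2 * \<kappa> * \<rho> * C + 6 * C') / (norm x - \<rho>)) * N"
      unfolding N_def
    proof (rule norm_potential_le[OF cl x0])
      fix y :: "real^3" assume y: "norm y \<le> \<rho>"
      define d where "d = x - y"
      define s where "s = (\<Sum>i\<in>UNIV. x$i * (d$i / norm d))"
      have d1: "norm d \<ge> norm x - \<rho>" "norm d \<ge> 1" using far[OF x1 y] by (auto simp: d_def)
      then have d0: "norm d > 0" by linarith
      have sd: "s = (x \<bullet> d) / norm d" by (simp add: s_def inner_vec_def sum_divide_distrib)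
      have "x \<bullet> d = norm d * norm d + y \<bullet> d"
      proof -
        have "x = d + y" by (simp add: d_def)
        then show ?thesis by (metis inner_add_left power2_eq_square power2_norm_eq_inner)
      qed
      then have s': "s = norm d + (y \<bullet> d) / norm d" using d0 by (simp add: sd add_divide_distrib)
      have "\<bar>(y \<bullet> d) / norm d\<bar> \<le> norm y" using Cauchy_Schwarz_ineq2[of y d] d0 by (simp add: abs_divide field_simps)
      moreover have "\<bar>norm d - norm x\<bar> \<le> norm y"
        using norm_triangle_ineq3[of d x] by (simp add: d_def)
      ultimately have sb: "\<bar>s - norm x\<bar> \<le> 2 * \<rho>" using s' y by linarith
      have le: "l d = \<i> * of_real (\<kappa> * (s - norm x)) * k d + (\<Sum>i\<in>UNIV. x$i *\<^sub>R (partial i k d - \<i> * of_real (\<kappa> * (d$i / norm d)) * k d))"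
        by (simp add: l_def s_def scaleR_diff_right sum_subtractf scaleR_conv_of_real sum_distrib_left sum_distrib_right algebra_simps)
      have t1: "norm (\<i> * of_real (\<kappa> * (s - norm x)) * k d) \<le> 2 * \<kappa> * \<rho> * C / (norm x - \<rho>)"
      proof -
        have "norm (\<i> * of_real (\<kappa> * (s - norm x)) * k d) = (\<kappa> * \<bar>s - norm x\<bar>) * norm (k d)"
          using \<kappa> by (simp add: norm_mult abs_mult del: of_real_mult of_real_diff)
        also have "\<dots> \<le> (\<kappa> * (2 * \<rho>)) * (C / (norm x - \<rho>))"
          using sb \<kappa> \<rho> kb[OF x1 y] by (intro mult_mono) (auto simp: d_def)
        finally show ?thesis by (simp add: mult_ac)
      qed
      have "norm (\<Sum>i\<in>UNIV. x$i *\<^sub>R (partial i k d - \<i> * of_real (\<kappa> * (d$i / norm d)) * k d)) \<le> (\<Sum>i\<in>(UNIV::3 set). 2 * C' / (norm x - \<rho>))"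
      proof (rule sum_norm_le)
        fix i :: 3
        have "norm (x$i *\<^sub>R (partial i k d - \<i> * of_real (\<kappa> * (d$i / norm d)) * k d)) \<le> norm x * (C' / (norm d)\<^sup>2)"
          unfolding norm_scaleR using component_le_norm_cart[of x i] C'(2)[OF d1(2)] by (intro mult_mono) auto
        also have "\<dots> \<le> (2 * (norm x - \<rho>)) * (C' / (norm x - \<rho>)\<^sup>2)"
        proof (rule mult_mono)
          show "C' / (norm d)\<^sup>2 \<le> C' / (norm x - \<rho>)\<^sup>2"
            using d1 x0 C'(1) by (intro divide_left_mono power_mono mult_pos_pos zero_less_power) auto
        qed (use x \<rho> C' in auto)
        also have "\<dots> = 2 * C' / (norm x - \<rho>)"
        proof -
          have t: "t \<noteq> 0 \<Longrightarrow> 2 * t * (C' / t\<^sup>2) = 2 * C' / t" for t :: real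
            by (simp add: power2_eq_square)
          show ?thesis by (rule t) (use x0 in simp)
        qed
        finally show "norm (x$i *\<^sub>R (partial i k d - \<i> * of_real (\<kappa> * (d$i / norm d)) * k d)) \<le> 2 * C' / (norm x - \<rho>)" .
      qed
      then have t2: "norm (\<Sum>i\<in>UNIV. x$i *\<^sub>R (partial i k d - \<i> * of_real (\<kappa> * (d$i / norm d)) * k d)) \<le> 6 * C' / (norm x - \<rho>)"
        by simp
      show "norm (l (x - y)) \<le> (2 * \<kappa> * \<rho> * C + 6 * C') / (norm x - \<rho>)"
        unfolding d_def[symmetric] le add_divide_distrib by (rule norm_triangle_le[OF add_mono[OF t1 t2]])
    qed
    finally show "norm ((\<Sum>i\<in>UNIV. x$i *\<^sub>R potential (partial i k) f x) - \<i> * of_real (\<kappa> * norm x) * potential k f x)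
       \<le> ((2 * \<kappa> * \<rho> * C + 6 * C') * N) / (norm x - \<rho>)" by simp
  qed
qed

end

section \<open>The electric field\<close>

lemma radiating_field_add:
  assumes "radiating_field \<kappa> \<rho> e D H" "radiating_field \<kappa> \<rho> e' D' H'"
  shows "radiating_field \<kappa> \<rho> (\<lambda>x. e x + e' x) (\<lambda>i x. D i x + D' i x) (\<lambda>i j x. H i j x + H' i j x)"
proof -
  interpret a: radiating_field \<kappa> \<rho> e D H by fact
  interpret b: radiating_field \<kappa> \<rho> e' D' H' by fact
  show ?thesis
  proof
    show "0 < \<kappa>" "0 \<le> \<rho>" by (rule a.\<kappa> a.\<rho>)+
    show "C2 {x. norm x > \<rho>} (\<lambda>x. e x + e' x) (\<lambda>i x. D i x + D' i x) (\<lambda>i j x. H i j x + H' i j x)"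
      unfolding C2_def
      using C2D(1,2)[OF a.C2] C2D(1,2)[OF b.C2] C2D(4)[OF a.C2] C2D(4)[OF b.C2]
      by (auto intro!: grad_add continuous_on_add a.cont b.cont)
    show "(\<Sum>i\<in>UNIV. H i i x + H' i i x) = - (of_real (\<kappa>\<^sup>2) * (e x + e' x))" if "norm x > \<rho>" for x
      using a.helmholtz[OF that] b.helmholtz[OF that] by (simp add: sum.distrib algebra_simps)
    show "((\<lambda>x. e x + e' x) \<longlongrightarrow> 0) at_infinity"
      using tendsto_add[OF a.decay b.decay] by simp
    show "((\<lambda>x. (\<Sum>i\<in>UNIV. x$i *\<^sub>R (D i x + D' i x)) - \<i> * of_real (\<kappa> * norm x) * (e x + e' x)) \<longlongrightarrow> 0) at_infinity"
      using tendsto_add[OF a.sommerfeld b.sommerfeld]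
      by (simp add: scaleR_add_right sum.distrib algebra_simps)
  qed
qed

lemma radiating_field_sum:
  assumes "\<And>j::3. radiating_field \<kappa> \<rho> (e j) (D j) (H j)"
  shows "radiating_field \<kappa> \<rho> (\<lambda>x. \<Sum>j\<in>UNIV. e j x) (\<lambda>i x. \<Sum>j\<in>UNIV. D j i x) (\<lambda>i l x. \<Sum>j\<in>UNIV. H j i l x)"
  unfolding sum_3 by (intro radiating_field_add assms)

text \<open>The entries of the dyadic Green tensor as functions of the difference of its arguments. The factor for the diagonal
makes each entry a linear combination of waves.\<close>

definition maxwell_kernel :: "real \<Rightarrow> 3 \<Rightarrow> 3 \<Rightarrow> real^3 \<Rightarrow> complex" where
  "maxwell_kernel \<kappa> i j z = (if i = j then 1 else 0) * outgoing_wave \<kappa> z +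
     of_real (1 / \<kappa>\<^sup>2) * partial i (partial j (outgoing_wave \<kappa>)) z"

lemma helmholtz_wave_maxwell: "helmholtz_wave \<kappa> (maxwell_kernel \<kappa> i j)"
  unfolding maxwell_kernel_def[abs_def]
  by (intro helmholtz_wave_lincomb helmholtz_wave_partial helmholtz_wave_outgoing)

lemma grad_translate:
  assumes "grad (-{0}) f D"
  shows "grad (-{y}) (\<lambda>z. f (z - y)) (\<lambda>i z. D i (z - y))"
  unfolding grad_def
proof
  fix z assume "z \<in> -{y}"
  then have "z - y \<in> -{0}" by simp
  then show "((\<lambda>z. f (z - y)) has_derivative (\<lambda>h. \<Sum>i\<in>UNIV. h$i *\<^sub>R D i (z - y))) (at z)"
    by (intro has_derivative_compose[where f = "\<lambda>z. z - y" and g = f, OF _ gradD[OF assms]])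
       (auto intro!: derivative_eq_intros)
qed

lemma maxwell_green_eq_kernel:
  assumes "x \<noteq> y"
  shows "maxwell_green \<kappa> x y $ i $ j = maxwell_kernel \<kappa> i j (x - y)"
proof -
  have w: "wave \<kappa> (outgoing_wave \<kappa>)" using helmholtz_wave_outgoing by (simp add: helmholtz_wave_def)
  have h: "(\<lambda>z. helmholtz_green \<kappa> z y) = (\<lambda>z. outgoing_wave \<kappa> (z - y))"
    by (simp add: helmholtz_green_def outgoing_wave_def dist_norm)
  have 1: "partial j (\<lambda>z. helmholtz_green \<kappa> z y) z = partial j (outgoing_wave \<kappa>) (z - y)" if "z \<noteq> y" for z
    unfolding h using partial_eq_grad[OF grad_translate[OF wave_grad[OF w]]] that by simp
  have g2: "grad (-{y}) (\<lambda>z. partial j (outgoing_wave \<kappa>) (z - y)) (\<lambda>i z. partial i (partial j (outgoing_wave \<kappa>)) (z - y))"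
    by (rule grad_translate[OF wave_grad[OF wave_partial[OF w]]])
  have "partial i (partial j (\<lambda>z. helmholtz_green \<kappa> z y)) x = partial i (\<lambda>z. partial j (outgoing_wave \<kappa>) (z - y)) x"
    by (rule partial_cong_open[OF g2, symmetric]) (use assms 1 in auto)
  also have "\<dots> = partial i (partial j (outgoing_wave \<kappa>)) (x - y)"
    using partial_eq_grad[OF g2] assms by simp
  finally have "partial i (partial j (\<lambda>z. helmholtz_green \<kappa> z y)) x = partial i (partial j (outgoing_wave \<kappa>)) (x - y)" .
  moreover have "helmholtz_green \<kappa> x y = outgoing_wave \<kappa> (x - y)" using fun_cong[OF h, of x] by simp
  ultimately show ?thesis by (simp add: maxwell_green_def maxwell_kernel_def)
qed

text \<open>The complement of the essential support is a union of possibly uncountably many open sets on which the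
function vanishes almost everywhere; by Lindelof's theorem countably many of them suffice.\<close>

lemma AE_zero_off_ess_support: "AE y in lebesgue. y \<notin> ess_support J \<longrightarrow> J y = 0"
proof -
  define \<U> where "\<U> = {U. open U \<and> (AE y in lebesgue. y \<in> U \<longrightarrow> J y = 0)}"
  obtain \<V> where V: "\<V> \<subseteq> \<U>" "countable \<V>" "\<Union>\<V> = \<Union>\<U>"
    by (rule Lindelof_openin[of \<U> UNIV]) (auto simp: \<U>_def)
  have "AE y in lebesgue. \<forall>U\<in>\<V>. y \<in> U \<longrightarrow> J y = 0"
    using V(1) by (subst AE_ball_countable[OF V(2)]) (auto simp: \<U>_def)
  then show ?thesis
  proof (rule AE_mp, intro AE_I2 impI)
    fix y assume "\<forall>U\<in>\<V>. y \<in> U \<longrightarrow> J y = 0" "y \<notin> ess_support J"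
    then show "J y = 0" using V(3) by (auto simp: ess_support_def \<U>_def)
  qed
qed

lemma vec_eq_sum_axis: "v = (\<Sum>i\<in>UNIV. axis i (v$i))" for v :: "complex^3"
  by (simp add: vec_eq_iff axis_def sum_3 forall_3)

text \<open>A vector is the sum of its components on the axes, which transfers integrability and differentiability from the
components to the vector.\<close>

lemma bounded_linear_axis: "bounded_linear (axis i :: complex \<Rightarrow> complex^3)"
  by (rule linear_conv_bounded_linear[THEN iffD1], rule linearI) (auto simp: vec_eq_iff axis_def)

lemma integrable_vec:
  fixes g :: "'a \<Rightarrow> complex^3"
  assumes "\<And>i. integrable M (\<lambda>y. g y $ i)"
  shows "integrable M g"
proof -
  have "integrable M (\<lambda>y. \<Sum>i\<in>UNIV. axis i (g y $ i))"
    by (intro Bochner_Integration.integrable_sum integrable_bounded_linear[OF bounded_linear_axis] assms)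
  then show ?thesis by (simp add: vec_eq_sum_axis[symmetric])
qed

lemma has_derivative_vec:
  fixes E :: "real^3 \<Rightarrow> complex^3"
  assumes "\<And>i. ((\<lambda>x. E x $ i) has_derivative (\<lambda>h. E' h $ i)) F"
  shows "(E has_derivative E') F"
proof -
  have "((\<lambda>x. \<Sum>i\<in>UNIV. axis i (E x $ i)) has_derivative (\<lambda>h. \<Sum>i\<in>UNIV. axis i (E' h $ i))) F"
    by (intro has_derivative_sum bounded_linear.has_derivative[OF bounded_linear_axis] assms)
  then show ?thesis by (simp add: vec_eq_sum_axis[symmetric])
qed

text \<open>A component of the source, set to zero on the null set off the essential support where it may fail to vanish.\<close>

definition truncated_component :: "(real^3 \<Rightarrow> complex^3) \<Rightarrow> 3 \<Rightarrow> real^3 \<Rightarrow> complex" where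
  "truncated_component J j y = (if y \<in> ess_support J then J y $ j else 0)"

text \<open>The gap between \<open>\<rho>\<close> and \<open>R\<close> leaves a neighbourhood of the sphere on which the field is regular, as the derivatives in
\<open>V_field\<close> require.\<close>

lemma compact_subset_smaller_ball:
  assumes "compact K" "K \<subseteq> ball 0 R" "R > 0"
  shows "\<exists>\<rho>\<ge>0. \<rho> < R \<and> K \<subseteq> cball (0::real^3) \<rho>"
proof (cases "K = {}")
  case False
  have "continuous_on K norm" by (intro continuous_intros)
  then obtain z where "z \<in> K" "\<And>y. y \<in> K \<Longrightarrow> norm y \<le> norm z"
    using continuous_attains_sup[OF assms(1) False, of norm] by blast
  then show ?thesis using assms(2) by (intro exI[of _ "norm z"]) auto
qed (use assms in auto)

lemma source_truncated_component:
  assumes J: "J \<in> L2_fields (ball 0 R)" and K: "compact (ess_support J)" "ess_support J \<subseteq> ball 0 R"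
    and \<rho>: "\<rho> \<ge> 0" "ess_support J \<subseteq> cball 0 \<rho>"
  shows "source \<rho> (truncated_component J j)"
proof
  have m: "J \<in> borel_measurable (lebesgue_on (ball 0 R))"
    and i: "integrable (lebesgue_on (ball 0 R)) (\<lambda>x. (norm (J x))\<^sup>2)"
    using J by (auto simp: L2_fields_def)
  have mj: "(\<lambda>y. J y $ j) \<in> borel_measurable (lebesgue_on (ball 0 R))"
    using borel_measurable_continuous_onI[OF linear_continuous_on[OF bounded_linear_vec_nth]] m
    by (rule measurable_compose_rev)
  have one: "integrable (lebesgue_on (ball 0 R)) (\<lambda>_::real^3. 1::real)"
    by (rule finite_measure.integrable_const, rule finite_measureI)
       (use emeasure_lborel_ball_finite[of "0::real^3" R] in \<open>simp add: emeasure_restrict_space less_top[symmetric]\<close>)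
  have "integrable (lebesgue_on (ball 0 R)) (\<lambda>y. J y $ j)"
  proof (rule Bochner_Integration.integrable_bound[OF Bochner_Integration.integrable_add[OF one i] mj], intro AE_I2)
    fix y
    have "norm (J y $ j) \<le> norm (J y)" by (rule Finite_Cartesian_Product.norm_nth_le)
    also have "\<dots> \<le> 1 + (norm (J y))\<^sup>2"
    proof -
      have "0 \<le> (norm (J y) - 1)\<^sup>2" by simp
      then have "2 * norm (J y) \<le> 1 + (norm (J y))\<^sup>2" by (simp add: power2_eq_square algebra_simps)
      then show ?thesis using norm_ge_zero[of "J y"] by linarith
    qed
    finally show "norm (J y $ j) \<le> norm (1 + (norm (J y))\<^sup>2)" by simp
  qed
  then have "integrable lebesgue (\<lambda>y. indicator (ball 0 R) y *\<^sub>R (J y $ j))"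
    by (subst (asm) integrable_restrict_space) auto
  then have "integrable lebesgue (\<lambda>y. indicator (ess_support J) y *\<^sub>R (indicator (ball 0 R) y *\<^sub>R (J y $ j)))"
    by (rule integrable_mult_indicator[rotated]) (rule fmeasurableD[OF lmeasurable_compact[OF K(1)]])
  also have "(\<lambda>y. indicator (ess_support J) y *\<^sub>R (indicator (ball 0 R) y *\<^sub>R (J y $ j))) = truncated_component J j"
    using K(2) by (auto simp: fun_eq_iff truncated_component_def indicator_def)
  finally show "integrable lebesgue (truncated_component J j)" .
  show "truncated_component J j y = 0" if "norm y > \<rho>" for y
    using \<rho>(2) that by (auto simp: truncated_component_def)
qed (rule \<rho>(1))

lemma electric_field_nth:
  assumes J: "J \<in> L2_fields (ball 0 R)" and K: "compact (ess_support J)" "ess_support J \<subseteq> ball 0 R"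
    and \<rho>: "\<rho> \<ge> 0" "ess_support J \<subseteq> cball 0 \<rho>" and x: "norm x > \<rho>"
  shows "electric_field \<kappa> R J x $ i = (\<Sum>j\<in>UNIV. potential (maxwell_kernel \<kappa> i j) (truncated_component J j) x)"
proof -
  let ?f = "truncated_component J"
  define g where "g y = (\<chi> i. \<Sum>j\<in>UNIV. maxwell_kernel \<kappa> i j (x - y) * ?f j y)" for y
  have ck: "continuous_on (-{0}) (maxwell_kernel \<kappa> i j)" for i j
    by (rule wave_continuous[OF helmholtz_wave_maxwell[unfolded helmholtz_wave_def, THEN conjunct1]])
  have ip: "integrable lebesgue (\<lambda>y. maxwell_kernel \<kappa> i j (x - y) * ?f j y)" for i j
    by (rule source.integrable_potential[OF source_truncated_component[OF J K \<rho>] ck x])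
  have ig: "integrable lebesgue g"
    by (rule integrable_vec) (simp add: g_def ip)
  have AE: "AE y in lebesgue. g y = indicator (ball 0 R) y *\<^sub>R (maxwell_green \<kappa> x y *v J y)"
  proof (rule AE_mp[OF AE_zero_off_ess_support[of J]], intro AE_I2 impI)
    fix y assume y: "y \<notin> ess_support J \<longrightarrow> J y = 0"
    show "g y = indicator (ball 0 R) y *\<^sub>R (maxwell_green \<kappa> x y *v J y)"
    proof (cases "y \<in> ess_support J")
      case True
      then have "y \<in> ball 0 R" "x \<noteq> y" using K(2) \<rho>(2) x by auto
      then show ?thesis
        using True by (simp add: g_def vec_eq_iff matrix_vector_mult_def truncated_component_def maxwell_green_eq_kernel)
    next
      case False
      with y have "J y = 0" by simp
      then have "maxwell_green \<kappa> x y *v J y = 0" by simp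
      then show ?thesis
        using False by (simp only: scaleR_zero_right) (simp add: g_def vec_eq_iff truncated_component_def)
    qed
  qed
  have "electric_field \<kappa> R J x = (LINT y|lebesgue. g y)"
    unfolding electric_field_def set_lebesgue_integral_def
  proof (rule integral_cong_AE[symmetric])
    show "g \<in> borel_measurable lebesgue" using ig by (rule borel_measurable_integrable)
    then show "(\<lambda>y. indicator (ball 0 R) y *\<^sub>R (maxwell_green \<kappa> x y *v J y)) \<in> borel_measurable lebesgue"
      using AE by (rule borel_measurable_AE)
  qed (rule AE)
  then have "electric_field \<kappa> R J x $ i = (LINT y|lebesgue. g y $ i)"
    using integral_bounded_linear[OF bounded_linear_vec_nth ig] by simp
  also have "\<dots> = (\<Sum>j\<in>UNIV. potential (maxwell_kernel \<kappa> i j) (?f j) x)"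
    unfolding potential_def g_def by (simp add: Bochner_Integration.integral_sum ip)
  finally show ?thesis .
qed

lemma V_field_nth:
  assumes E: "\<And>x i. norm x > \<rho> \<Longrightarrow> E x $ i = e i x"
    and e: "\<And>i. radiating_field \<kappa> \<rho> (e i) (D i) (H i)"
    and R: "R > \<rho>" and \<rho>: "\<rho> \<ge> 0"
  shows "V_field R E \<xi> $ i = of_real (R\<^sup>2) * surf (\<lambda>\<omega>. exp (- \<i> * of_real (\<xi> \<bullet> (R *\<^sub>R \<omega>))) *
     (\<i> * of_real (\<xi> \<bullet> \<omega>) * e i (R *\<^sub>R \<omega>) - radial_deriv (D i) R \<omega>))"
proof -
  have R0: "R > 0" using R \<rho> by simp
  have dE: "frechet_derivative E (at x) h $ i = (\<Sum>a\<in>UNIV. h$a *\<^sub>R D i a x)" if x: "norm x > \<rho>" for x h i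
  proof -
    have op: "open {x::real^3. norm x > \<rho>}" by (intro open_Collect_less continuous_intros)
    have "(E has_derivative (\<lambda>h. \<chi> i. \<Sum>a\<in>UNIV. h$a *\<^sub>R D i a x)) (at x)"
    proof (rule has_derivative_vec)
      fix i
      have "(e i has_derivative (\<lambda>h. \<Sum>a\<in>UNIV. h$a *\<^sub>R D i a x)) (at x)"
        by (rule gradD[OF C2D(1)[OF radiating_field.C2[OF e]]]) (use x in simp)
      then show "((\<lambda>x. E x $ i) has_derivative (\<lambda>h. (\<chi> i. \<Sum>a\<in>UNIV. h$a *\<^sub>R D i a x) $ i)) (at x)"
        unfolding vec_lambda_beta
        by (rule has_derivative_transform_within_open[OF _ op]) (use x E in auto)
    qed
    from frechet_derivative_at[OF this, symmetric] show ?thesis by simp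
  qed
  define G where "G i \<omega> = exp (- \<i> * of_real (\<xi> \<bullet> (R *\<^sub>R \<omega>))) *
     (\<i> * of_real (\<xi> \<bullet> \<omega>) * e i (R *\<^sub>R \<omega>) - radial_deriv (D i) R \<omega>)" for i \<omega>
  have cG: "continuous_on (sphere 0 1) (G i)" for i
    unfolding G_def by (intro continuous_intros radiating_field.cont_sphere(1)[OF e R] radiating_field.cont_radial[OF e R])
  define F where "F y = exp (- \<i> * of_real (\<xi> \<bullet> y)) *s ((\<i> * of_real (\<xi> \<bullet> unit_normal R y)) *s E y
        - frechet_derivative E (at y) (unit_normal R y))" for y
  have F: "F (R *\<^sub>R \<omega>) $ i = G i \<omega>" if w: "norm \<omega> = 1" for \<omega> i
  proof -
    have n: "norm (R *\<^sub>R \<omega>) > \<rho>" using w R R0 by simp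
    have u: "unit_normal R (R *\<^sub>R \<omega>) = \<omega>" using R0 by (simp add: unit_normal_def)
    show ?thesis
      by (simp add: F_def G_def u E[OF n] dE[OF n] radial_deriv_def right_diff_distrib)
  qed
  let ?B = "{0..pi} \<times> {0..2*pi}"
  let ?I = "\<lambda>(\<theta>, \<phi>). (R\<^sup>2 * sin \<theta>) *\<^sub>R F (spherical_point R \<theta> \<phi>)"
  have B: "?B = cbox (0,0) (pi, 2*pi)" by (simp add: cbox_Pair_eq)
  have Ii: "?I z $ i = of_real (R\<^sup>2) * (\<lambda>(\<theta>, \<phi>). sin \<theta> *\<^sub>R G i (sph \<theta> \<phi>)) z" for z i
  proof -
    have "(R\<^sup>2 * s) *\<^sub>R c = of_real (R\<^sup>2) * (s *\<^sub>R c)" for s and c :: complex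
      by (simp add: scaleR_conv_of_real)
    then show ?thesis by (simp add: case_prod_beta' spherical_point_scaleR[of R] F)
  qed
  have cI: "continuous_on ?B ?I"
  proof -
    have "continuous_on ?B (\<lambda>z. \<chi> i. of_real (R\<^sup>2) * (\<lambda>(\<theta>, \<phi>). sin \<theta> *\<^sub>R G i (sph \<theta> \<phi>)) z)"
      by (intro continuous_intros continuous_on_surf_integrand cG)
    moreover have "(\<lambda>z. \<chi> i. of_real (R\<^sup>2) * (\<lambda>(\<theta>, \<phi>). sin \<theta> *\<^sub>R G i (sph \<theta> \<phi>)) z) = ?I"
      using Ii by (simp only: fun_eq_iff vec_eq_iff vec_lambda_beta simp_thms)
    ultimately show ?thesis by (simp only:)
  qed
  have "set_integrable lborel ?B ?I"
    unfolding set_integrable_def by (rule borel_integrable_compact[OF _ cI]) (simp add: B)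
  then have "sphere_integral R F = integral ?B ?I"
    unfolding sphere_integral_def by (rule set_borel_integral_eq_integral(2))
  moreover have "?I integrable_on ?B" unfolding B by (rule integrable_continuous) (use cI B in simp)
  ultimately have "sphere_integral R F $ i = integral ?B (\<lambda>z. ?I z $ i)"
    using integral_linear[OF _ bounded_linear_vec_nth, of ?I ?B i] by (simp add: o_def)
  also have "\<dots> = of_real (R\<^sup>2) * surf (G i)"
    unfolding Ii surf_def B by (rule integral_mult_right)
  finally show ?thesis unfolding V_field_def F_def G_def .
qed

theorem theorem3p8:
  fixes \<kappa> R :: real and J :: "real^3 \<Rightarrow> complex^3"
  assumes "\<kappa> > 0" and "R > 0"
    and "J \<in> H_div_grad (ball 0 R)"
    and "compact (ess_support J)" and "ess_support J \<subseteq> ball 0 R"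
  shows "nonradiating \<kappa> R J \<longleftrightarrow>
    (\<forall>\<xi>. norm \<xi> = \<kappa> \<longrightarrow> V_field R (electric_field \<kappa> R J) \<xi> = 0)"
proof -
  have J: "J \<in> L2_fields (ball 0 R)" using assms(3) by (simp add: H_div_grad_def)
  obtain \<rho> where \<rho>: "\<rho> \<ge> 0" "\<rho> < R" "ess_support J \<subseteq> cball 0 \<rho>"
    using compact_subset_smaller_ball[OF assms(4,5,2)] by blast
  let ?k = "maxwell_kernel \<kappa>" and ?f = "truncated_component J"
  define e where "e i x = (\<Sum>j\<in>UNIV. potential (?k i j) (?f j) x)" for i x
  define D where "D i a x = (\<Sum>j\<in>UNIV. potential (partial a (?k i j)) (?f j) x)" for i a x
  define H where "H i a b x = (\<Sum>j\<in>UNIV. potential (partial b (partial a (?k i j))) (?f j) x)" for i a b x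
  have E: "electric_field \<kappa> R J x $ i = e i x" if "norm x > \<rho>" for x i
    unfolding e_def by (rule electric_field_nth[OF J assms(4,5) \<rho>(1,3) that])
  have e: "radiating_field \<kappa> \<rho> (e i) (D i) (H i)" for i
    unfolding e_def[abs_def] D_def[abs_def] H_def[abs_def]
    by (intro radiating_field_sum source.radiating_potential[OF source_truncated_component[OF J assms(4,5) \<rho>(1,3)] assms(1)] helmholtz_wave_maxwell)
  have V: "V_field R (electric_field \<kappa> R J) \<xi> $ i = of_real (R\<^sup>2) * surf (\<lambda>\<omega>. exp (- \<i> * of_real (\<xi> \<bullet> (R *\<^sub>R \<omega>))) *
     (\<i> * of_real (\<xi> \<bullet> \<omega>) * e i (R *\<^sub>R \<omega>) - radial_deriv (D i) R \<omega>))" for \<xi> i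
    by (rule V_field_nth[OF E e \<rho>(2,1)])
  show ?thesis
  proof
    assume nr: "nonradiating \<kappa> R J"
    have e0: "e i x = 0" if "norm x \<ge> R" for i x
      using nr that E[of x i] \<rho> by (simp add: nonradiating_def)
    \<comment> \<open>The field is differentiable across the sphere, so its radial derivative is determined by the values outside.\<close>
    have r0: "radial_deriv (D i) R \<omega> = 0" if w: "norm \<omega> = 1" for i \<omega>
    proof -
      have "((\<lambda>t. t *\<^sub>R \<omega>) has_vector_derivative \<omega>) (at R within {R..})"
        by (auto intro!: derivative_eq_intros)
      from grad_chain[OF C2D(1)[OF radiating_field.C2[OF e]] _ this, of i]
      have "((\<lambda>t. e i (t *\<^sub>R \<omega>)) has_vector_derivative radial_deriv (D i) R \<omega>) (at R within {R..})"
        using w \<rho> by (simp add: radial_deriv_def)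
      then have "((\<lambda>_. 0) has_vector_derivative radial_deriv (D i) R \<omega>) (at R within {R..})"
        by (rule has_vector_derivative_transform[rotated 2]) (use e0 w assms(2) in auto)
      moreover have "((\<lambda>_. 0) has_vector_derivative 0) (at R within {R..})" by simp
      ultimately show ?thesis
        by (rule vector_derivative_unique_within[rotated]) (simp add: at_within_Ici_at_right)
    qed
    have "V_field R (electric_field \<kappa> R J) \<xi> $ i = of_real (R\<^sup>2) * surf (\<lambda>_. 0)" for \<xi> i
      unfolding V by (intro arg_cong2[of _ _ _ _ "(*)"] refl surf_cong) (use e0 r0 assms(2) in simp)
    then show "\<forall>\<xi>. norm \<xi> = \<kappa> \<longrightarrow> V_field R (electric_field \<kappa> R J) \<xi> = 0"
      by (simp add: vec_eq_iff)
  next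
    assume V0: "\<forall>\<xi>. norm \<xi> = \<kappa> \<longrightarrow> V_field R (electric_field \<kappa> R J) \<xi> = 0"
    have "e i x = 0" if x: "norm x \<ge> R" for i x
    proof (rule radiating_field.zero_outside[OF e \<rho>(2) _ x])
      fix \<xi> :: "real^3" assume \<xi>: "norm \<xi> = 1"
      have "norm (\<kappa> *\<^sub>R \<xi>) = \<kappa>" using \<xi> assms(1) by simp
      then have "V_field R (electric_field \<kappa> R J) (\<kappa> *\<^sub>R \<xi>) $ i = 0" using V0 by simp
      then show "surf (\<lambda>\<omega>. exp (- \<i> * of_real (\<xi> \<bullet> (R *\<^sub>R \<kappa> *\<^sub>R \<omega>))) *
        (\<i> * of_real (\<kappa> * (\<xi> \<bullet> \<omega>)) * e i (R *\<^sub>R \<omega>) - radial_deriv (D i) R \<omega>)) = 0"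
        unfolding V using assms(2) by (simp add: mult_ac)
    qed
    then show "nonradiating \<kappa> R J"
      using E \<rho> by (simp add: nonradiating_def vec_eq_iff)
  qed
qed

end
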